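(* Let $\Lambda$ be one of the following two $\mathfrak o_F$-lattice sequences in $V$: (1) $\Lambda(2i)=\varpi^iN_0$, $\Lambda(2i+1)=\varpi^iN_2$ ($i\in\mathbf Z$); (2) $\Lambda(2i)=\varpi^iN_1$, $\Lambda(2i+1)=\varpi^{i+1}N_1^\#$ ($i\in\mathbf Z$). Let $n$ be a positive odd integer, and let $[\Lambda,n,[n/2],\beta]$ and $[\Lambda,n,[n/2],\gamma]$ be skew strata such that $\phi_\beta(X)=\phi_\gamma(X)=(X-a)^2(X-b)^2$ with $a,b\in k_0$, $a\ne b$. Assume that $ab\neq0$ or that $\Lambda$ is the sequence (2). Suppose that there exists an irreducible smooth representation of $G$ containing both $[\Lambda,n,[n/2],\beta]$ and $[\Lambda,n,[n/2],\gamma]$. Then $(P_{\Lambda,[n/2]+1},\psi_\gamma)$ is a $P_{\Lambda,0}$-conjugate of $(P_{\Lambda,[n/2]+1},\psi_\beta)$, i.e. there is $g\in P_{\Lambda,0}$ with $\psi_\gamma(x)=\psi_\beta(gxg^{-1})$ for all $x\in P_{\Lambda,[n/2]+1}$.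
   Context: Let $F_0$ be a non-archimedean local field of odd residual characteristic, with ring of integers $\mathfrak o_0$, maximal ideal $\mathfrak p_0$ and residue field $k_0$ of cardinality $q$. Let $\varepsilon\in\mathfrak o_0^\times$ be a nonsquare and $F=F_0[\sqrt\varepsilon]$ the unramified quadratic extension, with corresponding objects $\mathfrak o_F,\mathfrak p_F,k_F$; $x\mapsto\overline x$ is Galois conjugation, and $\varpi$ is a common uniformizer of $F_0$ and $F$. Let $V=F^4$ (column vectors) with standard basis $e_1,\dots,e_4$, $A=M_4(F)=\mathrm{End}_F(V)$ with matrix units $E_{ij}$, $H=E_{14}+E_{23}+E_{32}+E_{41}$, $f(x,y)={}^t\overline xHy$ on $V$, $\sigma(X)=H^{-1}\,{}^t\overline X H$ on $A$, $G=U(2,2)=\{g\in GL_4(F): g\sigma(g)=1\}$ and $\mathfrak g=\{X\in A: X+\sigma(X)=0\}$. An $\mathfrak o_F$-lattice sequence in $V$ is a function $\Lambda$ from $\mathbf Z$ to the set of $\mathfrak o_F$-lattices in $V$ with $\Lambda(i)\supseteq\Lambda(i+1)$ for all $i$ and for which there is a positive integer $e(\Lambda)$ (the period) with $\varpi\Lambda(i)=\Lambda(i+e(\Lambda))$ for all $i$. For a lattice $L$, $L^\#=\{v\in V: f(v,L)\subset\mathfrak o_F\}$. $\Lambda$ is self-dual if there is an integer $d(\Lambda)$ with $\Lambda(i)^\#=\Lambda(d(\Lambda)-i)$ for all $i$. Put $N_0=\mathfrak o_Fe_1\oplus\mathfrak o_Fe_2\oplus\mathfrak o_Fe_3\oplus\mathfrak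 o_Fe_4$, $N_1=\mathfrak o_Fe_1\oplus\mathfrak o_Fe_2\oplus\mathfrak o_Fe_3\oplus\mathfrak p_Fe_4$, $N_2=\mathfrak o_Fe_1\oplus\mathfrak o_Fe_2\oplus\mathfrak p_Fe_3\oplus\mathfrak p_Fe_4$. For a lattice sequence $\Lambda$ put $\mathfrak a_n(\Lambda)=\{X\in A: X\Lambda(i)\subset\Lambda(i+n)\ \forall i\}$. For $\Lambda$ self-dual put $\mathfrak g_{\Lambda,n}=\mathfrak g\cap\mathfrak a_n(\Lambda)$, $P_{\Lambda,0}=G\cap\mathfrak a_0(\Lambda)$ and $P_{\Lambda,n}=G\cap(1+\mathfrak a_n(\Lambda))$ for $n\ge1$ (an open normal subgroup of $P_{\Lambda,0}$). A stratum is a 4-tuple $[\Lambda,n,r,\beta]$ with $\Lambda$ an $\mathfrak o_F$-lattice sequence in $V$, integers $n>r\ge0$ and $\beta\in\mathfrak a_{-n}(\Lambda)$; it is skew if $\Lambda$ is self-dual and $\beta\in\mathfrak g_{\Lambda,-n}$. With $k=\gcd(e(\Lambda),n)$ put $y_\beta=\varpi^{n/k}\beta^{e(\Lambda)/k}\in\mathfrak a_0(\Lambda)$; its characteristic polynomial $\Phi_\beta(X)$ lies in $\mathfrak o_F[X]$ and $\phi_\beta(X)\in k_F[X]$ denotes its reduction modulo $\mathfrak p_F$. Fix an additive character $\Omega$ of $F_0$ with conductor $\mathfrak p_0$ (trivial on $\mathfrak p_0$, not on $\mathfrak o_0$), and let $\mathrm{tr}_{A/F_0}=\mathrm{tr}_{F/F_0}\circ\mathrm{tr}_{A/F}$.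 For a skew stratum with $n>r\ge[n/2]$, $\psi_\beta(p)=\Omega(\mathrm{tr}_{A/F_0}(\beta(p-1)))$ is a character of $P_{\Lambda,r+1}$ trivial on $P_{\Lambda,n+1}$. A smooth complex representation $\pi$ of $G$ contains $[\Lambda,n,r,\beta]$ (with $n>r\ge[n/2]$) if the restriction of $\pi$ to $P_{\Lambda,r+1}$ contains $\psi_\beta$. *)

theory Defs
  imports "HOL-Analysis.Analysis" "HOL-Computational_Algebra.Polynomial"
begin

section \<open>Local fields and unramified quadratic extensions\<close>

text \<open>A valuation is a function \<open>v :: 'a \<Rightarrow> int\<close> whose value at 0 is irrelevant; \<open>frac_ideal v m\<close>
  is the \<open>m\<close>-th power of the maximal ideal (in particular \<open>m = 0\<close> gives the ring of integers and
  \<open>m = 1\<close> the maximal ideal).\<close>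

definition frac_ideal :: "('a::field \<Rightarrow> int) \<Rightarrow> int \<Rightarrow> 'a set" where
  "frac_ideal v m = {x. x = 0 \<or> v x \<ge> m}"

abbreviation val_ring :: "('a::field \<Rightarrow> int) \<Rightarrow> 'a set" where
  "val_ring v \<equiv> frac_ideal v 0"

abbreviation max_ideal :: "('a::field \<Rightarrow> int) \<Rightarrow> 'a set" where
  "max_ideal v \<equiv> frac_ideal v 1"

text \<open>A field, complete for a normalized discrete valuation, with finite residue field. The residue
  field is given as a type \<open>'r\<close> together with the reduction map \<open>red\<close>, which matters only on the
  ring of integers.\<close>

locale nonarch_local_field =
  fixes v :: "'a::field \<Rightarrow> int" and red :: "'a \<Rightarrow> 'r::field"
  assumes val_mult: "x \<noteq> 0 \<Longrightarrow> y \<noteq> 0 \<Longrightarrow> v (x * y) = v x + v y"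
    and val_add: "x \<noteq> 0 \<Longrightarrow> y \<noteq> 0 \<Longrightarrow> x + y \<noteq> 0 \<Longrightarrow> v (x + y) \<ge> min (v x) (v y)"
    and val_normalized: "\<exists>x. x \<noteq> 0 \<and> v x = 1"
    and complete:
      "(\<forall>m. \<exists>N. \<forall>i\<ge>N. \<forall>j\<ge>N. X i - X j \<in> frac_ideal v m) \<Longrightarrow>
       \<exists>L. \<forall>m. \<exists>N. \<forall>i\<ge>N. (X :: nat \<Rightarrow> 'a) i - L \<in> frac_ideal v m"
    and red_add: "x \<in> val_ring v \<Longrightarrow> y \<in> val_ring v \<Longrightarrow> red (x + y) = red x + red y"
    and red_mult: "x \<in> val_ring v \<Longrightarrow> y \<in> val_ring v \<Longrightarrow> red (x * y) = red x * red y"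
    and red_one: "red 1 = 1"
    and red_surj: "red ` val_ring v = UNIV"
    and red_kernel: "x \<in> val_ring v \<Longrightarrow> red x = 0 \<longleftrightarrow> x \<in> max_ideal v"
    and finite_residue_field: "finite (UNIV :: 'r set)"

text \<open>The base field is the type \<open>'k\<close>, the extension generated by the square root \<open>s\<close> of the
  nonsquare unit \<open>\<epsilon>\<close> is the type \<open>'f\<close>, \<open>\<iota>\<close> is the inclusion and \<open>cj\<close> the Galois conjugation. Both
  normalized valuations are part of the data; that \<open>v\<close> extends \<open>v0\<close> says that the extension is
  unramified.\<close>

locale unramified_quadratic_ext =
  base: nonarch_local_field v0 red0 + ext: nonarch_local_field v red
  for v0 :: "'k::field \<Rightarrow> int" and red0 :: "'k \<Rightarrow> 'r0::field"
    and v :: "'f::field \<Rightarrow> int" and red :: "'f \<Rightarrow> 'r::field" +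
  fixes \<iota> :: "'k \<Rightarrow> 'f" and \<epsilon> :: 'k and s :: 'f and cj :: "'f \<Rightarrow> 'f"
  assumes odd_residue_char: "odd CHAR('r0)"
    and emb_add: "\<iota> (a + b) = \<iota> a + \<iota> b"
    and emb_mult: "\<iota> (a * b) = \<iota> a * \<iota> b"
    and emb_one: "\<iota> 1 = 1"
    and eps_unit: "\<epsilon> \<noteq> 0" "v0 \<epsilon> = 0"
    and eps_nonsquare: "\<nexists>x. x ^ 2 = \<epsilon>"
    and sqrt_eps: "s ^ 2 = \<iota> \<epsilon>"
    and generated: "\<exists>a b. x = \<iota> a + \<iota> b * s"
    and cj_eq: "cj (\<iota> a + \<iota> b * s) = \<iota> a - \<iota> b * s"
    and val_emb: "a \<noteq> 0 \<Longrightarrow> v (\<iota> a) = v0 a"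

definition tr_quadratic :: "('k::field \<Rightarrow> 'f::field) \<Rightarrow> ('f \<Rightarrow> 'f) \<Rightarrow> 'f \<Rightarrow> 'k" where
  "tr_quadratic \<iota> cj x = inv \<iota> (x + cj x)"

definition additive_character_conductor_p :: "('k::field \<Rightarrow> int) \<Rightarrow> ('k \<Rightarrow> complex) \<Rightarrow> bool" where
  "additive_character_conductor_p v0 \<Omega> \<longleftrightarrow>
     (\<forall>x. norm (\<Omega> x) = 1) \<and> (\<forall>x y. \<Omega> (x + y) = \<Omega> x * \<Omega> y) \<and>
     (\<forall>x\<in>max_ideal v0. \<Omega> x = 1) \<and> (\<exists>x\<in>val_ring v0. \<Omega> x \<noteq> 1)"


section \<open>The unitary group U(2,2)\<close>

text \<open>In the index type \<open>4\<close> the numeral \<open>4\<close> equals \<open>0\<close>; its elements are \<open>1, 2, 3, 4\<close>.\<close>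

definition matrix_unit :: "4 \<Rightarrow> 4 \<Rightarrow> 'f::field^4^4" where
  "matrix_unit i j = (\<chi> k l. if k = i \<and> l = j then 1 else 0)"

definition Hmat :: "'f::field^4^4" where
  "Hmat = matrix_unit 1 4 + matrix_unit 2 3 + matrix_unit 3 2 + matrix_unit 4 1"

definition conj_transpose :: "('f::field \<Rightarrow> 'f) \<Rightarrow> 'f^4^4 \<Rightarrow> 'f^4^4" where
  "conj_transpose cj X = transpose (\<chi> i j. cj (X $ i $ j))"

definition herm_form :: "('f::field \<Rightarrow> 'f) \<Rightarrow> 'f^4 \<Rightarrow> 'f^4 \<Rightarrow> 'f" where
  "herm_form cj x y = (\<Sum>i\<in>UNIV. cj (x $ i) * (Hmat *v y) $ i)"

definition adj_inv :: "('f::field \<Rightarrow> 'f) \<Rightarrow> 'f^4^4 \<Rightarrow> 'f^4^4" where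
  "adj_inv cj X = matrix_inv Hmat ** conj_transpose cj X ** Hmat"

definition U22 :: "('f::field \<Rightarrow> 'f) \<Rightarrow> ('f^4^4) set" where
  "U22 cj = {g. invertible g \<and> g ** adj_inv cj g = mat 1}"

definition u22_Lie :: "('f::field \<Rightarrow> 'f) \<Rightarrow> ('f^4^4) set" where
  "u22_Lie cj = {X. X + adj_inv cj X = 0}"


section \<open>Lattice sequences\<close>

definition is_lattice :: "('f::field \<Rightarrow> int) \<Rightarrow> ('f^4) set \<Rightarrow> bool" where
  "is_lattice v L \<longleftrightarrow>
     (\<exists>B. finite B \<and> vec.span B = UNIV \<and>
          L = {\<Sum>b\<in>B. c b *s b | c. \<forall>b\<in>B. c b \<in> val_ring v})"

definition lattice_seq :: "('f::field \<Rightarrow> int) \<Rightarrow> 'f \<Rightarrow> (int \<Rightarrow> ('f^4) set) \<Rightarrow> bool" where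
  "lattice_seq v \<pi> \<Lambda> \<longleftrightarrow>
     (\<forall>i. is_lattice v (\<Lambda> i)) \<and> (\<forall>i. \<Lambda> (i + 1) \<subseteq> \<Lambda> i) \<and>
     (\<exists>e::nat. e > 0 \<and> (\<forall>i. (*s) \<pi> ` \<Lambda> i = \<Lambda> (i + int e)))"

text \<open>The period is unique, since no lattice equals its multiple by a uniformizer.\<close>

definition period :: "'f::field \<Rightarrow> (int \<Rightarrow> ('f^4) set) \<Rightarrow> nat" where
  "period \<pi> \<Lambda> = (THE e. e > 0 \<and> (\<forall>i. (*s) \<pi> ` \<Lambda> i = \<Lambda> (i + int e)))"

definition dual_lattice :: "('f::field \<Rightarrow> int) \<Rightarrow> ('f \<Rightarrow> 'f) \<Rightarrow> ('f^4) set \<Rightarrow> ('f^4) set" where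
  "dual_lattice v cj L = {x. \<forall>y\<in>L. herm_form cj x y \<in> val_ring v}"

definition self_dual :: "('f::field \<Rightarrow> int) \<Rightarrow> ('f \<Rightarrow> 'f) \<Rightarrow> (int \<Rightarrow> ('f^4) set) \<Rightarrow> bool" where
  "self_dual v cj \<Lambda> \<longleftrightarrow> (\<exists>d. \<forall>i. dual_lattice v cj (\<Lambda> i) = \<Lambda> (d - i))"

definition N0 :: "('f::field \<Rightarrow> int) \<Rightarrow> ('f^4) set" where
  "N0 v = {x. x $ 1 \<in> val_ring v \<and> x $ 2 \<in> val_ring v \<and> x $ 3 \<in> val_ring v \<and> x $ 4 \<in> val_ring v}"

definition N1 :: "('f::field \<Rightarrow> int) \<Rightarrow> ('f^4) set" where
  "N1 v = {x. x $ 1 \<in> val_ring v \<and> x $ 2 \<in> val_ring v \<and> x $ 3 \<in> val_ring v \<and> x $ 4 \<in> max_ideal v}"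

definition N2 :: "('f::field \<Rightarrow> int) \<Rightarrow> ('f^4) set" where
  "N2 v = {x. x $ 1 \<in> val_ring v \<and> x $ 2 \<in> val_ring v \<and> x $ 3 \<in> max_ideal v \<and> x $ 4 \<in> max_ideal v}"

definition is_seq1 :: "('f::field \<Rightarrow> int) \<Rightarrow> 'f \<Rightarrow> (int \<Rightarrow> ('f^4) set) \<Rightarrow> bool" where
  "is_seq1 v \<pi> \<Lambda> \<longleftrightarrow>
     (\<forall>i. \<Lambda> (2 * i) = (*s) (\<pi> powi i) ` N0 v \<and> \<Lambda> (2 * i + 1) = (*s) (\<pi> powi i) ` N2 v)"

definition is_seq2 ::
  "('f::field \<Rightarrow> int) \<Rightarrow> ('f \<Rightarrow> 'f) \<Rightarrow> 'f \<Rightarrow> (int \<Rightarrow> ('f^4) set) \<Rightarrow> bool" where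
  "is_seq2 v cj \<pi> \<Lambda> \<longleftrightarrow>
     (\<forall>i. \<Lambda> (2 * i) = (*s) (\<pi> powi i) ` N1 v \<and>
          \<Lambda> (2 * i + 1) = (*s) (\<pi> powi (i + 1)) ` dual_lattice v cj (N1 v))"


section \<open>Filtrations, strata and characters\<close>

definition lat_filtration :: "(int \<Rightarrow> ('f::field^4) set) \<Rightarrow> int \<Rightarrow> ('f^4^4) set" where
  "lat_filtration \<Lambda> n = {X. \<forall>i. (*v) X ` \<Lambda> i \<subseteq> \<Lambda> (i + n)}"

definition Lie_filtration ::
  "('f::field \<Rightarrow> 'f) \<Rightarrow> (int \<Rightarrow> ('f^4) set) \<Rightarrow> int \<Rightarrow> ('f^4^4) set" where
  "Lie_filtration cj \<Lambda> n = u22_Lie cj \<inter> lat_filtration \<Lambda> n"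

definition P_filtration ::
  "('f::field \<Rightarrow> 'f) \<Rightarrow> (int \<Rightarrow> ('f^4) set) \<Rightarrow> nat \<Rightarrow> ('f^4^4) set" where
  "P_filtration cj \<Lambda> n =
     (if n = 0 then U22 cj \<inter> lat_filtration \<Lambda> 0
      else U22 cj \<inter> {mat 1 + X | X. X \<in> lat_filtration \<Lambda> (int n)})"

definition stratum ::
  "('f::field \<Rightarrow> int) \<Rightarrow> 'f \<Rightarrow> (int \<Rightarrow> ('f^4) set) \<Rightarrow> nat \<Rightarrow> nat \<Rightarrow> 'f^4^4 \<Rightarrow> bool" where
  "stratum v \<pi> \<Lambda> n r \<beta> \<longleftrightarrow> lattice_seq v \<pi> \<Lambda> \<and> n > r \<and> \<beta> \<in> lat_filtration \<Lambda> (- int n)"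

definition skew_stratum ::
  "('f::field \<Rightarrow> int) \<Rightarrow> ('f \<Rightarrow> 'f) \<Rightarrow> 'f \<Rightarrow> (int \<Rightarrow> ('f^4) set) \<Rightarrow> nat \<Rightarrow> nat \<Rightarrow> 'f^4^4 \<Rightarrow> bool"
  where
  "skew_stratum v cj \<pi> \<Lambda> n r \<beta> \<longleftrightarrow>
     stratum v \<pi> \<Lambda> n r \<beta> \<and> self_dual v cj \<Lambda> \<and> \<beta> \<in> Lie_filtration cj \<Lambda> (- int n)"

definition matrix_power :: "'f::field^4^4 \<Rightarrow> nat \<Rightarrow> 'f^4^4" where
  "matrix_power X m = (((**) X) ^^ m) (mat 1)"

definition charpoly :: "'f::field^4^4 \<Rightarrow> 'f poly" where
  "charpoly X = det (mat [:0, 1:] - (\<chi> i j. [:X $ i $ j:]))"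

definition y_elt :: "'f::field \<Rightarrow> (int \<Rightarrow> ('f^4) set) \<Rightarrow> nat \<Rightarrow> 'f^4^4 \<Rightarrow> 'f^4^4" where
  "y_elt \<pi> \<Lambda> n \<beta> =
     (let e = period \<pi> \<Lambda>; k = gcd e n
      in mat (\<pi> ^ (n div k)) ** matrix_power \<beta> (e div k))"

definition phi_poly ::
  "('f::field \<Rightarrow> 'r::field) \<Rightarrow> 'f \<Rightarrow> (int \<Rightarrow> ('f^4) set) \<Rightarrow> nat \<Rightarrow> 'f^4^4 \<Rightarrow> 'r poly" where
  "phi_poly red \<pi> \<Lambda> n \<beta> = map_poly red (charpoly (y_elt \<pi> \<Lambda> n \<beta>))"

definition psi ::
  "('k::field \<Rightarrow> 'f::field) \<Rightarrow> ('f \<Rightarrow> 'f) \<Rightarrow> ('k \<Rightarrow> complex) \<Rightarrow> 'f^4^4 \<Rightarrow> 'f^4^4 \<Rightarrow> complex" where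
  "psi \<iota> cj \<Omega> \<beta> p = \<Omega> (tr_quadratic \<iota> cj (trace (\<beta> ** (p - mat 1))))"


section \<open>Smooth representations\<close>

text \<open>Openness in \<open>U22\<close> for the topology induced by the valuation topology on matrix entries.\<close>

definition open_in_U22 ::
  "('f::field \<Rightarrow> int) \<Rightarrow> ('f \<Rightarrow> 'f) \<Rightarrow> ('f^4^4) set \<Rightarrow> bool" where
  "open_in_U22 v cj S \<longleftrightarrow>
     S \<subseteq> U22 cj \<and>
     (\<forall>g\<in>S. \<exists>m. \<forall>h\<in>U22 cj. (\<forall>i j. h $ i $ j - g $ i $ j \<in> frac_ideal v m) \<longrightarrow> h \<in> S)"

text \<open>A representation of \<open>U22\<close> on the complex vector space given by the type \<open>'v\<close> with scalar
  multiplication \<open>scl\<close>; only the values of \<open>\<rho>\<close> on \<open>U22\<close> matter.\<close>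

definition U22_rep ::
  "('f::field \<Rightarrow> 'f) \<Rightarrow> (complex \<Rightarrow> 'v::ab_group_add \<Rightarrow> 'v) \<Rightarrow> ('f^4^4 \<Rightarrow> 'v \<Rightarrow> 'v) \<Rightarrow> bool" where
  "U22_rep cj scl \<rho> \<longleftrightarrow>
     vector_space scl \<and>
     (\<forall>g\<in>U22 cj. Vector_Spaces.linear scl scl (\<rho> g)) \<and>
     \<rho> (mat 1) = id \<and>
     (\<forall>g\<in>U22 cj. \<forall>h\<in>U22 cj. \<rho> (g ** h) = \<rho> g \<circ> \<rho> h)"

definition smooth_rep ::
  "('f::field \<Rightarrow> int) \<Rightarrow> ('f \<Rightarrow> 'f) \<Rightarrow> (complex \<Rightarrow> 'v::ab_group_add \<Rightarrow> 'v) \<Rightarrow>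
   ('f^4^4 \<Rightarrow> 'v \<Rightarrow> 'v) \<Rightarrow> bool" where
  "smooth_rep v cj scl \<rho> \<longleftrightarrow>
     U22_rep cj scl \<rho> \<and>
     (\<forall>x. open_in_U22 v cj {g \<in> U22 cj. \<rho> g x = x})"

definition irreducible_rep ::
  "('f::field \<Rightarrow> 'f) \<Rightarrow> (complex \<Rightarrow> 'v::ab_group_add \<Rightarrow> 'v) \<Rightarrow> ('f^4^4 \<Rightarrow> 'v \<Rightarrow> 'v) \<Rightarrow> bool" where
  "irreducible_rep cj scl \<rho> \<longleftrightarrow>
     U22_rep cj scl \<rho> \<and> (UNIV :: 'v set) \<noteq> {0} \<and>
     (\<forall>W. module.subspace scl W \<and> (\<forall>g\<in>U22 cj. \<rho> g ` W \<subseteq> W) \<longrightarrow> W = {0} \<or> W = UNIV)"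

definition contains_stratum ::
  "('k::field \<Rightarrow> 'f::field) \<Rightarrow> ('f \<Rightarrow> 'f) \<Rightarrow> ('k \<Rightarrow> complex) \<Rightarrow>
   (complex \<Rightarrow> 'v::ab_group_add \<Rightarrow> 'v) \<Rightarrow> ('f^4^4 \<Rightarrow> 'v \<Rightarrow> 'v) \<Rightarrow>
   (int \<Rightarrow> ('f^4) set) \<Rightarrow> nat \<Rightarrow> 'f^4^4 \<Rightarrow> bool" where
  "contains_stratum \<iota> cj \<Omega> scl \<rho> \<Lambda> r \<beta> \<longleftrightarrow>
     (\<exists>x. x \<noteq> 0 \<and> (\<forall>p\<in>P_filtration cj \<Lambda> (r + 1). \<rho> p x = scl (psi \<iota> cj \<Omega> \<beta> p) x))"

end

theory Submission
  imports Defs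
begin

text \<open>Write \<open>n = 2 m + 1\<close>, let \<open>p\<close> be the uniformizer, \<open>\<aa>\<^sub>k\<close> the filtration of the matrix algebra and \<open>y = p\<^sup>n \<beta>\<^sup>2\<close>.
  The proof shows more than conjugacy: an element \<open>g\<close> of the unitary group that intertwines the two
  characters automatically stabilizes the lattice sequence, so it lies in the parahoric group and
  conjugates one character into the other.

  An intertwining \<open>g\<close> exists because in an irreducible representation some translate of a vector for
  one character has nonzero projection to the isotypic part of the other (\<open>intertwining_exists\<close>). By
  duality for the trace form this agreement of characters on \<open>P \<inter> g P g\<^sup>-\<^sup>1\<close> lifts to matrices: after
  changing \<open>\<beta>\<close> and \<open>\<gamma>\<close> by skew elements of \<open>\<aa>\<^sub>-\<^sub>m\<close>, which changes neither character, one has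
  \<open>\<beta> = g \<gamma> g\<^sup>-\<^sup>1\<close> (\<open>conjugate_representatives\<close>).

  The hypothesis on \<open>\<phi>\<close> says that on each two-dimensional graded piece \<open>\<Lambda>(j) / \<Lambda>(j + 1)\<close> the element \<open>y\<close>
  has the two distinct eigenvalues \<open>a\<close> and \<open>b\<close> (\<open>splits_wt1\<close>, \<open>splits_wt2\<close>): the pieces of even and of odd
  index carry the products \<open>R Q\<close> and \<open>Q R\<close> of the same two blocks of \<open>\<beta>\<close>, so they contribute equal
  factors to \<open>\<phi> = (X - a)\<^sup>2 (X - b)\<^sup>2\<close>. The two eigenlines are orthogonal, since \<open>y\<close> is self-adjoint and \<open>a\<close>,
  \<open>b\<close> are fixed by conjugation. On a vector \<open>w\<close> of \<open>\<Lambda>(j)\<close> representing an eigenline consider \<open>f w (\<theta> w)\<close>,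
  where \<open>\<theta> = 1\<close> for the second sequence and \<open>\<theta> = \<beta>\<close> for the first (this is where \<open>a b \<noteq> 0\<close> is needed).
  Nondegeneracy of the induced pairing on the line shows that its valuation is determined by \<open>j\<close>
  (\<open>eigenvector_form_value\<close>). Hence the position of an eigenvector in the lattice sequence is read off
  from \<open>f\<close> and \<open>\<theta>\<close>, both of which are respected by \<open>g\<close>, and \<open>g\<close> must preserve the sequence
  (\<open>isometry_preserves_chain\<close>).\<close>

section \<open>Discretely valued fields\<close>

context nonarch_local_field
begin

lemma val_one [simp]: "v 1 = 0"
  using val_mult[of 1 1] by simp

lemma val_neg_one [simp]: "v (-1) = 0"
  using val_mult[of "-1" "-1"] by simp

lemma val_minus [simp]: "v (- x) = v x"
  using val_mult[of "-1" x] by (cases "x = 0") auto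

lemma val_inverse: "x \<noteq> 0 \<Longrightarrow> v (inverse x) = - v x"
  using val_mult[of x "inverse x"] by simp

lemma val_divide: "x \<noteq> 0 \<Longrightarrow> y \<noteq> 0 \<Longrightarrow> v (x / y) = v x - v y"
  by (simp add: divide_inverse val_mult val_inverse)

lemma val_power: "x \<noteq> 0 \<Longrightarrow> v (x ^ n) = int n * v x"
  by (induction n) (auto simp: val_mult algebra_simps)

lemma val_powi: "x \<noteq> 0 \<Longrightarrow> v (x powi i) = i * v x"
  by (simp add: power_int_def val_power val_inverse)

lemma ideal_0 [simp]: "0 \<in> frac_ideal v m"
  by (simp add: frac_ideal_def)

lemma ideal_1 [simp]: "1 \<in> frac_ideal v 0"
  by (simp add: frac_ideal_def)

lemma ideal_mono: "x \<in> frac_ideal v m \<Longrightarrow> m' \<le> m \<Longrightarrow> x \<in> frac_ideal v m'"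
  by (auto simp: frac_ideal_def)

lemma ideal_add: "x \<in> frac_ideal v m \<Longrightarrow> y \<in> frac_ideal v m \<Longrightarrow> x + y \<in> frac_ideal v m"
  using val_add[of x y] by (cases "x = 0 \<or> y = 0 \<or> x + y = 0") (auto simp: frac_ideal_def)

lemma ideal_minus: "x \<in> frac_ideal v m \<Longrightarrow> - x \<in> frac_ideal v m"
  by (auto simp: frac_ideal_def)

lemma ideal_minus_iff [simp]: "- x \<in> frac_ideal v m \<longleftrightarrow> x \<in> frac_ideal v m"
  by (auto simp: frac_ideal_def)

lemma ideal_diff: "x \<in> frac_ideal v m \<Longrightarrow> y \<in> frac_ideal v m \<Longrightarrow> x - y \<in> frac_ideal v m"
  using ideal_add[of x m "- y"] by simp

lemma ideal_sum: "(\<And>i. i \<in> I \<Longrightarrow> x i \<in> frac_ideal v m) \<Longrightarrow> sum x I \<in> frac_ideal v m"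
  by (induction I rule: infinite_finite_induct) (auto intro: ideal_add)

lemma ideal_mult:
  "x \<in> frac_ideal v m \<Longrightarrow> y \<in> frac_ideal v n \<Longrightarrow> k \<le> m + n \<Longrightarrow> x * y \<in> frac_ideal v k"
  by (cases "x = 0 \<or> y = 0") (auto simp: frac_ideal_def val_mult)

lemma ideal_scale: "c \<noteq> 0 \<Longrightarrow> c * x \<in> frac_ideal v m \<longleftrightarrow> x \<in> frac_ideal v (m - v c)"
  by (cases "x = 0") (auto simp: frac_ideal_def val_mult)

lemma val_add_eq:
  assumes "x \<noteq> 0" "y \<in> frac_ideal v (v x + 1)"
  shows "x + y \<noteq> 0 \<and> v (x + y) = v x"
proof (cases "y = 0")
  case False
  then have y: "v y \<ge> v x + 1" using assms by (auto simp: frac_ideal_def)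
  have ne: "x + y \<noteq> 0"
  proof
    assume "x + y = 0"
    then have "y = - x" by (simp add: eq_neg_iff_add_eq_0 add.commute)
    then show False using y by simp
  qed
  have "v (x + y) \<ge> v x" using val_add[of x y] assms False ne y by auto
  moreover have "v x \<ge> min (v (x + y)) (v y)"
    using val_add[of "x + y" "- y"] assms False ne by auto
  ultimately show ?thesis using y ne by auto
qed (use assms in auto)

lemma red_0 [simp]: "red 0 = 0"
  by (subst red_kernel) auto

lemma red_minus: "x \<in> val_ring v \<Longrightarrow> red (- x) = - red x"
  using red_add[of x "- x"] by (simp add: ideal_minus eq_neg_iff_add_eq_0 add.commute)

lemma red_diff: "x \<in> val_ring v \<Longrightarrow> y \<in> val_ring v \<Longrightarrow> red (x - y) = red x - red y"
  using red_add[of x "- y"] by (simp add: red_minus ideal_minus)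

lemma red_sum: "(\<And>i. i \<in> I \<Longrightarrow> x i \<in> val_ring v) \<Longrightarrow> red (sum x I) = (\<Sum>i\<in>I. red (x i))"
  by (induction I rule: infinite_finite_induct) (auto simp: red_add ideal_sum)

lemma red_eq_0: "x \<in> max_ideal v \<Longrightarrow> red x = 0"
  using red_kernel[of x] ideal_mono[of x 1 0] by auto

lemma red_nonzero_unit:
  assumes "x \<in> val_ring v" "red x \<noteq> 0" shows "x \<noteq> 0" "v x = 0"
  using assms red_kernel[of x] by (auto simp: frac_ideal_def)

text \<open>Each of the \<open>k\<close> steps of the filtration contributes the finite residue field.\<close>

lemma finite_ideal_quotient:
  "\<exists>S. finite S \<and> (\<forall>x\<in>frac_ideal v c. \<exists>y\<in>S. x - y \<in> frac_ideal v (c + int k))"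
proof (induction k)
  case 0
  show ?case by (rule exI[of _ "{0}"]) auto
next
  case (Suc k)
  then obtain S where S: "finite S" "\<forall>x\<in>frac_ideal v c. \<exists>y\<in>S. x - y \<in> frac_ideal v (c + int k)"
    by blast
  obtain p where p: "p \<noteq> 0" "v p = 1" using val_normalized by blast
  define q where "q = p powi (c + int k)"
  have q: "q \<noteq> 0" "v q = c + int k" using p by (auto simp: q_def val_powi)
  define lift where "lift r = (SOME x. x \<in> val_ring v \<and> red x = r)" for r
  have lift: "lift r \<in> val_ring v \<and> red (lift r) = r" for r
    unfolding lift_def by (rule someI_ex) (use red_surj in \<open>metis UNIV_I image_iff\<close>)
  let ?S = "(\<lambda>(y, r). y + q * lift r) ` (S \<times> UNIV)"
  have "finite ?S" using S finite_residue_field by auto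
  moreover have "\<exists>y\<in>?S. x - y \<in> frac_ideal v (c + int (Suc k))" if x: "x \<in> frac_ideal v c" for x
  proof -
    obtain y where y: "y \<in> S" "x - y \<in> frac_ideal v (c + int k)" using S x by blast
    define z where "z = (x - y) / q"
    have xy: "x - y = q * z" using q by (simp add: z_def)
    have z: "z \<in> val_ring v" using y q unfolding xy by (simp add: ideal_scale)
    have "z - lift (red z) \<in> max_ideal v"
      using red_kernel[of "z - lift (red z)"] lift[of "red z"] z by (simp add: red_diff ideal_diff)
    then have "q * (z - lift (red z)) \<in> frac_ideal v (c + int (Suc k))"
      using q by (simp add: ideal_scale)
    moreover have "q * (z - lift (red z)) = x - (y + q * lift (red z))"
      using xy by (simp add: algebra_simps)
    ultimately show ?thesis using y(1) by force
  qed
  ultimately show ?case by blast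
qed

text \<open>A non-archimedean Hahn-Banach theorem: a bounded module over the valuation ring is cut out by
  the linear functionals that take values in the maximal ideal on it. One coordinate is treated at a
  time; since the valuation is discrete, the module has an element \<open>e\<close> whose chosen coordinate has
  least valuation, and modulo \<open>e\<close> both the module and \<open>z\<close> lose that coordinate.\<close>

lemma lattice_separation:
  fixes L :: "('i \<Rightarrow> 'a) set" and z :: "'i \<Rightarrow> 'a"
  assumes "finite I"
    and "\<And>x y. x \<in> L \<Longrightarrow> y \<in> L \<Longrightarrow> (\<lambda>i. x i + y i) \<in> L"
    and "\<And>c x. c \<in> val_ring v \<Longrightarrow> x \<in> L \<Longrightarrow> (\<lambda>i. c * x i) \<in> L"
    and "\<And>x i. x \<in> L \<Longrightarrow> x i \<in> frac_ideal v B"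
    and "\<And>x i. x \<in> L \<Longrightarrow> i \<notin> I \<Longrightarrow> x i = 0" and "\<And>i. i \<notin> I \<Longrightarrow> z i = 0"
    and "(\<lambda>_. 0) \<in> L" and "z \<notin> L"
  shows "\<exists>t. (\<forall>x\<in>L. (\<Sum>i\<in>I. t i * x i) \<in> max_ideal v) \<and> (\<Sum>i\<in>I. t i * z i) \<notin> max_ideal v"
  using assms
proof (induction I arbitrary: L z rule: finite_induct)
  case empty
  then have "z = (\<lambda>_. 0)" by auto
  then show ?case using empty by simp
next
  case (insert k I)
  note L = insert.prems
  have single: "(\<Sum>i\<in>insert k I. (if i = k then c else 0) * x i) = c * x k" for c :: 'a and x
  proof -
    have "(\<Sum>i\<in>I. (if i = k then c else 0) * x i) = 0"
      using insert.hyps by (intro sum.neutral) auto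
    then show ?thesis using insert.hyps by simp
  qed
  have split: "(\<Sum>i\<in>insert k I. (t(k := c)) i * x i) = c * x k + (\<Sum>i\<in>I. t i * x i)"
    for t c and x :: "'i \<Rightarrow> 'a"
  proof -
    have "(\<Sum>i\<in>I. (t(k := c)) i * x i) = (\<Sum>i\<in>I. t i * x i)"
      using insert.hyps by (intro sum.cong) auto
    then show ?thesis using insert.hyps by simp
  qed
  show ?case
  proof (cases "\<forall>x\<in>L. x k = 0")
    case True
    show ?thesis
    proof (cases "z k = 0")
      case True': False
      show ?thesis
        by (rule exI[of _ "\<lambda>i. if i = k then inverse (z k) else 0"])
           (use True True' in \<open>simp add: single frac_ideal_def\<close>)
    next
      case zk: True
      have "\<exists>t. (\<forall>x\<in>L. (\<Sum>i\<in>I. t i * x i) \<in> max_ideal v) \<and> (\<Sum>i\<in>I. t i * z i) \<notin> max_ideal v"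
      proof (rule insert.IH)
        show "x i = 0" if "x \<in> L" "i \<notin> I" for x i
          using that True L(4)[of x i] by (cases "i = k") auto
        show "z i = 0" if "i \<notin> I" for i
          using that zk L(5)[of i] by (cases "i = k") auto
      qed (use L in auto)
      then obtain t where "\<forall>x\<in>L. (\<Sum>i\<in>I. t i * x i) \<in> max_ideal v" "(\<Sum>i\<in>I. t i * z i) \<notin> max_ideal v"
        by blast
      then show ?thesis using zk True insert.hyps by (intro exI[of _ t]) auto
    qed
  next
    case False
    then obtain x0 where x0: "x0 \<in> L" "x0 k \<noteq> 0" by blast
    define e where "e = (ARG_MIN (\<lambda>x. nat (v (x k) - B)) x. x \<in> L \<and> x k \<noteq> 0)"
    have e: "e \<in> L" "e k \<noteq> 0"
      and e_min: "\<And>x. x \<in> L \<Longrightarrow> x k \<noteq> 0 \<Longrightarrow> nat (v (e k) - B) \<le> nat (v (x k) - B)"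
      using arg_min_nat_lemma[of "\<lambda>x. x \<in> L \<and> x k \<noteq> 0" x0 "\<lambda>x. nat (v (x k) - B)"] x0
      by (auto simp: e_def)
    have vB: "x \<in> L \<Longrightarrow> x k \<noteq> 0 \<Longrightarrow> B \<le> v (x k)" for x
      using L(3)[of x k] by (auto simp: frac_ideal_def)
    have min: "x k / e k \<in> val_ring v" if "x \<in> L" for x
      using e_min[OF that] vB[OF that] vB[of e] e by (cases "x k = 0") (auto simp: frac_ideal_def val_divide)
    show ?thesis
    proof (cases "z k / e k \<in> val_ring v")
      case False
      obtain p where p: "p \<noteq> 0" "v p = 1" using val_normalized by blast
      have "p * (x k / e k) \<in> max_ideal v" if "x \<in> L" for x
        using min[OF that] p by (simp add: ideal_scale del: times_divide_eq_right)
      moreover have "p * (z k / e k) \<notin> max_ideal v"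
        using False p by (simp add: ideal_scale del: times_divide_eq_right)
      ultimately show ?thesis
        by (intro exI[of _ "\<lambda>i. if i = k then p / e k else 0"]) (simp add: single times_divide_eq_left)
    next
      case True
      define L' where "L' = {x \<in> L. x k = 0}"
      define sub where "sub x = (\<lambda>i. x i + - (x k / e k) * e i)" for x :: "'i \<Rightarrow> 'a"
      have scaled: "c \<in> val_ring v \<Longrightarrow> (\<lambda>i. c * e i) \<in> L" for c
        using L(2) e by blast
      have sub_L: "sub x \<in> L'" if "x \<in> L" for x
        using L(1)[OF that scaled[of "- (x k / e k)"]] min[OF that] e
        by (auto simp: L'_def sub_def)
      have z': "sub z \<notin> L'"
      proof
        assume "sub z \<in> L'"
        then have "(\<lambda>i. sub z i + (z k / e k) * e i) \<in> L"
          using L(1)[of "sub z"] scaled[OF True] by (auto simp: L'_def)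
        also have "(\<lambda>i. sub z i + (z k / e k) * e i) = z" by (auto simp: sub_def)
        finally show False using L(7) by simp
      qed
      have "\<exists>t. (\<forall>x\<in>L'. (\<Sum>i\<in>I. t i * x i) \<in> max_ideal v) \<and> (\<Sum>i\<in>I. t i * sub z i) \<notin> max_ideal v"
      proof (rule insert.IH)
        show "sub z i = 0" if "i \<notin> I" for i
          using that L(4)[OF e(1), of i] L(5)[of i] e by (cases "i = k") (auto simp: sub_def)
        show "x i = 0" if "x \<in> L'" "i \<notin> I" for x i
          using that L(4)[of x i] by (auto simp: L'_def)
      qed (use L z' in \<open>auto simp: L'_def\<close>)
      then obtain t where t: "\<forall>x\<in>L'. (\<Sum>i\<in>I. t i * x i) \<in> max_ideal v"
          "(\<Sum>i\<in>I. t i * sub z i) \<notin> max_ideal v"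
        by blast
      \<comment> \<open>The value at the new coordinate is chosen so that the functional kills \<open>e\<close>.\<close>
      define c where "c = - (\<Sum>i\<in>I. t i * e i) / e k"
      have eq: "(\<Sum>i\<in>insert k I. (t(k := c)) i * x i) = (\<Sum>i\<in>I. t i * sub x i)" for x :: "'i \<Rightarrow> 'a"
      proof -
        have "(\<Sum>i\<in>I. t i * sub x i) = (\<Sum>i\<in>I. t i * x i) - (\<Sum>i\<in>I. (x k / e k) * (t i * e i))"
          unfolding sum_subtractf[symmetric] by (rule sum.cong) (auto simp: sub_def algebra_simps)
        also have "\<dots> = (\<Sum>i\<in>I. t i * x i) + c * x k"
          by (simp only: c_def sum_distrib_left[symmetric]) (simp add: mult.commute)
        finally show ?thesis unfolding split by simp
      qed
      show ?thesis
        by (rule exI[of _ "t(k := c)"]) (use t sub_L in \<open>simp add: eq del: fun_upd_apply\<close>)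
    qed
  qed
qed

end

section \<open>Unramified quadratic extensions\<close>

context unramified_quadratic_ext
begin

lemma emb_0 [simp]: "\<iota> 0 = 0"
  using emb_add[of 0 0] by (metis add_cancel_left_right add_0)

lemma emb_minus: "\<iota> (- x) = - \<iota> x"
  using emb_add[of x "- x"] by (simp add: eq_neg_iff_add_eq_0 add.commute)

lemma emb_diff: "\<iota> (x - y) = \<iota> x - \<iota> y"
  using emb_add[of x "- y"] by (simp add: emb_minus)

lemma emb_eq_0_iff [simp]: "\<iota> x = 0 \<longleftrightarrow> x = 0"
proof
  assume "\<iota> x = 0"
  then have "\<iota> (x * inverse x) = 0" by (simp add: emb_mult)
  then show "x = 0" using emb_one by (cases "x = 0") auto
qed simp

lemma inj_emb: "inj \<iota>"
  by (rule injI) (metis emb_diff emb_eq_0_iff right_minus_eq)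

lemma emb_divide: "\<iota> (x / y) = \<iota> x / \<iota> y"
proof (cases "y = 0")
  case False
  then have "\<iota> x = \<iota> (x / y) * \<iota> y" by (simp flip: emb_mult)
  then show ?thesis using False by simp
qed simp

lemma emb_ideal [simp]: "\<iota> x \<in> frac_ideal v m \<longleftrightarrow> x \<in> frac_ideal v0 m"
  by (cases "x = 0") (auto simp: frac_ideal_def val_emb)

lemma not_emb_minus_s: "s \<noteq> - \<iota> x"
proof
  assume "s = - \<iota> x"
  then have "\<iota> (x ^ 2) = \<iota> \<epsilon>" using sqrt_eps by (simp add: power2_eq_square emb_mult)
  then have "x ^ 2 = \<epsilon>" using inj_emb by (simp add: inj_eq)
  then show False using eps_nonsquare by blast
qed

lemma s_nonzero [simp]: "s \<noteq> 0"
  using not_emb_minus_s[of 0] by simp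

lemma val_s [simp]: "v s = 0"
proof -
  have "v (s * s) = 0" using sqrt_eps eps_unit by (simp add: power2_eq_square val_emb)
  then show ?thesis using ext.val_mult[of s s] by simp
qed

lemma two_unit0: "(2::'k) \<noteq> 0 \<and> v0 2 = 0"
proof -
  have "(2::'r0) \<noteq> 0"
  proof
    assume "(2::'r0) = 0"
    then have "of_nat 2 = (0::'r0)" by simp
    then have "CHAR('r0) dvd 2" by (simp only: of_nat_eq_0_iff_char_dvd)
    then have "CHAR('r0) = 1"
    proof -
      assume dvd: "CHAR('r0) dvd 2"
      then have "CHAR('r0) \<le> 2" by (rule dvd_imp_le) simp
      moreover have "CHAR('r0) \<noteq> 0" "CHAR('r0) \<noteq> 2"
        using odd_residue_char by (metis dvd_0_right, metis dvd_refl)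
      ultimately show ?thesis by linarith
    qed
    then have "of_nat 1 = (0::'r0)" by (metis of_nat_CHAR)
    then show False by simp
  qed
  moreover have "red0 (1 + 1) = 1 + 1"
    by (simp only: base.red_add base.ideal_1 base.red_one)
  ultimately have "red0 2 \<noteq> 0" by (simp only: one_add_one not_False_eq_True)
  then show ?thesis using base.red_nonzero_unit[of 2] base.ideal_add[of 1 0 1] by simp
qed

lemma emb_2: "\<iota> 2 = 2"
  using emb_add[of 1 1] emb_one by simp

lemma two_nonzero [simp]: "(2::'f) \<noteq> 0"
  using two_unit0 emb_2 by (metis emb_eq_0_iff)

lemma val_two [simp]: "v 2 = 0"
  using two_unit0 emb_2 by (metis val_emb)

lemma cj_emb [simp]: "cj (\<iota> a) = \<iota> a"
  using cj_eq[of a 0] by simp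

lemma cj_add: "cj (x + y) = cj x + cj y"
proof -
  obtain a b c d where xy: "x = \<iota> a + \<iota> b * s" "y = \<iota> c + \<iota> d * s" using generated by metis
  have "x + y = \<iota> (a + c) + \<iota> (b + d) * s" by (simp add: xy emb_add algebra_simps)
  then show ?thesis by (simp only: xy cj_eq) (simp add: emb_add algebra_simps)
qed

lemma cj_mult: "cj (x * y) = cj x * cj y"
proof -
  obtain a b c d where xy: "x = \<iota> a + \<iota> b * s" "y = \<iota> c + \<iota> d * s" using generated by metis
  have ss: "s * s = \<iota> \<epsilon>" using sqrt_eps by (simp add: power2_eq_square)
  have ss': "s * (s * z) = \<iota> \<epsilon> * z" for z using ss by (simp add: mult.assoc[symmetric])
  have "x * y = \<iota> (a * c + b * d * \<epsilon>) + \<iota> (a * d + b * c) * s"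
    by (simp add: xy emb_add emb_mult ss ss' algebra_simps)
  then have "cj (x * y) = \<iota> (a * c + b * d * \<epsilon>) - \<iota> (a * d + b * c) * s"
    by (simp only: cj_eq)
  also have "\<dots> = (\<iota> a - \<iota> b * s) * (\<iota> c - \<iota> d * s)"
    by (simp add: emb_add emb_mult ss ss' algebra_simps)
  finally show ?thesis by (simp only: xy cj_eq)
qed

lemma cj_cj [simp]: "cj (cj x) = x"
proof -
  obtain a b where x: "x = \<iota> a + \<iota> b * s" using generated by metis
  have "cj x = \<iota> a + \<iota> (- b) * s" by (simp only: x cj_eq) (simp add: emb_minus)
  then have "cj (cj x) = \<iota> a - \<iota> (- b) * s" by (simp only: cj_eq)
  then show ?thesis by (simp add: x emb_minus)
qed

lemma cj_0 [simp]: "cj 0 = 0" and cj_1 [simp]: "cj 1 = 1"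
  using cj_emb[of 0] cj_emb[of 1] emb_one by simp_all

lemma cj_minus: "cj (- x) = - cj x"
  using cj_add[of x "- x"] by (simp add: eq_neg_iff_add_eq_0 add.commute)

lemma cj_diff: "cj (x - y) = cj x - cj y"
  using cj_add[of x "- y"] by (simp add: cj_minus)

lemma cj_eq_0_iff [simp]: "cj x = 0 \<longleftrightarrow> x = 0"
  by (metis cj_0 cj_cj)

lemma cj_inverse: "cj (inverse x) = inverse (cj x)"
proof (cases "x = 0")
  case False
  then have "cj x * cj (inverse x) = 1" by (simp flip: cj_mult)
  then show ?thesis by (simp add: inverse_unique)
qed simp

lemma cj_power: "cj (x ^ n) = cj x ^ n"
  by (induction n) (auto simp: cj_mult)

lemma cj_sum: "cj (sum g I) = (\<Sum>i\<in>I. cj (g i))"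
  by (induction I rule: infinite_finite_induct) (auto simp: cj_add)

text \<open>If conjugation changed the valuation, some \<open>t\<close> with \<open>t * cj t = 1\<close> would have positive
  valuation; writing its powers as \<open>\<iota> a + \<iota> b * s\<close>, the quotients \<open>- a / b\<close> approximate \<open>s\<close> by
  elements of the base field, which is complete, so that \<open>s\<close> would lie in it.\<close>

lemma val_cj_le: "x \<noteq> 0 \<Longrightarrow> v x \<le> v (cj x)"
proof (rule ccontr)
  assume x: "x \<noteq> 0" and less: "\<not> v x \<le> v (cj x)"
  define t where "t = x / cj x"
  have t: "t \<noteq> 0" "cj t = inverse t"
    using x by (auto simp: t_def divide_inverse cj_mult cj_inverse)
  define c where "c = v t"
  have c: "c > 0" using less x by (simp add: c_def t_def ext.val_divide)
  have "\<forall>k::nat. \<exists>a b. t ^ k = \<iota> a + \<iota> b * s" using generated by blast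
  then obtain A B where AB: "\<And>k::nat. t ^ k = \<iota> (A k) + \<iota> (B k) * s" by metis
  have cjAB: "inverse t ^ k = \<iota> (A k) - \<iota> (B k) * s" for k
    using arg_cong[OF AB[of k], of cj] by (simp only: cj_eq cj_power t)
  have close: "B k \<noteq> 0 \<and> s + \<iota> (A k / B k) \<in> frac_ideal v (2 * (int k * c))" if k: "k > 0" for k
  proof -
    have diff: "- (inverse t ^ k) + t ^ k = 2 * (\<iota> (B k) * s)"
      unfolding AB cjAB by (simp add: algebra_simps)
    have vt: "v (t ^ k) = int k * c" "v (inverse t ^ k) = - (int k * c)"
      using t by (auto simp: ext.val_power ext.val_inverse c_def)
    have pos: "int k * c > 0" using k c by simp
    have pos': "1 \<le> 2 * (c * int k)"
      using pos mult.commute[of c "int k"] by linarith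
    have "- (inverse t ^ k) + t ^ k \<noteq> 0 \<and> v (- (inverse t ^ k) + t ^ k) = v (- (inverse t ^ k))"
      by (rule ext.val_add_eq) (use t vt pos pos' in \<open>auto simp: frac_ideal_def\<close>)
    then have ne: "2 * (\<iota> (B k) * s) \<noteq> 0" and val: "v (2 * (\<iota> (B k) * s)) = - (int k * c)"
      unfolding diff using vt by auto
    then have B: "B k \<noteq> 0" by auto
    then have vB: "v (\<iota> (B k)) = - (int k * c)"
      using val by (simp add: ext.val_mult)
    have "s + \<iota> (A k / B k) = t ^ k / \<iota> (B k)"
      unfolding AB using B by (simp add: emb_divide field_simps)
    then show ?thesis using B vB vt t by (simp add: frac_ideal_def ext.val_divide)
  qed
  have close': "s + \<iota> (A k / B k) \<in> frac_ideal v m" if "k > 0" "int k \<ge> m" for k m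
  proof -
    have "m \<le> 2 * (int k * c)"
    proof -
      have "int k * 1 \<le> int k * c" using c by (intro mult_left_mono) auto
      then show ?thesis using that by linarith
    qed
    then show ?thesis using close that ext.ideal_mono by blast
  qed
  have "\<exists>L. \<forall>m. \<exists>N. \<forall>i\<ge>N. A i / B i - L \<in> frac_ideal v0 m"
  proof (rule base.complete, intro allI)
    fix m
    show "\<exists>N. \<forall>i\<ge>N. \<forall>j\<ge>N. A i / B i - A j / B j \<in> frac_ideal v0 m"
    proof (intro exI[of _ "nat m + 1"] allI impI)
      fix i j assume ij: "nat m + 1 \<le> i" "nat m + 1 \<le> j"
      have "(s + \<iota> (A i / B i)) - (s + \<iota> (A j / B j)) \<in> frac_ideal v m"
        by (intro ext.ideal_diff close') (use ij in auto)
      then have "\<iota> (A i / B i - A j / B j) \<in> frac_ideal v m" by (simp add: emb_diff)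
      then show "A i / B i - A j / B j \<in> frac_ideal v0 m" by simp
    qed
  qed
  then obtain L where L: "\<And>m. \<exists>N. \<forall>i\<ge>N. A i / B i - L \<in> frac_ideal v0 m" by blast
  have "s + \<iota> L \<in> frac_ideal v m" for m
  proof -
    obtain N where N: "\<And>i. i \<ge> N \<Longrightarrow> A i / B i - L \<in> frac_ideal v0 m" using L by blast
    define i where "i = max N (nat m + 1)"
    have "(s + \<iota> (A i / B i)) - \<iota> (A i / B i - L) \<in> frac_ideal v m"
      by (intro ext.ideal_diff close') (use N[of i] in \<open>auto simp: i_def\<close>)
    then show ?thesis by (simp add: emb_diff)
  qed
  from this[of "v (s + \<iota> L) + 1"] have "s + \<iota> L = 0" by (auto simp: frac_ideal_def)
  then show False using not_emb_minus_s[of L] by (simp add: eq_neg_iff_add_eq_0)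
qed

lemma val_cj [simp]: "v (cj x) = v x"
  using val_cj_le[of x] val_cj_le[of "cj x"] by (cases "x = 0") auto

lemma ideal_cj [simp]: "cj x \<in> frac_ideal v m \<longleftrightarrow> x \<in> frac_ideal v m"
  by (cases "x = 0") (auto simp: frac_ideal_def)

abbreviation "Tr \<equiv> tr_quadratic \<iota> cj"

lemma emb_Tr: "\<iota> (Tr x) = x + cj x"
proof -
  obtain a b where x: "x = \<iota> a + \<iota> b * s" using generated by metis
  have "x + cj x = \<iota> (2 * a)" unfolding x cj_eq by (simp add: emb_mult emb_2)
  then show ?thesis unfolding tr_quadratic_def by (simp add: inv_f_f[OF inj_emb])
qed

lemma Tr_add: "Tr (x + y) = Tr x + Tr y"
  by (rule injD[OF inj_emb]) (simp add: emb_Tr emb_add cj_add algebra_simps)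

lemma Tr_ideal: "x \<in> frac_ideal v m \<Longrightarrow> Tr x \<in> frac_ideal v0 m"
  using emb_ideal[of "Tr x" m] unfolding emb_Tr by (simp add: ext.ideal_add)

lemma Tr_cj [simp]: "Tr (cj x) = Tr x"
  by (rule injD[OF inj_emb]) (simp add: emb_Tr add.commute)

lemma Tr_half_emb: "Tr (\<iota> a / 2) = a"
proof (rule injD[OF inj_emb])
  have "\<iota> a / 2 = \<iota> (a / 2)" by (simp add: emb_divide emb_2)
  then have "\<iota> (Tr (\<iota> a / 2)) = \<iota> a / 2 + \<iota> a / 2" by (simp add: emb_Tr)
  also have "\<dots> = (\<iota> a / 2) * 2" by (simp only: mult_2_right)
  also have "\<dots> = \<iota> a" by simp
  finally show "\<iota> (Tr (\<iota> a / 2)) = \<iota> a" .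
qed

text \<open>If \<open>z\<close> has valuation at most zero, then every integral \<open>t\<close> of the base field is \<open>Tr (c * z)\<close> with the
  integral multiplier \<open>c = t / (2 z)\<close>, so that the character would be trivial on all integers.\<close>

lemma character_Tr_detects:
  assumes "additive_character_conductor_p v0 \<Omega>"
    and "\<And>c. c \<in> val_ring v \<Longrightarrow> \<Omega> (Tr (c * z)) = 1"
  shows "z \<in> max_ideal v"
proof (rule ccontr)
  assume z: "z \<notin> max_ideal v"
  then have z0: "z \<noteq> 0" "v z \<le> 0" by (auto simp: frac_ideal_def)
  obtain t where t: "t \<in> val_ring v0" "\<Omega> t \<noteq> 1"
    using assms(1) by (auto simp: additive_character_conductor_p_def)
  have "\<iota> t / 2 / z \<in> val_ring v"
    using t z0 by (cases "t = 0") (auto simp: frac_ideal_def ext.val_divide ext.val_mult val_emb)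
  from assms(2)[OF this] show False using z0 t by (simp add: Tr_half_emb)
qed

end

section \<open>Weighted lattice sequences and their matrix filtration\<close>

text \<open>Both lattice sequences of period two have this form, for integer weights \<open>d\<close> of the four coordinates:
  the bound \<open>(i + d k) div 2\<close> is the least \<open>t\<close> with \<open>2 t + 1 \<ge> i + d k\<close>, which makes scaling, duality and
  the filtration of the matrices linear arithmetic.\<close>

definition Lam :: "('f::field \<Rightarrow> int) \<Rightarrow> (4 \<Rightarrow> int) \<Rightarrow> int \<Rightarrow> ('f^4) set" where
  "Lam v d i = {x. \<forall>k. x $ k \<in> frac_ideal v ((i + d k) div 2)}"

lemma mat_mult_vec: "mat c *v x = c *s (x :: 'a::comm_ring_1^'n)"
  by (simp add: vec_eq_iff matrix_vector_mult_def mat_def if_distrib [where f = "\<lambda>u. u * _"] cong: if_cong)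

lemma mat_mult_nth: "(mat c ** X) $ k $ l = c * (X :: 'a::comm_ring_1^'n^'m) $ k $ l"
  by (simp add: matrix_matrix_mult_def mat_def if_distrib [where f = "\<lambda>u. u * _"] cong: if_cong)

lemma mult_mat_nth: "(X ** mat c) $ k $ l = c * (X :: 'a::comm_ring_1^'n^'m) $ k $ l"
  by (simp add: matrix_matrix_mult_def mat_def if_distrib [where f = "\<lambda>u. _ * u"] mult.commute cong: if_cong)

lemma mat_commute: "mat c ** X = X ** mat (c :: 'a::comm_ring_1)"
  by (simp add: vec_eq_iff mat_mult_nth mult_mat_nth)

lemma matrix_diff_ldistrib: "A ** (B - C) = A ** B - A ** (C :: 'a::comm_ring_1^'n^'m)"
  by (simp add: matrix_matrix_mult_def vec_eq_iff right_diff_distrib sum_subtractf)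

lemma matrix_diff_rdistrib: "(B - C) ** A = B ** A - C ** (A :: 'a::comm_ring_1^'n^'m)"
  by (simp add: matrix_matrix_mult_def vec_eq_iff left_diff_distrib sum_subtractf)

lemma matrix_add_rdistrib': "(B + C) ** A = B ** A + C ** (A :: 'a::comm_ring_1^'n^'m)"
  by (simp add: matrix_matrix_mult_def vec_eq_iff distrib_right sum.distrib)

lemma matrix_minus_left: "(- A) ** B = - (A ** (B :: 'a::comm_ring_1^'n^'m))"
  by (simp add: matrix_matrix_mult_def vec_eq_iff sum_negf)

lemma matrix_minus_right: "A ** (- B) = - (A ** (B :: 'a::comm_ring_1^'n^'m))"
  by (simp add: matrix_matrix_mult_def vec_eq_iff sum_negf)

locale lattice_chain = nonarch_local_field v red
  for v :: "'a::field \<Rightarrow> int" and red :: "'a \<Rightarrow> 'r::field" +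
  fixes d :: "4 \<Rightarrow> int"
begin

abbreviation "L \<equiv> Lam v d"
abbreviation "lat \<equiv> lat_filtration (Lam v d)"

lemma L_mono: "x \<in> L i \<Longrightarrow> j \<le> i \<Longrightarrow> x \<in> L j"
proof -
  assume *: "x \<in> L i" "j \<le> i"
  have "(j + d k) div 2 \<le> (i + d k) div 2" for k using *(2) by linarith
  then show ?thesis using *(1) unfolding Lam_def by (blast intro: ideal_mono)
qed

lemma L_0 [simp]: "0 \<in> L i"
  by (simp add: Lam_def)

lemma L_add: "x \<in> L i \<Longrightarrow> y \<in> L i \<Longrightarrow> x + y \<in> L i"
  by (simp add: Lam_def ideal_add)

lemma L_diff: "x \<in> L i \<Longrightarrow> y \<in> L i \<Longrightarrow> x - y \<in> L i"
  by (simp add: Lam_def ideal_diff)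

lemma L_scale: "c \<in> frac_ideal v t \<Longrightarrow> x \<in> L i \<Longrightarrow> j \<le> i + 2 * t \<Longrightarrow> c *s x \<in> L j"
proof -
  assume *: "c \<in> frac_ideal v t" "x \<in> L i" "j \<le> i + 2 * t"
  have "(j + d k) div 2 \<le> t + (i + d k) div 2" for k
    using *(3) by linarith
  then show ?thesis using *(1,2) unfolding Lam_def mem_Collect_eq vector_smult_component
    by (blast intro: ideal_mult)
qed

lemma L_scale_iff: "c \<noteq> 0 \<Longrightarrow> c *s x \<in> L i \<longleftrightarrow> x \<in> L (i - 2 * v c)"
proof -
  assume c: "c \<noteq> 0"
  have "(i - 2 * v c + d k) div 2 = (i + d k) div 2 - v c" for k by linarith
  then show ?thesis using c by (simp add: Lam_def ideal_scale)
qed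

lemma L_bounded: "\<exists>i. x \<in> L i"
proof -
  define C where "C = Min (range (\<lambda>k. 2 * v (x $ k) - d k))"
  have "C \<le> 2 * v (x $ k) - d k" for k unfolding C_def by (rule Min_le) auto
  then have "C + d k \<le> 2 * v (x $ k)" for k by (simp add: algebra_simps)
  then have "(C + d k) div 2 \<le> v (x $ k)" for k
    using zdiv_mono1[of "C + d k" "2 * v (x $ k)" 2] by simp
  then have "x \<in> L C" by (auto simp: Lam_def frac_ideal_def)
  then show ?thesis ..
qed

lemma L_separated: "(\<And>i. x \<in> L i) \<Longrightarrow> x = 0"
proof (rule ccontr)
  assume *: "\<And>i. x \<in> L i" "x \<noteq> 0"
  then obtain k where k: "x $ k \<noteq> 0" by (auto simp: vec_eq_iff)
  have "x $ k \<in> frac_ideal v ((2 * v (x $ k) + 2 - d k + d k) div 2)"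
    using *(1)[of "2 * v (x $ k) + 2 - d k"] unfolding Lam_def by blast
  moreover have "(2 * v (x $ k) + 2 - d k + d k) div 2 = v (x $ k) + 1" by linarith
  ultimately show False using k by (simp add: frac_ideal_def)
qed

lemma L_axis: "c \<in> frac_ideal v ((i + d l) div 2) \<Longrightarrow> c *s axis l 1 \<in> L i"
  by (auto simp: Lam_def axis_def)

lemma latD: "X \<in> lat n \<Longrightarrow> x \<in> L i \<Longrightarrow> j \<le> i + n \<Longrightarrow> X *v x \<in> L j"
  unfolding lat_filtration_def by (blast intro: L_mono)

lemma latI: "(\<And>i x. x \<in> L i \<Longrightarrow> X *v x \<in> L (i + n)) \<Longrightarrow> X \<in> lat n"
  unfolding lat_filtration_def by blast

text \<open>The sharpest condition on the column \<open>l\<close> comes from \<open>1 - d l\<close>, the largest index at which \<open>L\<close> contains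
  the basis vector \<open>axis l 1\<close>.\<close>

lemma lat_iff: "X \<in> lat n \<longleftrightarrow> (\<forall>k l. X $ k $ l \<in> frac_ideal v ((n + d k - d l + 1) div 2))"
proof
  assume X: "X \<in> lat n"
  show "\<forall>k l. X $ k $ l \<in> frac_ideal v ((n + d k - d l + 1) div 2)"
  proof (intro allI)
    fix k l
    have "1 *s axis l 1 \<in> L (1 - d l)" by (rule L_axis) simp
    then have "X *v axis l 1 \<in> L (1 - d l + n)" using X by (auto intro: latD)
    then have "(X *v axis l 1) $ k \<in> frac_ideal v ((1 - d l + n + d k) div 2)"
      unfolding Lam_def by blast
    moreover have "1 - d l + n + d k = n + d k - d l + 1" by simp
    ultimately show "X $ k $ l \<in> frac_ideal v ((n + d k - d l + 1) div 2)"
      by (simp add: matrix_vector_mult_def axis_def if_distrib cong: if_cong)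
  qed
next
  assume X: "\<forall>k l. X $ k $ l \<in> frac_ideal v ((n + d k - d l + 1) div 2)"
  show "X \<in> lat n"
  proof (rule latI)
    fix i x assume x: "x \<in> L i"
    have "X $ k $ l * x $ l \<in> frac_ideal v ((i + n + d k) div 2)" for k l
    proof (rule ideal_mult)
      show "X $ k $ l \<in> frac_ideal v ((n + d k - d l + 1) div 2)" using X by blast
      show "x $ l \<in> frac_ideal v ((i + d l) div 2)" using x unfolding Lam_def by blast
      show "(i + n + d k) div 2 \<le> (n + d k - d l + 1) div 2 + (i + d l) div 2" by linarith
    qed
    then show "X *v x \<in> L (i + n)"
      unfolding Lam_def by (auto simp: matrix_vector_mult_def intro: ideal_sum)
  qed
qed

lemma lat_mono: "X \<in> lat n \<Longrightarrow> m \<le> n \<Longrightarrow> X \<in> lat m"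
  by (rule latI) (auto intro: latD)

lemma lat_add: "X \<in> lat n \<Longrightarrow> Y \<in> lat n \<Longrightarrow> X + Y \<in> lat n"
  by (simp add: lat_iff ideal_add)

lemma lat_diff: "X \<in> lat n \<Longrightarrow> Y \<in> lat n \<Longrightarrow> X - Y \<in> lat n"
  by (simp add: lat_iff ideal_diff)

lemma lat_minus: "X \<in> lat n \<Longrightarrow> - X \<in> lat n"
  by (simp add: lat_iff)

lemma lat_0 [simp]: "0 \<in> lat n"
  by (simp add: lat_iff)

lemma lat_mult: "X \<in> lat n \<Longrightarrow> Y \<in> lat m \<Longrightarrow> k \<le> n + m \<Longrightarrow> X ** Y \<in> lat k"
proof (rule latI)
  fix i x assume *: "X \<in> lat n" "Y \<in> lat m" "k \<le> n + m" "x \<in> L i"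
  have "Y *v x \<in> L (i + m)" using * by (auto intro: latD)
  then have "X *v (Y *v x) \<in> L (i + k)" using * by (auto intro: latD)
  then show "X ** Y *v x \<in> L (i + k)" by (simp add: matrix_vector_mul_assoc)
qed

lemma lat_mat: "c \<in> frac_ideal v t \<Longrightarrow> m \<le> 2 * t \<Longrightarrow> mat c \<in> lat m"
  by (rule latI) (auto simp: mat_mult_vec intro: L_scale)

lemma lat_1 [simp]: "mat 1 \<in> lat 0"
  by (rule lat_mat[of _ 0]) auto

lemma lat_scale: "c \<in> frac_ideal v t \<Longrightarrow> X \<in> lat n \<Longrightarrow> k \<le> n + 2 * t \<Longrightarrow> mat c ** X \<in> lat k"
  by (rule lat_mult[of _ "2 * t" _ n]) (auto intro: lat_mat)

lemma lat_bounded: "\<exists>C::nat. X \<in> lat (- int C)"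
proof -
  have "\<exists>j. \<forall>x\<in>I. fst (snd x) $ fst x $ snd (snd x) \<in> frac_ideal v j"
    if "finite I" for I :: "(4 \<times> ('a^4^4) \<times> 4) set"
    using that
  proof (induction I rule: finite_induct)
    case (insert x I)
    then obtain j where j: "\<forall>x\<in>I. fst (snd x) $ fst x $ snd (snd x) \<in> frac_ideal v j" by blast
    let ?e = "fst (snd x) $ fst x $ snd (snd x)"
    show ?case
      by (rule exI[of _ "min j (v ?e)"]) (use j in \<open>auto intro: ideal_mono simp: frac_ideal_def\<close>)
  qed auto
  from this[of "UNIV \<times> {X} \<times> UNIV"] obtain j where j: "\<And>k l. X $ k $ l \<in> frac_ideal v j"
    by auto
  define B where "B = Max (range (\<lambda>(k, l). d k - d l))"
  have B: "d k - d l \<le> B" for k l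
    unfolding B_def by (rule Max_ge) (auto simp: image_iff)
  define C where "C = nat (B + 2 - 2 * j)"
  have "(- int C + d k - d l + 1) div 2 \<le> j" for k l
  proof -
    have "int C \<ge> B + 2 - 2 * j" by (simp add: C_def)
    then show ?thesis using B[of k l] by linarith
  qed
  then have "X \<in> lat (- int C)" unfolding lat_iff using j ideal_mono by blast
  then show ?thesis ..
qed

text \<open>For \<open>Z\<close> of positive degree, \<open>1 - Z\<close> is injective, hence invertible, because a fixed vector of
  \<open>Z\<close> lies in every lattice; its inverse \<open>W = 1 + Z W\<close> has degree at least zero, as the identity
  improves any negative bound.\<close>

lemma one_minus_inverse:
  assumes Z: "Z \<in> lat 1"
  shows "\<exists>W\<in>lat 0. (mat 1 - Z) ** W = mat 1 \<and> W ** (mat 1 - Z) = mat 1"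
proof -
  have inj: "x = 0" if x: "(mat 1 - Z) *v x = 0" for x
  proof (rule L_separated)
    fix i
    have fixed: "x = Z *v x" using x by (simp add: matrix_vector_mult_diff_rdistrib)
    obtain j where j: "x \<in> L j" using L_bounded by blast
    have "x \<in> L (j + int k)" for k
    proof (induction k)
      case (Suc k)
      have "Z *v x \<in> L (j + int (Suc k))" by (rule latD[OF Z Suc]) simp
      then show ?case using fixed by simp
    qed (use j in simp)
    from this[of "nat (i - j)"] show "x \<in> L i" by (rule L_mono) simp
  qed
  have "\<exists>W. W ** (mat 1 - Z) = mat 1"
    by (rule iffD2[OF matrix_left_invertible_ker]) (use inj in simp)
  then obtain W where W: "W ** (mat 1 - Z) = mat 1" ..
  then have W': "(mat 1 - Z) ** W = mat 1" by (simp add: matrix_left_right_inverse)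
  then have step: "W = mat 1 + Z ** W" by (simp add: matrix_diff_rdistrib algebra_simps)
  obtain C where C: "W \<in> lat (- int C)" using lat_bounded by blast
  have "W \<in> lat (- int (C - k))" for k
  proof (induction k)
    case (Suc k)
    have "Z ** W \<in> lat (- int (C - Suc k))" by (rule lat_mult[OF Z Suc]) simp
    moreover have "mat 1 \<in> lat (- int (C - Suc k))" by (rule lat_mono[OF lat_1]) simp
    ultimately show ?case using step lat_add by metis
  qed (use C in simp)
  from this[of C] have "W \<in> lat 0" by simp
  then show ?thesis using W W' by blast
qed

lemma trace_ideal:
  assumes "X \<in> lat 1" shows "trace X \<in> max_ideal v"
  unfolding trace_def
proof (rule ideal_sum)
  fix k
  have "X $ k $ k \<in> frac_ideal v ((1 + d k - d k + 1) div 2)"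
    using assms unfolding lat_iff by blast
  then show "X $ k $ k \<in> max_ideal v" by simp
qed

text \<open>Testing \<open>Z\<close> against multiples of the matrix units in \<open>lat m\<close> bounds its entries one by one.\<close>

lemma lat_dual:
  assumes "\<And>X. X \<in> lat m \<Longrightarrow> trace (Z ** X) \<in> max_ideal v"
  shows "Z \<in> lat (1 - m)"
  unfolding lat_iff
proof (intro allI)
  fix k l
  define t where "t = (m + d l - d k + 1) div 2"
  obtain p where p: "p \<noteq> 0" "v p = 1" using val_normalized by blast
  define q where "q = p powi t"
  have q: "q \<noteq> 0" "v q = t" using p by (auto simp: q_def val_powi)
  define X where "X = (\<chi> i j. if i = l \<and> j = k then q else 0)"
  have "X \<in> lat m" unfolding lat_iff using q by (auto simp: X_def t_def frac_ideal_def)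
  from assms[OF this] have "trace (Z ** X) \<in> max_ideal v" .
  moreover have "trace (Z ** X) = q * Z $ k $ l"
  proof -
    have "(\<Sum>i\<in>UNIV. Z $ j $ i * X $ i $ j) = (if j = k then q * Z $ k $ l else 0)" for j
    proof -
      have "(\<Sum>i\<in>UNIV. Z $ j $ i * X $ i $ j) = (\<Sum>i\<in>UNIV. if i = l then (if j = k then q * Z $ k $ l else 0) else 0)"
        by (rule sum.cong) (auto simp: X_def)
      then show ?thesis by simp
    qed
    then show ?thesis by (simp add: trace_def matrix_matrix_mult_def)
  qed
  moreover have "1 - t = (1 - m + d k - d l + 1) div 2"
    unfolding t_def by linarith
  ultimately show "Z $ k $ l \<in> frac_ideal v ((1 - m + d k - d l + 1) div 2)"
    using q by (simp add: ideal_scale)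
qed

end

section \<open>The hermitian form and the adjoint involution\<close>

text \<open>In the index type \<open>4\<close>, where \<open>4 = 0\<close>, the index that the form pairs with \<open>i\<close> is \<open>1 - i\<close>.\<close>

lemma sum_flip_4: "(\<Sum>i\<in>UNIV. g (1 - i :: 4)) = (\<Sum>i\<in>UNIV. g i)"
  by (rule sum.reindex_bij_witness[of _ "\<lambda>i. 1 - i" "\<lambda>i. 1 - i"]) auto

lemma Hmat_nth: "Hmat $ k $ l = (if l = 1 - k then 1 else 0)"
  using exhaust_4[of k] exhaust_4[of l] by (auto simp: Hmat_def matrix_unit_def)

lemma Hmat_mult_nth: "(Hmat ** X) $ k $ l = (X :: 'a::field^4^4) $ (1 - k) $ l"
  by (simp add: matrix_matrix_mult_def Hmat_nth if_distrib [where f = "\<lambda>u. u * _"] cong: if_cong)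

lemma mult_Hmat_nth: "(X ** Hmat) $ k $ l = (X :: 'a::field^4^4) $ k $ (1 - l)"
proof -
  have "(X ** Hmat) $ k $ l = (\<Sum>i\<in>UNIV. if i = 1 - l then X $ k $ i else 0)"
    unfolding matrix_matrix_mult_def vec_lambda_beta
    by (rule sum.cong) (auto simp: Hmat_nth)
  then show ?thesis by simp
qed

lemma Hmat_Hmat: "Hmat ** Hmat = (mat 1 :: 'a::field^4^4)"
  by (simp add: vec_eq_iff Hmat_mult_nth) (simp add: Hmat_nth mat_def)

lemma matrix_inv_eq:
  assumes "A ** B = mat 1" "B ** A = mat 1" shows "matrix_inv A = (B :: 'a::field^'n^'n)"
proof -
  have "A ** matrix_inv A = mat 1"
    unfolding matrix_inv_def using someI[of "\<lambda>A'. A ** A' = mat 1 \<and> A' ** A = mat 1" B] assms by blast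
  then have "B ** (A ** matrix_inv A) = B" by simp
  then show ?thesis by (simp add: matrix_mul_assoc assms)
qed

lemma adj_inv_nth: "adj_inv cj X $ k $ l = cj (X $ (1 - l) $ (1 - k))"
  by (simp add: adj_inv_def matrix_inv_eq[OF Hmat_Hmat Hmat_Hmat] mult_Hmat_nth Hmat_mult_nth
      conj_transpose_def transpose_def)

lemma herm_form_eq: "herm_form cj x y = (\<Sum>i\<in>UNIV. cj (x $ i) * y $ (1 - i))"
  by (simp add: herm_form_def matrix_vector_mult_def Hmat_nth if_distrib [where f = "\<lambda>u. u * _"] cong: if_cong)

lemma herm_form_diff_right: "herm_form cj x (y - z) = herm_form cj x y - herm_form cj x z"
  by (simp add: herm_form_eq sum_subtractf right_diff_distrib)

lemma herm_form_scale_right: "herm_form cj x (c *s y) = c * herm_form cj x y"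
  by (simp add: herm_form_eq sum_distrib_left algebra_simps)

context unramified_quadratic_ext
begin

abbreviation "f \<equiv> herm_form cj"
abbreviation "\<sigma> \<equiv> adj_inv cj"
abbreviation "G \<equiv> U22 cj"

lemma adj_adj [simp]: "\<sigma> (\<sigma> X) = X"
  by (simp add: vec_eq_iff adj_inv_nth)

lemma adj_add: "\<sigma> (X + Y) = \<sigma> X + \<sigma> Y"
  by (simp add: vec_eq_iff adj_inv_nth cj_add)

lemma adj_diff: "\<sigma> (X - Y) = \<sigma> X - \<sigma> Y"
  by (simp add: vec_eq_iff adj_inv_nth cj_diff)

lemma adj_minus: "\<sigma> (- X) = - \<sigma> X"
  by (simp add: vec_eq_iff adj_inv_nth cj_minus)

lemma adj_mat: "\<sigma> (mat c) = mat (cj c)"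
  by (simp add: vec_eq_iff adj_inv_nth mat_def)

lemma adj_1 [simp]: "\<sigma> (mat 1) = mat 1"
  by (simp add: adj_mat)

lemma adj_mult: "\<sigma> (X ** Y) = \<sigma> Y ** \<sigma> X"
proof -
  have "cj (\<Sum>i\<in>UNIV. X $ (1 - l) $ i * Y $ i $ (1 - k)) =
    (\<Sum>i\<in>UNIV. cj (Y $ (1 - i) $ (1 - k)) * cj (X $ (1 - l) $ (1 - i)))" for k l
    by (subst sum_flip_4[symmetric]) (simp add: cj_sum cj_mult mult.commute)
  then show ?thesis by (simp add: vec_eq_iff adj_inv_nth matrix_matrix_mult_def)
qed

lemma trace_adj: "trace (\<sigma> X) = cj (trace X)"
  using sum_flip_4[of "\<lambda>i. cj (X $ i $ i)"] by (simp add: trace_def adj_inv_nth cj_sum)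

lemma f_adj: "f (X *v x) y = f x (\<sigma> X *v y)"
proof -
  have "f (X *v x) y = (\<Sum>i\<in>UNIV. \<Sum>j\<in>UNIV. cj (X $ i $ j) * cj (x $ j) * y $ (1 - i))"
    by (simp add: herm_form_eq matrix_vector_mult_def cj_sum cj_mult sum_distrib_right)
  also have "\<dots> = (\<Sum>j\<in>UNIV. \<Sum>i\<in>UNIV. cj (X $ i $ j) * cj (x $ j) * y $ (1 - i))"
    by (rule sum.swap)
  also have "\<dots> = (\<Sum>j\<in>UNIV. \<Sum>i\<in>UNIV. cj (X $ (1 - i) $ j) * cj (x $ j) * y $ i)"
  proof (rule sum.cong)
    fix j
    show "(\<Sum>i\<in>UNIV. cj (X $ i $ j) * cj (x $ j) * y $ (1 - i)) =
      (\<Sum>i\<in>UNIV. cj (X $ (1 - i) $ j) * cj (x $ j) * y $ i)"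
      using sum_flip_4[of "\<lambda>i. cj (X $ i $ j) * cj (x $ j) * y $ (1 - i)"] by simp
  qed simp
  also have "\<dots> = f x (\<sigma> X *v y)"
    by (simp add: herm_form_eq matrix_vector_mult_def adj_inv_nth sum_distrib_left algebra_simps)
  finally show ?thesis .
qed

lemma G_I: "g ** \<sigma> g = mat 1 \<Longrightarrow> g \<in> G"
  unfolding U22_def invertible_def by (auto simp: matrix_left_right_inverse)

lemma G_adj: assumes "g \<in> G" shows "g ** \<sigma> g = mat 1" "\<sigma> g ** g = mat 1" "matrix_inv g = \<sigma> g" "\<sigma> g \<in> G"
proof -
  show 1: "g ** \<sigma> g = mat 1" using assms by (simp add: U22_def)
  then show 2: "\<sigma> g ** g = mat 1" by (simp add: matrix_left_right_inverse)
  show "matrix_inv g = \<sigma> g" using 1 2 by (rule matrix_inv_eq)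
  show "\<sigma> g \<in> G" by (rule G_I) (use 2 in simp)
qed

lemma G_1 [simp]: "mat 1 \<in> G"
  by (rule G_I) simp

lemma G_mult: "g \<in> G \<Longrightarrow> h \<in> G \<Longrightarrow> g ** h \<in> G"
proof (rule G_I)
  assume g: "g \<in> G" and h: "h \<in> G"
  have "g ** h ** \<sigma> (g ** h) = g ** (h ** \<sigma> h) ** \<sigma> g"
    by (simp add: adj_mult matrix_mul_assoc)
  then show "g ** h ** \<sigma> (g ** h) = mat 1" using G_adj[OF g] G_adj[OF h] by simp
qed

lemma G_cancel: assumes "g \<in> G"
  shows "g ** (\<sigma> g ** X) = X" "\<sigma> g ** (g ** X) = X" "X ** g ** \<sigma> g = X" "X ** \<sigma> g ** g = X"
  using G_adj[OF assms] by (simp_all add: matrix_mul_assoc) (simp_all add: matrix_mul_assoc[symmetric])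

lemma f_G: "g \<in> G \<Longrightarrow> f (g *v x) (g *v y) = f x y"
  by (simp add: f_adj matrix_vector_mul_assoc G_adj)

end

text \<open>The weights are compatible with the form: this makes the lattice sequence self-dual, with
  \<open>L i\<close> dual to \<open>L (1 - D - i)\<close>.\<close>

locale u22_chain = unramified_quadratic_ext v0 red0 v red \<iota> \<epsilon> s cj + chain: lattice_chain v red d
  for v0 :: "'k::field \<Rightarrow> int" and red0 :: "'k \<Rightarrow> 'r0::field"
    and v :: "'f::field \<Rightarrow> int" and red :: "'f \<Rightarrow> 'r::field"
    and \<iota> :: "'k \<Rightarrow> 'f" and \<epsilon> :: 'k and s :: 'f and cj :: "'f \<Rightarrow> 'f"
    and d :: "4 \<Rightarrow> int" +
  fixes D :: int
  assumes d_flip: "d k + d (1 - k) = D"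
begin

abbreviation "L \<equiv> Lam v d"
abbreviation "lat \<equiv> lat_filtration (Lam v d)"

lemma adj_lat: "X \<in> lat n \<Longrightarrow> \<sigma> X \<in> lat n"
  unfolding chain.lat_iff adj_inv_nth
proof (intro allI)
  fix k l assume X: "\<forall>k l. X $ k $ l \<in> frac_ideal v ((n + d k - d l + 1) div 2)"
  have "n + d (1 - l) - d (1 - k) + 1 = n + d k - d l + 1"
    using d_flip[of k] d_flip[of l] by linarith
  then show "cj (X $ (1 - l) $ (1 - k)) \<in> frac_ideal v ((n + d k - d l + 1) div 2)"
    using X by (metis ideal_cj)
qed

lemma f_ideal: "x \<in> L i \<Longrightarrow> z \<in> L k \<Longrightarrow> 1 - D + 2 * \<kappa> \<le> i + k \<Longrightarrow> f x z \<in> frac_ideal v \<kappa>"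
  unfolding herm_form_eq
proof (rule ext.ideal_sum)
  fix j assume *: "x \<in> L i" "z \<in> L k" "1 - D + 2 * \<kappa> \<le> i + k"
  show "cj (x $ j) * z $ (1 - j) \<in> frac_ideal v \<kappa>"
  proof (rule ext.ideal_mult)
    show "cj (x $ j) \<in> frac_ideal v ((i + d j) div 2)" using * by (simp add: Lam_def)
    show "z $ (1 - j) \<in> frac_ideal v ((k + d (1 - j)) div 2)" using * unfolding Lam_def by blast
    show "\<kappa> \<le> (i + d j) div 2 + (k + d (1 - j)) div 2" using *(3) d_flip[of j] by linarith
  qed
qed

text \<open>It suffices to pair with the multiples of a basis vector that lie in \<open>L k\<close>; the exponent \<open>t\<close> below is
  the least possible one.\<close>

lemma L_dualI:
  assumes "\<And>z. z \<in> L k \<Longrightarrow> f x z \<in> frac_ideal v \<kappa>" and "i \<le> 1 - D + 2 * \<kappa> - k"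
  shows "x \<in> L i"
  unfolding Lam_def
proof safe
  fix l
  define t where "t = (k + d (1 - l)) div 2"
  obtain p where p: "p \<noteq> 0" "v p = 1" using ext.val_normalized by blast
  define q where "q = p powi t"
  have q: "q \<noteq> 0" "v q = t" using p by (auto simp: q_def ext.val_powi)
  have "q *s axis (1 - l) 1 \<in> L k"
    by (rule chain.L_axis) (use q in \<open>simp add: t_def frac_ideal_def\<close>)
  then have "f x (q *s axis (1 - l) 1) \<in> frac_ideal v \<kappa>" by (rule assms)
  moreover have "f x (q *s axis (1 - l) 1) = q * cj (x $ l)"
    by (simp add: herm_form_eq axis_def if_distrib cong: if_cong)
  ultimately have "x $ l \<in> frac_ideal v (\<kappa> - t)" using q by (simp add: ext.ideal_scale)
  moreover have "(i + d l) div 2 \<le> \<kappa> - t" unfolding t_def using assms(2) d_flip[of l] by linarith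
  ultimately show "x $ l \<in> frac_ideal v ((i + d l) div 2)" by (rule ext.ideal_mono)
qed

lemma dual_L: "dual_lattice v cj (L i) = L (1 - D - i)"
  unfolding dual_lattice_def using f_ideal[of _ "1 - D - i" _ i 0] L_dualI[of i _ 0 "1 - D - i"] by auto

end

section \<open>Isometries respecting a splitting of the graded pieces\<close>

context lattice_chain
begin

text \<open>The preimage in \<open>L j\<close> of the \<open>e\<close>-eigenspace of \<open>y\<close> on \<open>L j / L (j + 1)\<close>.\<close>

definition eigen :: "'a^4^4 \<Rightarrow> 'a \<Rightarrow> int \<Rightarrow> ('a^4) set" where
  "eigen y e j = {w \<in> L j. (y - mat e) *v w \<in> L (j + 1)}"

text \<open>The endomorphism that \<open>y\<close> induces on each graded piece is a root of \<open>(X - a) (X - b)\<close>, and its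
  eigenspaces for \<open>a\<close> and \<open>b\<close> are at most one-dimensional over the residue field.\<close>

definition splits :: "'a^4^4 \<Rightarrow> 'a \<Rightarrow> 'a \<Rightarrow> bool" where
  "splits y a b \<longleftrightarrow> y \<in> lat 0 \<and> a \<in> val_ring v \<and> b \<in> val_ring v \<and>
     (y - mat a) ** (y - mat b) \<in> lat 1 \<and>
     (\<forall>e\<in>{a, b}. \<forall>j. \<forall>w\<in>eigen y e j - L (j + 1). \<forall>u\<in>eigen y e j.
        \<exists>c\<in>val_ring v. u - c *s w \<in> L (j + 1))"

lemma shift_commute: "(y - mat a) ** (y - mat b) = (y - mat b) ** (y - mat (a :: 'a))"
  by (simp only: matrix_diff_ldistrib matrix_diff_rdistrib mat_commute[of a y] mat_commute[of b y]
      mat_commute[of b "mat a"]) (simp add: algebra_simps)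

lemma splits_commute: "splits y a b \<Longrightarrow> splits y b a"
  unfolding splits_def using shift_commute[of y a b] by auto

lemma shift_lat: "y \<in> lat 0 \<Longrightarrow> a \<in> val_ring v \<Longrightarrow> y - mat a \<in> lat 0"
  by (intro lat_diff lat_mat[of _ 0]) auto

text \<open>Everything in the definition concerns the action on graded pieces, which does not see \<open>\<aa>\<^sub>1\<close>. So
  the property passes to other representatives of the character of a stratum.\<close>

lemma splits_cong:
  assumes y: "splits y a b" and X: "X \<in> lat 1"
  shows "splits (y + X) a b"
proof -
  have y0: "y \<in> lat 0" and ab: "a \<in> val_ring v" "b \<in> val_ring v" using y by (auto simp: splits_def)
  have eig: "eigen (y + X) e j = eigen y e j" for e j
  proof -
    have "(y + X - mat e) *v w \<in> L (j + 1) \<longleftrightarrow> (y - mat e) *v w \<in> L (j + 1)" if "w \<in> L j" for w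
    proof -
      have Xw: "X *v w \<in> L (j + 1)" using X that by (rule latD) simp
      have "(y + X - mat e) *v w = (y - mat e) *v w + X *v w"
        by (simp add: matrix_vector_mult_add_rdistrib matrix_vector_mult_diff_rdistrib)
      then show ?thesis using L_add[OF _ Xw, of "(y - mat e) *v w"] L_diff[OF _ Xw, of "(y + X - mat e) *v w"]
        by auto
    qed
    then show ?thesis by (auto simp: eigen_def)
  qed
  have "(y + X - mat a) ** (y + X - mat b) =
      (y - mat a) ** (y - mat b) + (X ** (y + X - mat b) + (y - mat a) ** X)"
    by (simp add: matrix_diff_ldistrib matrix_diff_rdistrib matrix_add_ldistrib matrix_add_rdistrib' algebra_simps)
  moreover have "X ** (y + X - mat b) \<in> lat 1"
    by (rule lat_mult[OF X, of _ 0]) (use y0 ab X in \<open>auto intro!: shift_lat lat_add intro: lat_mono\<close>)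
  moreover have "(y - mat a) ** X \<in> lat 1"
    by (rule lat_mult[OF shift_lat[OF y0 ab(1)] X]) simp
  ultimately have "(y + X - mat a) ** (y + X - mat b) \<in> lat 1"
    using y by (auto simp: splits_def intro!: lat_add)
  moreover have "y + X \<in> lat 0" using y0 X by (auto intro!: lat_add intro: lat_mono)
  ultimately show ?thesis using y unfolding splits_def eig by blast
qed

end

context u22_chain
begin

text \<open>Here \<open>\<theta>\<close> is \<open>1\<close> or \<open>\<beta>\<close>. The orthogonality of the two eigenspaces of \<open>y\<close> and the
  one-dimensionality of the \<open>a\<close>-eigenspace force the value \<open>f w (\<theta> w)\<close> to have the least valuation
  that duality allows: otherwise \<open>w\<close> would pair too well with a whole lattice.\<close>

lemma eigenvector_form_value:
  assumes y: "chain.splits y a b" "\<sigma> y = y" and cj_a: "cj a = a" and ab: "a - b \<noteq> 0" "v (a - b) = 0"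
    and \<theta>: "\<theta> \<in> lat (- s')" "\<theta> ** y = y ** \<theta>" and \<kappa>: "2 * \<kappa> = 2 * j - s' + D - 2"
    and w: "w \<in> chain.eigen y a j" "w \<notin> L (j + 1)" and \<theta>w: "\<theta> *v w \<notin> L (j - s' + 1)"
  shows "f w (\<theta> *v w) \<notin> frac_ideal v (\<kappa> + 1)"
proof
  assume small: "f w (\<theta> *v w) \<in> frac_ideal v (\<kappa> + 1)"
  have y0: "y \<in> lat 0" and ring: "a \<in> val_ring v" "b \<in> val_ring v"
    and prod: "(y - mat a) ** (y - mat b) \<in> lat 1"
    and one_dim: "\<And>j w u. w \<in> chain.eigen y a j \<Longrightarrow> w \<notin> L (j + 1) \<Longrightarrow> u \<in> chain.eigen y a j \<Longrightarrow>
        \<exists>c\<in>val_ring v. u - c *s w \<in> L (j + 1)"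
    using y(1) by (auto simp: chain.splits_def)
  have wL: "w \<in> L j" and yw: "(y - mat a) *v w \<in> L (j + 1)" using w by (auto simp: chain.eigen_def)
  have \<theta>wL: "\<theta> *v w \<in> L (j - s')" using \<theta>(1) wL by (rule chain.latD) simp
  have "(y - mat a) *v (\<theta> *v w) = \<theta> *v ((y - mat a) *v w)"
    by (simp add: matrix_vector_mul_assoc matrix_diff_ldistrib matrix_diff_rdistrib \<theta>(2) mat_commute)
  also have "\<dots> \<in> L (j - s' + 1)" using \<theta>(1) yw by (rule chain.latD) simp
  finally have \<theta>eig: "\<theta> *v w \<in> chain.eigen y a (j - s')" using \<theta>wL by (simp add: chain.eigen_def)
  have "f w u \<in> frac_ideal v (\<kappa> + 1)" if u: "u \<in> L (j - s')" for u
  proof -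
    have "(y - mat b) *v u \<in> L (j - s')"
      using chain.shift_lat[OF y0 ring(2)] u by (rule chain.latD) simp
    moreover have "(y - mat a) *v ((y - mat b) *v u) \<in> L (j - s' + 1)"
      unfolding matrix_vector_mul_assoc using prod u by (rule chain.latD) simp
    ultimately have "(y - mat b) *v u \<in> chain.eigen y a (j - s')" by (simp add: chain.eigen_def)
    then obtain c where c: "c \<in> val_ring v" and r: "(y - mat b) *v u - c *s (\<theta> *v w) \<in> L (j - s' + 1)"
      using one_dim[OF \<theta>eig \<theta>w] by blast
    have "f w ((y - mat b) *v u - c *s (\<theta> *v w)) \<in> frac_ideal v (\<kappa> + 1)"
      by (rule f_ideal[OF wL r]) (use \<kappa> in simp)
    then have 1: "f w ((y - mat b) *v u) - c * f w (\<theta> *v w) \<in> frac_ideal v (\<kappa> + 1)"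
      by (simp add: herm_form_diff_right herm_form_scale_right)
    have "c * f w (\<theta> *v w) \<in> frac_ideal v (\<kappa> + 1)" using c small by (rule ext.ideal_mult) simp
    from ext.ideal_add[OF 1 this] have 2: "f w ((y - mat b) *v u) \<in> frac_ideal v (\<kappa> + 1)" by simp
    have "f w ((y - mat a) *v u) = f ((y - mat a) *v w) u"
      by (simp add: f_adj adj_diff adj_mat y(2) cj_a)
    also have "\<dots> \<in> frac_ideal v (\<kappa> + 1)" by (rule f_ideal[OF yw u]) (use \<kappa> in simp)
    finally have "f w ((y - mat b) *v u) - f w ((y - mat a) *v u) \<in> frac_ideal v (\<kappa> + 1)"
      using 2 by (intro ext.ideal_diff)
    moreover have "f w ((y - mat b) *v u) - f w ((y - mat a) *v u) = (a - b) * f w u"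
      by (simp add: herm_form_diff_right matrix_vector_mult_diff_rdistrib mat_mult_vec
          herm_form_scale_right algebra_simps)
    ultimately show ?thesis using ab by (simp add: ext.ideal_scale)
  qed
  moreover have "j + 1 \<le> 1 - D + 2 * (\<kappa> + 1) - (j - s')" using \<kappa> by presburger
  ultimately have "w \<in> L (j + 1)" by (rule L_dualI)
  then show False using w by blast
qed

text \<open>Among the bounds \<open>g (L i) \<subseteq> L (i - C)\<close> the best one is considered; if \<open>C > 0\<close>, a vector at which it is sharp has
  an eigencomponent \<open>w\<close> at which it is sharp, and the value of \<open>f w (\<theta> w)\<close>, being computed before
  applying \<open>g\<close>, is too small.\<close>

lemma isometry_preserves_chain:
  assumes g: "g \<in> G" "g ** y' = y ** g" "g ** \<theta>' = \<theta> ** g"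
    and y: "chain.splits y a b" "\<sigma> y = y"
    and y': "y' \<in> lat 0" "(y' - mat a) ** (y' - mat b) \<in> lat 1"
    and cj_ab: "cj a = a" "cj b = b" and ab: "a - b \<noteq> 0" "v (a - b) = 0"
    and \<theta>: "\<theta> \<in> lat (- s')" "\<theta>' \<in> lat (- s')" "\<theta> ** y = y ** \<theta>" and parity: "even (s' + D)"
    and inj: "\<And>e j w. e \<in> {a, b} \<Longrightarrow> w \<in> chain.eigen y e j \<Longrightarrow> w \<notin> L (j + 1) \<Longrightarrow> \<theta> *v w \<notin> L (j - s' + 1)"
  shows "g \<in> lat 0"
proof -
  have ring: "a \<in> val_ring v" "b \<in> val_ring v" using y(1) by (auto simp: chain.splits_def)
  define C where "C = (LEAST C::nat. g \<in> lat (- int C))"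
  have C: "g \<in> lat (- int C)" unfolding C_def by (rule LeastI_ex) (rule chain.lat_bounded)
  have "C = 0"
  proof (rule ccontr)
    assume "C \<noteq> 0"
    then have "g \<notin> lat (- int (C - 1))" unfolding C_def by (intro not_less_Least) simp
    then obtain i x where x: "x \<in> L i" and gx: "g *v x \<notin> L (i - int C + 1)"
      using chain.latI[of g "- int (C - 1)"] \<open>C \<noteq> 0\<close> by (auto simp: algebra_simps of_nat_diff)
    define j where "j = i - int C"
    have component: "(y - mat b') *v (g *v x) \<in> L (j + 1)"
      if sp: "chain.splits y a' b'" and e: "a' \<in> {a, b}" "b' \<in> {a, b}" "cj a' = a'" "a' - b' \<noteq> 0" "v (a' - b') = 0"
        and prod: "(y' - mat a') ** (y' - mat b') \<in> lat 1" for a' b'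
    proof (rule ccontr)
      assume notin: "(y - mat b') *v (g *v x) \<notin> L (j + 1)"
      have b': "b' \<in> val_ring v" using e ring by auto
      define x' where "x' = (y' - mat b') *v x"
      define w where "w = (y - mat b') *v (g *v x)"
      have shift: "(y - mat e) ** g = g ** (y' - mat e)" for e
        by (simp add: matrix_diff_ldistrib matrix_diff_rdistrib g(2) mat_commute)
      have w: "w = g *v x'" unfolding w_def x'_def by (simp add: matrix_vector_mul_assoc shift)
      have x'L: "x' \<in> L i" unfolding x'_def using chain.shift_lat[OF y'(1) b'] x by (rule chain.latD) simp
      have wL: "w \<in> L j" unfolding w j_def using C x'L by (rule chain.latD) simp
      have "(y' - mat a') *v x' \<in> L (i + 1)"
        unfolding x'_def matrix_vector_mul_assoc using prod x by (rule chain.latD) simp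
      then have "g *v ((y' - mat a') *v x') \<in> L (j + 1)"
        unfolding j_def by (rule chain.latD[OF C]) simp
      moreover have "g *v ((y' - mat a') *v x') = (y - mat a') *v w"
        unfolding w by (simp add: matrix_vector_mul_assoc shift)
      ultimately have eig: "w \<in> chain.eigen y a' j" using wL by (simp add: chain.eigen_def)
      define \<kappa> where "\<kappa> = (2 * j - s' + D - 2) div 2"
      have \<kappa>: "2 * \<kappa> = 2 * j - s' + D - 2"
        unfolding \<kappa>_def using parity by simp
      have "\<theta> *v w \<notin> L (j - s' + 1)" using inj[OF e(1) eig] notin w_def by blast
      then have "f w (\<theta> *v w) \<notin> frac_ideal v (\<kappa> + 1)"
        using eigenvector_form_value[OF sp y(2) e(3,4,5) \<theta>(1) \<theta>(3) \<kappa> eig] notin w_def by blast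
      moreover have "\<theta> *v w = g *v (\<theta>' *v x')"
        unfolding w by (simp add: matrix_vector_mul_assoc g(3))
      then have "f w (\<theta> *v w) = f x' (\<theta>' *v x')" unfolding w using f_G[OF g(1)] by simp
      moreover have "f x' (\<theta>' *v x') \<in> frac_ideal v (\<kappa> + 1)"
      proof (rule f_ideal[OF x'L])
        show "\<theta>' *v x' \<in> L (i - s')" using \<theta>(2) x'L by (rule chain.latD) simp
        show "1 - D + 2 * (\<kappa> + 1) \<le> i + (i - s')" using \<kappa> \<open>C \<noteq> 0\<close> by (simp add: j_def)
      qed
      ultimately show False by simp
    qed
    have "(y - mat b) *v (g *v x) \<in> L (j + 1)"
      using y y' cj_ab ab by (intro component[of a b]) auto
    moreover have "(y - mat a) *v (g *v x) \<in> L (j + 1)"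
      using y y' cj_ab ab chain.splits_commute chain.shift_commute[of y' a b] ext.val_minus[of "a - b"]
      by (intro component[of b a]) auto
    ultimately have "(y - mat b) *v (g *v x) - (y - mat a) *v (g *v x) \<in> L (j + 1)"
      by (rule chain.L_diff)
    moreover have "(y - mat b) *v (g *v x) - (y - mat a) *v (g *v x) = (a - b) *s (g *v x)"
      by (simp add: matrix_vector_mult_diff_rdistrib mat_mult_vec vector_sub_rdistrib)
    ultimately have "(a - b) *s (g *v x) \<in> L (j + 1)" by (simp only:)
    then show False using gx ab(2) chain.L_scale_iff[OF ab(1)] by (simp add: j_def del: vector_sub_rdistrib)
  qed
  then show ?thesis using C by simp
qed

end

section \<open>The reduced characteristic polynomial\<close>

lemma det_4:
  fixes A :: "'a::comm_ring_1^4^4"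
  shows "det A = 
    A$1$1 * (A$2$2 * (A$3$3 * A$4$4 - A$3$4 * A$4$3) - A$2$3 * (A$3$2 * A$4$4 - A$3$4 * A$4$2) + A$2$4 * (A$3$2 * A$4$3 - A$3$3 * A$4$2))
  - A$1$2 * (A$2$1 * (A$3$3 * A$4$4 - A$3$4 * A$4$3) - A$2$3 * (A$3$1 * A$4$4 - A$3$4 * A$4$1) + A$2$4 * (A$3$1 * A$4$3 - A$3$3 * A$4$1))
  + A$1$3 * (A$2$1 * (A$3$2 * A$4$4 - A$3$4 * A$4$2) - A$2$2 * (A$3$1 * A$4$4 - A$3$4 * A$4$1) + A$2$4 * (A$3$1 * A$4$2 - A$3$2 * A$4$1))
  - A$1$4 * (A$2$1 * (A$3$2 * A$4$3 - A$3$3 * A$4$2) - A$2$2 * (A$3$1 * A$4$3 - A$3$3 * A$4$1) + A$2$3 * (A$3$1 * A$4$2 - A$3$2 * A$4$1))"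
proof -
  have f1234: "finite {2::4, 3, 4}" "1 \<notin> {2::4, 3, 4}" by auto
  have f234: "finite {3::4, 4}" "2 \<notin> {3::4, 4}" by auto
  have f34: "finite {4::4}" "3 \<notin> {4::4}" by auto
  show ?thesis
    unfolding det_def UNIV_4
    unfolding sum_over_permutations_insert[OF f1234]
    unfolding sum_over_permutations_insert[OF f234]
    unfolding sum_over_permutations_insert[OF f34]
    unfolding permutes_sing
    by (simp add: sign_swap_id permutation_swap_id permutation_compose sign_compose sign_id)
       (simp add: algebra_simps)
qed

lemma charpoly_block_triangular:
  fixes R :: "'a::field^4^4"
  assumes "R$3$1 = 0" "R$3$2 = 0" "R$4$1 = 0" "R$4$2 = 0"
  shows "charpoly R =
    [:R$1$1 * R$2$2 - R$1$2 * R$2$1, - (R$1$1 + R$2$2), 1:] *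
    [:R$3$3 * R$4$4 - R$3$4 * R$4$3, - (R$3$3 + R$4$4), 1:]"
proof -
  define A where "A = mat [:0, 1:] - (\<chi> i j. [:R $ i $ j:])"
  have A: "A $ k $ l = (if k = l then [:- (R $ k $ l), 1:] else [:- (R $ k $ l):])" for k l
    by (simp add: A_def mat_def)
  have zero: "A$3$1 = 0" "A$3$2 = 0" "A$4$1 = 0" "A$4$2 = 0" using assms by (simp_all add: A)
  have "det A = (A$1$1 * A$2$2 - A$1$2 * A$2$1) * (A$3$3 * A$4$4 - A$3$4 * A$4$3)"
    unfolding det_4 zero by (simp add: algebra_simps)
  also have "A$1$1 * A$2$2 - A$1$2 * A$2$1 = [:R$1$1 * R$2$2 - R$1$2 * R$2$1, - (R$1$1 + R$2$2), 1:]"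
    by (simp add: A algebra_simps)
  also have "A$3$3 * A$4$4 - A$3$4 * A$4$3 = [:R$3$3 * R$4$4 - R$3$4 * R$4$3, - (R$3$3 + R$4$4), 1:]"
    by (simp add: A algebra_simps)
  finally show ?thesis by (simp add: charpoly_def A_def)
qed

lemma charpoly_conj:
  fixes X P Q :: "'a::field^4^4"
  assumes "P ** Q = mat 1"
  shows "charpoly (Q ** X ** P) = charpoly X"
proof -
  have QP: "Q ** P = mat 1" using assms by (simp add: matrix_left_right_inverse)
  define c where "c M = (\<chi> i j. [:M $ i $ j:])" for M :: "'a^4^4"
  have c_mult: "c (M ** N) = c M ** c N" for M N
  proof -
    have const_sum: "[:\<Sum>k\<in>S. h k:] = (\<Sum>k\<in>S. [:h k:])" for h :: "4 \<Rightarrow> 'a" and S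
    proof (induction S rule: infinite_finite_induct)
      case (insert k S)
      have "[:h k + sum h S:] = [:h k:] + [:sum h S:]" by simp
      then show ?case using insert by simp
    qed simp_all
    show ?thesis by (simp add: c_def vec_eq_iff matrix_matrix_mult_def const_sum mult.commute)
  qed
  have c_1: "c (mat 1) = mat 1" by (simp add: c_def vec_eq_iff mat_def)
  have "mat [:0, 1:] - c (Q ** X ** P) = c Q ** (mat [:0, 1:] - c X) ** c P"
  proof -
    have "c Q ** mat [:0, 1:] ** c P = mat [:0, 1:] ** (c Q ** c P)"
      by (simp add: mat_commute[symmetric] matrix_mul_assoc)
    also have "\<dots> = mat [:0, 1:]" using c_mult[of Q P] unfolding QP c_1 by (metis matrix_mul_rid)
    finally show ?thesis by (simp add: matrix_diff_ldistrib matrix_diff_rdistrib c_mult)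
  qed
  then have "charpoly (Q ** X ** P) = det (c Q) * det (mat [:0, 1:] - c X) * det (c P)"
    unfolding charpoly_def c_def by (simp add: det_mul)
  moreover have "det (c Q) * det (c P) = 1"
    using QP c_1 c_mult[of Q P] by (metis det_I det_mul)
  ultimately show ?thesis unfolding charpoly_def c_def by (simp add: mult.assoc mult.left_commute)
qed

lemma cayley_hamilton_2:
  fixes t11 t12 t21 t22 a b x1 x2 :: "'r::field"
  assumes "t11 + t22 = a + b" "t11 * t22 - t12 * t21 = a * b"
  shows "(t11 - a) * ((t11 - b) * x1 + t12 * x2) + t12 * (t21 * x1 + (t22 - b) * x2) = 0"
    and "t21 * ((t11 - b) * x1 + t12 * x2) + (t22 - a) * (t21 * x1 + (t22 - b) * x2) = 0"
  using assms by algebra+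

text \<open>As \<open>a \<noteq> b\<close>, the matrix is not the scalar \<open>a\<close>: its trace would be \<open>2 a\<close>. So one row of its difference
  with \<open>a\<close> is a nonzero linear equation for the eigenvectors.\<close>

lemma eigenspace_dim_2:
  fixes t11 t12 t21 t22 a b :: "'r::field"
  assumes T: "t11 + t22 = a + b" "t11 * t22 - t12 * t21 = a * b" "a \<noteq> b"
    and w: "(t11 - a) * w1 + t12 * w2 = 0" "t21 * w1 + (t22 - a) * w2 = 0" "\<not> (w1 = 0 \<and> w2 = 0)"
    and u: "(t11 - a) * u1 + t12 * u2 = 0" "t21 * u1 + (t22 - a) * u2 = 0"
  shows "\<exists>c. u1 = c * w1 \<and> u2 = c * w2"
proof -
  have ratio: "\<exists>c. u1 = c * w1 \<and> u2 = c * w2"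
    if "p * w1 + q * w2 = 0" "p * u1 + q * u2 = 0" "\<not> (p = 0 \<and> q = 0)" for p q
  proof -
    have "u1 * w2 = u2 * w1" using that by algebra
    then show ?thesis
      using w(3) by (cases "w1 = 0") (auto intro: exI[of _ "u1 / w1"] exI[of _ "u2 / w2"] simp: field_simps)
  qed
  have "\<not> (t11 = a \<and> t12 = 0 \<and> t21 = 0 \<and> t22 = a)" using T by auto
  then show ?thesis
    using ratio[of "t11 - a" t12] ratio[of t21 "t22 - a"] w u by auto
qed

context nonarch_local_field
begin

definition integral_poly :: "'a poly \<Rightarrow> bool" where
  "integral_poly p \<longleftrightarrow> (\<forall>i. coeff p i \<in> val_ring v)"

lemma integral_poly_add: "integral_poly p \<Longrightarrow> integral_poly q \<Longrightarrow> integral_poly (p + q)"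
  by (simp add: integral_poly_def ideal_add)

lemma integral_poly_mult: "integral_poly p \<Longrightarrow> integral_poly q \<Longrightarrow> integral_poly (p * q)"
  unfolding integral_poly_def coeff_mult by (intro allI ideal_sum) (auto intro: ideal_mult)

lemma integral_poly_sign: "integral_poly (of_int (sign p))"
  by (cases p rule: sign_cases) (simp_all add: integral_poly_def coeff_1)

lemma map_red_add:
  "integral_poly p \<Longrightarrow> integral_poly q \<Longrightarrow> map_poly red (p + q) = map_poly red p + map_poly red q"
  by (rule poly_eqI) (simp add: coeff_map_poly integral_poly_def red_add)

lemma map_red_mult:
  "integral_poly p \<Longrightarrow> integral_poly q \<Longrightarrow> map_poly red (p * q) = map_poly red p * map_poly red q"
proof (rule poly_eqI)
  fix n assume pq: "integral_poly p" "integral_poly q"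
  have "coeff p i * coeff q (n - i) \<in> val_ring v" for i
    using pq by (auto simp: integral_poly_def intro: ideal_mult)
  then have "red (\<Sum>i\<le>n. coeff p i * coeff q (n - i)) = (\<Sum>i\<le>n. red (coeff p i * coeff q (n - i)))"
    by (intro red_sum) auto
  also have "\<dots> = (\<Sum>i\<le>n. red (coeff p i) * red (coeff q (n - i)))"
    using pq by (intro sum.cong refl red_mult) (auto simp: integral_poly_def)
  finally show "coeff (map_poly red (p * q)) n = coeff (map_poly red p * map_poly red q) n"
    by (simp add: coeff_map_poly coeff_mult)
qed

text \<open>Reduction is a ring homomorphism on polynomials with integral coefficients only, so integrality has
  to be carried through the Leibniz formula.\<close>

lemma red_charpoly:
  assumes X: "\<And>i j. X $ i $ j \<in> val_ring v"
  shows "map_poly red (charpoly X) = charpoly (\<chi> i j. red (X $ i $ j))"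
proof -
  define A where "A = mat [:0, 1:] - (\<chi> i j. [:X $ i $ j:])"
  have Aij: "A $ i $ j = [:- (X $ i $ j), if i = j then 1 else 0:]" for i j
    by (simp add: A_def mat_def)
  have A: "integral_poly (A $ i $ j)" for i j
    using X[of i j] unfolding Aij integral_poly_def by (auto simp: coeff_pCons split: nat.splits)
  have redA: "map_poly red (A $ i $ j) = mat [:0, 1:] $ i $ j - [:red (X $ i $ j):]" for i j
    unfolding Aij using X[of i j] by (auto simp: map_poly_pCons red_minus red_one mat_def)
  have prod: "integral_poly (\<Prod>i\<in>S. A $ i $ p i) \<and>
      map_poly red (\<Prod>i\<in>S. A $ i $ p i) = (\<Prod>i\<in>S. map_poly red (A $ i $ p i))" for p S
  proof (induction S rule: infinite_finite_induct)
    case (insert x S)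
    then show ?case using A by (simp add: integral_poly_mult map_red_mult)
  qed (auto simp: integral_poly_def coeff_1 red_one)
  have sgn: "map_poly red (of_int (sign p)) = of_int (sign p)" for p :: "4 \<Rightarrow> 4"
  proof -
    have "map_poly red (- 1) = - 1"
      by (rule poly_eqI) (simp add: coeff_map_poly coeff_1 red_minus red_one)
    then show ?thesis by (cases p rule: sign_cases) (simp_all add: red_one)
  qed
  have summand: "integral_poly (of_int (sign p) * (\<Prod>i\<in>UNIV. A $ i $ p i)) \<and>
      map_poly red (of_int (sign p) * (\<Prod>i\<in>UNIV. A $ i $ p i)) =
      of_int (sign p) * (\<Prod>i\<in>UNIV. map_poly red (A $ i $ p i))" for p
    using prod[of p UNIV] integral_poly_sign[of p] by (simp add: integral_poly_mult map_red_mult sgn)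
  have "integral_poly (\<Sum>p\<in>S. of_int (sign p) * (\<Prod>i\<in>UNIV. A $ i $ p i)) \<and>
      map_poly red (\<Sum>p\<in>S. of_int (sign p) * (\<Prod>i\<in>UNIV. A $ i $ p i)) =
      (\<Sum>p\<in>S. of_int (sign p) * (\<Prod>i\<in>UNIV. map_poly red (A $ i $ p i)))" for S
  proof (induction S rule: infinite_finite_induct)
    case (insert x S)
    then show ?case using summand[of x] by (simp add: integral_poly_add map_red_add)
  qed (auto simp: integral_poly_def)
  then show ?thesis
    unfolding charpoly_def det_def A_def[symmetric] by (simp add: redA)
qed

end

context lattice_chain
begin

text \<open>One graded piece \<open>L j / L (j + 1)\<close>, with coordinates \<open>r1\<close> and \<open>r2\<close> over the residue field, on
  which \<open>y\<close> acts by the matrix \<open>t\<close>.\<close>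

lemma graded_piece_splits:
  assumes y: "y \<in> lat 0" and ring: "a \<in> val_ring v" "b \<in> val_ring v"
    and lin: "\<And>x z c. x \<in> L j \<Longrightarrow> z \<in> L j \<Longrightarrow> c \<in> val_ring v \<Longrightarrow>
        r1 (x - c *s z) = r1 x - red c * r1 z \<and> r2 (x - c *s z) = r2 x - red c * r2 z"
    and ker: "\<And>x. x \<in> L j \<Longrightarrow> x \<in> L (j + 1) \<longleftrightarrow> r1 x = 0 \<and> r2 x = 0"
    and act: "\<And>x. x \<in> L j \<Longrightarrow> r1 (y *v x) = t11 * r1 x + t12 * r2 x \<and> r2 (y *v x) = t21 * r1 x + t22 * r2 x"
    and T: "t11 + t22 = red a + red b" "t11 * t22 - t12 * t21 = red a * red b" "red a \<noteq> red b"
  shows "x \<in> L j \<Longrightarrow> (y - mat a) ** (y - mat b) *v x \<in> L (j + 1)"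
    and "w \<in> eigen y a j \<Longrightarrow> w \<notin> L (j + 1) \<Longrightarrow> u \<in> eigen y a j \<Longrightarrow> \<exists>c\<in>val_ring v. u - c *s w \<in> L (j + 1)"
proof -
  have shift: "r1 ((y - mat e) *v x) = (t11 - red e) * r1 x + t12 * r2 x"
      "r2 ((y - mat e) *v x) = t21 * r1 x + (t22 - red e) * r2 x"
      "(y - mat e) *v x \<in> L j"
    if "x \<in> L j" "e \<in> val_ring v" for x e
  proof -
    have "(y - mat e) *v x = y *v x - e *s x"
      by (simp add: matrix_vector_mult_diff_rdistrib mat_mult_vec)
    moreover have "y *v x \<in> L j" using y that(1) by (rule latD) simp
    ultimately show "r1 ((y - mat e) *v x) = (t11 - red e) * r1 x + t12 * r2 x"
      "r2 ((y - mat e) *v x) = t21 * r1 x + (t22 - red e) * r2 x"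
      using lin[of "y *v x" x e] act[OF that(1)] that by (simp_all add: algebra_simps)
    show "(y - mat e) *v x \<in> L j" using shift_lat[OF y that(2)] that(1) by (rule latD) simp
  qed
  show "(y - mat a) ** (y - mat b) *v x \<in> L (j + 1)" if x: "x \<in> L j"
  proof -
    let ?z = "(y - mat b) *v x"
    have "(y - mat a) *v ?z \<in> L (j + 1)"
      using shift[OF x ring(2)] shift[OF _ ring(1), of ?z] ker[of "(y - mat a) *v ?z"]
        cayley_hamilton_2[OF T(1,2), of "r1 x" "r2 x"] by simp
    then show ?thesis by (simp add: matrix_vector_mul_assoc)
  qed
  show "\<exists>c\<in>val_ring v. u - c *s w \<in> L (j + 1)"
    if w: "w \<in> eigen y a j" "w \<notin> L (j + 1)" and u: "u \<in> eigen y a j"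
  proof -
    have wL: "w \<in> L j" "u \<in> L j" and ev: "(y - mat a) *v w \<in> L (j + 1)" "(y - mat a) *v u \<in> L (j + 1)"
      using w u by (auto simp: eigen_def)
    have "\<exists>c. r1 u = c * r1 w \<and> r2 u = c * r2 w"
      by (rule eigenspace_dim_2[OF T])
         (use ker[of w] ker[of "(y - mat a) *v w"] ker[of "(y - mat a) *v u"] shift[of w a] shift[of u a]
           wL ev w ring in auto)
    then obtain c where c: "r1 u = c * r1 w" "r2 u = c * r2 w" by blast
    obtain c' where c': "c' \<in> val_ring v" "red c' = c" using red_surj by (metis UNIV_I image_iff)
    have "u - c' *s w \<in> L j"
      by (rule L_diff[OF wL(2)]) (rule L_scale[OF c'(1) wL(1)], simp)
    then show ?thesis using lin[OF wL(2,1) c'(1)] ker[of "u - c' *s w"] c c' by auto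
  qed
qed

end

section \<open>The two lattice sequences\<close>

definition wt1 :: "4 \<Rightarrow> int" where "wt1 k = (if k = 1 \<or> k = 2 then 0 else 1)"

lemma wt1_simps [simp]: "wt1 1 = 0" "wt1 2 = 0" "wt1 3 = 1" "wt1 4 = 1"
  by (simp_all add: wt1_def)

context nonarch_local_field
begin

text \<open>On the even (odd) graded pieces \<open>y\<close> acts by the lower (upper) diagonal block of its reduction.
  Being products \<open>R Q\<close> and \<open>Q R\<close> of the same off-diagonal blocks of \<open>\<beta>\<close>, the two blocks have the same
  characteristic polynomial, whose square is the given polynomial.\<close>

lemma splits_wt1:
  assumes p: "p \<noteq> 0" "v p = 1" and n: "n = 2 * m + 1"
    and \<beta>: "\<beta> \<in> lat_filtration (Lam v wt1) (- int n)"
    and a: "a \<in> val_ring v" and b: "b \<in> val_ring v" and ab: "red a \<noteq> red b"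
    and phi: "map_poly red (charpoly (mat (p ^ n) ** (\<beta> ** \<beta>))) = [:- red a, 1:] ^ 2 * [:- red b, 1:] ^ 2"
  shows "lattice_chain.splits v wt1 (mat (p ^ n) ** (\<beta> ** \<beta>)) a b"
proof -
  interpret chain: lattice_chain v red wt1 by unfold_locales
  define y where "y = mat (p ^ n) ** (\<beta> ** \<beta>)"
  have y0: "y \<in> chain.lat 0"
    unfolding y_def
  proof (rule chain.lat_scale)
    show "p ^ n \<in> frac_ideal v (int n)" using p by (simp add: frac_ideal_def val_power)
    show "\<beta> ** \<beta> \<in> chain.lat (- int n + - int n)" by (rule chain.lat_mult[OF \<beta> \<beta>]) simp
  qed simp
  have y_nth: "y $ k $ l \<in> frac_ideal v ((wt1 k - wt1 l + 1) div 2)" for k l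
    using y0 unfolding chain.lat_iff by simp
  have integral: "y $ k $ l \<in> val_ring v" for k l
    using y_nth[of k l] by (rule ideal_mono) (simp add: wt1_def)
  have lower: "y$3$1 \<in> max_ideal v" "y$3$2 \<in> max_ideal v" "y$4$1 \<in> max_ideal v" "y$4$2 \<in> max_ideal v"
    using y_nth[of 3 1] y_nth[of 3 2] y_nth[of 4 1] y_nth[of 4 2] by simp_all
  \<comment> \<open>In this scaling the upper right block of \<open>\<beta>\<close> is integral and all other entries lie in the maximal
    ideal; \<open>q\<close> and \<open>r\<close> below are the leading terms of the two off-diagonal blocks.\<close>
  define B where "B k l = p ^ (m + 1) * \<beta> $ k $ l" for k l
  have B: "B k l \<in> frac_ideal v (int m + 1 + (- int n + wt1 k - wt1 l + 1) div 2)" for k l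
  proof -
    have "\<beta> $ k $ l \<in> frac_ideal v ((- int n + wt1 k - wt1 l + 1) div 2)"
      using \<beta> unfolding chain.lat_iff by blast
    moreover have "v (p ^ (m + 1)) = int m + 1" using val_power[OF p(1), of "m + 1"] p(2) by simp
    ultimately show ?thesis
      unfolding B_def using p by (intro ideal_mult) (auto simp: frac_ideal_def)
  qed
  have Q: "B k l \<in> val_ring v" if "k \<in> {1, 2}" "l \<in> {3, 4}" for k l
    using B[of k l] that n by (auto intro: ideal_mono)
  have B': "B k l \<in> max_ideal v" if "k \<in> {3, 4} \<or> l \<in> {1, 2}" for k l
  proof -
    have "0 \<le> wt1 k - wt1 l" using that exhaust_4[of k] exhaust_4[of l] by auto
    then show ?thesis using B[of k l] n by (elim ideal_mono) linarith
  qed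
  have B0: "B k l \<in> val_ring v" for k l
    using Q[of k l] ideal_mono[OF B'[of k l], of 0] exhaust_4[of k] exhaust_4[of l] by auto
  have div: "x \<in> max_ideal v \<Longrightarrow> x / p \<in> val_ring v" for x
    using p by (cases "x = 0") (auto simp: frac_ideal_def val_divide)
  define q where "q k l = red (B k l)" for k l
  define r where "r k l = red (B k l / p)" for k l
  have y_B: "y $ k $ l = (\<Sum>i\<in>UNIV. B k i * B i l) / p" for k l
  proof -
    have "p * p ^ n = p ^ (m + 1) * p ^ (m + 1)" by (simp only: n power_Suc[symmetric] power_add[symmetric]) (simp add: mult_2)
    moreover have "y $ k $ l = p ^ n * (\<Sum>i\<in>UNIV. \<beta> $ k $ i * \<beta> $ i $ l)"
      by (simp only: y_def mat_mult_nth) (simp only: matrix_matrix_mult_def vec_lambda_beta)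
    moreover have "(\<Sum>i\<in>UNIV. B k i * B i l) = p ^ (m + 1) * p ^ (m + 1) * (\<Sum>i\<in>UNIV. \<beta> $ k $ i * \<beta> $ i $ l)"
      unfolding B_def sum_distrib_left by (rule sum.cong) (simp_all only: ac_simps)
    ultimately have "p * y $ k $ l = (\<Sum>i\<in>UNIV. B k i * B i l)" by (simp only: mult.assoc[symmetric])
    then show ?thesis using p by (simp add: field_simps)
  qed
  have upper_block: "red (y $ k $ l) = q k 3 * r 3 l + q k 4 * r 4 l" if "k \<in> {1, 2}" "l \<in> {1, 2}" for k l
  proof -
    have m1: "B k 1 \<in> max_ideal v" "B k 2 \<in> max_ideal v" using that B' by auto
    have m2: "B i l / p \<in> val_ring v" for i using that B' div by auto
    have m3: "B k 3 \<in> val_ring v" "B k 4 \<in> val_ring v" using that Q by auto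
    have t: "B k i * (B i l / p) \<in> val_ring v" for i
      by (rule ideal_mult[OF B0 m2]) simp
    have "y $ k $ l = (\<Sum>i\<in>UNIV. B k i * (B i l / p))"
      by (simp add: y_B sum_divide_distrib)
    then have "red (y $ k $ l) = (\<Sum>i\<in>UNIV. red (B k i * (B i l / p)))"
      using t by (simp only: red_sum)
    also have "\<dots> = red (B k 1 * (B 1 l / p)) + red (B k 2 * (B 2 l / p)) +
        red (B k 3 * (B 3 l / p)) + red (B k 4 * (B 4 l / p))" by (rule sum_4)
    also have "red (B k 1 * (B 1 l / p)) = 0"
      by (rule red_eq_0) (rule ideal_mult[OF m1(1) m2], simp)
    also have "red (B k 2 * (B 2 l / p)) = 0"
      by (rule red_eq_0) (rule ideal_mult[OF m1(2) m2], simp)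
    finally show ?thesis using m2 m3 by (simp only: red_mult q_def r_def add_0)
  qed
  have lower_block: "red (y $ k $ l) = r k 1 * q 1 l + r k 2 * q 2 l" if "k \<in> {3, 4}" "l \<in> {3, 4}" for k l
  proof -
    have m1: "B k i / p \<in> val_ring v" for i using that B' div by auto
    have m2: "B 1 l \<in> val_ring v" "B 2 l \<in> val_ring v" using that Q by auto
    have m3: "B 3 l \<in> max_ideal v" "B 4 l \<in> max_ideal v" using that B' by auto
    have t: "B k i / p * B i l \<in> val_ring v" for i
      by (rule ideal_mult[OF m1 B0]) simp
    have "y $ k $ l = (\<Sum>i\<in>UNIV. B k i / p * B i l)"
      by (simp add: y_B sum_divide_distrib)
    then have "red (y $ k $ l) = (\<Sum>i\<in>UNIV. red (B k i / p * B i l))"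
      using t by (simp only: red_sum)
    also have "\<dots> = red (B k 1 / p * B 1 l) + red (B k 2 / p * B 2 l) +
        red (B k 3 / p * B 3 l) + red (B k 4 / p * B 4 l)" by (rule sum_4)
    also have "red (B k 3 / p * B 3 l) = 0"
      by (rule red_eq_0) (rule ideal_mult[OF m1 m3(1)], simp)
    also have "red (B k 4 / p * B 4 l) = 0"
      by (rule red_eq_0) (rule ideal_mult[OF m1 m3(2)], simp)
    finally show ?thesis using m1 m2 by (simp only: red_mult q_def r_def add_0_right)
  qed
  define t where "t k l = red (y $ k $ l)" for k l
  define tr where "tr = t 1 1 + t 2 2"
  define dt where "dt = t 1 1 * t 2 2 - t 1 2 * t 2 1"
  have tr': "tr = t 3 3 + t 4 4" unfolding tr_def t_def by (simp add: upper_block lower_block algebra_simps)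
  have dt': "dt = t 3 3 * t 4 4 - t 3 4 * t 4 3"
    unfolding dt_def t_def by (simp add: upper_block lower_block algebra_simps)
  have "[:dt, - tr, 1:] ^ 2 = ([:- red a, 1:] * [:- red b, 1:]) ^ 2"
  proof -
    have "charpoly (\<chi> i j. red (y $ i $ j)) = [:dt, - tr, 1:] * [:dt, - tr, 1:]"
      using lower by (subst charpoly_block_triangular)
        (simp_all add: red_eq_0 tr'[unfolded t_def] dt'[unfolded t_def]
          flip: tr_def[unfolded t_def] dt_def[unfolded t_def])
    then show ?thesis
      using phi red_charpoly[OF integral] by (simp only: y_def power_mult_distrib power2_eq_square) (simp only: ac_simps)
  qed
  then have "[:dt, - tr, 1:] = [:- red a, 1:] * [:- red b, 1:] \<or> [:dt, - tr, 1:] = - ([:- red a, 1:] * [:- red b, 1:])"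
    by (simp only: power2_eq_iff)
  then have "tr = red a + red b \<and> dt = red a * red b"
  proof (elim disjE)
    assume "[:dt, - tr, 1:] = - ([:- red a, 1:] * [:- red b, 1:])"
    then have *: "dt + red a * red b = 0" "- tr = red a + red b" "(2::'r) = 0"
      by (simp_all add: eq_neg_iff_add_eq_0 mult.commute)
    have neg: "- z = z" for z :: 'r
      using *(3) mult_2[of z] by (simp add: neg_eq_iff_add_eq_0)
    have "tr = red a + red b" using *(2) neg by metis
    moreover have "dt = red a * red b" using *(1) neg by (metis eq_neg_iff_add_eq_0)
    ultimately show "tr = red a + red b \<and> dt = red a * red b" ..
  next
    assume "[:dt, - tr, 1:] = [:- red a, 1:] * [:- red b, 1:]"
    then have *: "dt = red a * red b" "- tr = - red a - red b" by (simp_all add: mult.commute)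
    have "tr = red a + red b" using *(2) by (auto simp: minus_equation_iff[of tr] add.commute)
    then show "tr = red a + red b \<and> dt = red a * red b" using *(1) ..
  qed
  then have T: "tr = red a + red b" "dt = red a * red b" by simp_all
  have graded: "(\<forall>x\<in>chain.L j. (y - mat a') ** (y - mat b') *v x \<in> chain.L (j + 1)) \<and>
      (\<forall>w u. w \<in> chain.eigen y a' j \<longrightarrow> w \<notin> chain.L (j + 1) \<longrightarrow> u \<in> chain.eigen y a' j \<longrightarrow>
        (\<exists>c\<in>val_ring v. u - c *s w \<in> chain.L (j + 1)))"
    if ab': "a' \<in> val_ring v" "b' \<in> val_ring v" "red a' \<noteq> red b'" "tr = red a' + red b'" "dt = red a' * red b'"
    for a' b' j
  proof -
    define h where "h = p powi (- (j div 2))"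
    have h: "h \<noteq> 0" "v h = - (j div 2)" using p by (auto simp: h_def val_powi)
    define c where "c k x = red (h * x $ k)" for k and x :: "'a^4"
    have coord: "h * x $ k \<in> val_ring v" if "x \<in> chain.L j" for x k
    proof -
      have "x $ k \<in> frac_ideal v ((j + wt1 k) div 2)" using that by (simp add: Lam_def)
      then have "x $ k \<in> frac_ideal v (j div 2)" by (rule ideal_mono) (auto simp: wt1_def intro: zdiv_mono1)
      then show ?thesis using h by (simp add: ideal_scale)
    qed
    have c0: "c k x = 0 \<longleftrightarrow> x $ k \<in> frac_ideal v (1 + j div 2)" if "x \<in> chain.L j" for k x
      unfolding c_def using red_kernel[OF coord[OF that]] h by (simp add: ideal_scale)
    have lin: "c k (x - e *s z) = c k x - red e * c k z"
      if "x \<in> chain.L j" "z \<in> chain.L j" "e \<in> val_ring v" for k x z e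
    proof -
      have "h * (x - e *s z) $ k = h * x $ k - e * (h * z $ k)" by (simp add: algebra_simps)
      moreover have "e * (h * z $ k) \<in> val_ring v" using that(3) coord[OF that(2)] by (rule ideal_mult) simp
      ultimately show ?thesis using that coord by (simp only: c_def red_diff red_mult)
    qed
    have act: "c k (y *v x) = (\<Sum>l\<in>UNIV. t k l * c l x)" if "x \<in> chain.L j" for k x
    proof -
      have "h * (y *v x) $ k = (\<Sum>l\<in>UNIV. y $ k $ l * (h * x $ l))"
        by (simp add: matrix_vector_mult_def sum_distrib_left algebra_simps)
      moreover have "y $ k $ l * (h * x $ l) \<in> val_ring v" for l
        using integral coord[OF that] by (rule ideal_mult) simp
      ultimately show ?thesis using integral coord[OF that] by (simp only: c_def t_def red_sum red_mult)
    qed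
    have act': "c k (y *v x) = t k 1 * c 1 x + t k 2 * c 2 x + t k 3 * c 3 x + t k 4 * c 4 x"
      if "x \<in> chain.L j" for k x
      using act[OF that] by (simp add: sum_4)
    have all_ideal: "x \<in> chain.L i \<longleftrightarrow> x$1 \<in> frac_ideal v (i div 2) \<and> x$2 \<in> frac_ideal v (i div 2) \<and>
        x$3 \<in> frac_ideal v ((i + 1) div 2) \<and> x$4 \<in> frac_ideal v ((i + 1) div 2)" for x i
      by (simp add: Lam_def forall_4)
    show ?thesis
    proof (cases "even j")
      case True
      then obtain i where j: "j = 2 * i" by blast
      have t0: "t 3 1 = 0" "t 3 2 = 0" "t 4 1 = 0" "t 4 2 = 0"
        using lower by (simp_all add: t_def red_eq_0)
      have ker: "x \<in> chain.L (j + 1) \<longleftrightarrow> c 3 x = 0 \<and> c 4 x = 0" if "x \<in> chain.L j" for x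
        using that c0[OF that] unfolding all_ideal j by (simp add: add.commute)
      note G = chain.graded_piece_splits[OF y0 ab'(1,2), of j "c 3" "c 4" "t 3 3" "t 3 4" "t 4 3" "t 4 4"]
      show ?thesis
        using G lin ker act' t0 ab' tr' dt' by auto
    next
      case False
      then obtain i where j: "j = 2 * i + 1" by (elim oddE)
      have c34: "c 3 x = 0" "c 4 x = 0" if "x \<in> chain.L j" for x
        using that c0[OF that] unfolding all_ideal j by (auto simp: add.commute)
      have ker: "x \<in> chain.L (j + 1) \<longleftrightarrow> c 1 x = 0 \<and> c 2 x = 0" if "x \<in> chain.L j" for x
        using that c0[OF that] unfolding all_ideal j by (simp add: add.commute)
      note G = chain.graded_piece_splits[OF y0 ab'(1,2), of j "c 1" "c 2" "t 1 1" "t 1 2" "t 2 1" "t 2 2"]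
      show ?thesis
        using G lin ker act' c34 ab' tr_def dt_def by auto
    qed
  qed
  have "(y - mat a) ** (y - mat b) \<in> chain.lat 1"
    by (rule chain.latI) (use graded[OF a b ab T] in blast)
  moreover have "\<forall>e\<in>{a, b}. \<forall>j. \<forall>w\<in>chain.eigen y e j - chain.L (j + 1). \<forall>u\<in>chain.eigen y e j.
        \<exists>c\<in>val_ring v. u - c *s w \<in> chain.L (j + 1)"
    using graded[OF a b ab T] graded[OF b a] ab T by (auto simp: add.commute mult.commute)
  ultimately have "chain.splits y a b" using y0 a b by (simp only: chain.splits_def simp_thms)
  then show ?thesis unfolding y_def .
qed

end

definition wt2 :: "4 \<Rightarrow> int" where "wt2 k = (if k = 1 then 0 else if k = 4 then 2 else 1)"

lemma wt2_simps [simp]: "wt2 1 = 0" "wt2 2 = 1" "wt2 3 = 1" "wt2 4 = 2"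
  by (simp_all add: wt2_def)

context nonarch_local_field
begin

text \<open>All notions involved are defined by the lattices, hence a linear map between lattice sequences
  transports them.\<close>

lemma splits_transport:
  assumes PQ: "P ** Q = mat 1" and Q: "\<And>i x. x \<in> Lam v d' i \<longleftrightarrow> Q *v x \<in> Lam v d i"
    and sp: "lattice_chain.splits v d (Q ** y ** P) a b"
  shows "lattice_chain.splits v d' y a b"
proof -
  interpret c: lattice_chain v red d by unfold_locales
  interpret c': lattice_chain v red d' by unfold_locales
  have QP: "Q ** P = mat 1" using PQ by (simp add: matrix_left_right_inverse)
  have pull_back: "X \<in> c'.lat n" if "Q ** X ** P \<in> c.lat n" for X n
  proof (rule c'.latI)
    fix i x assume "x \<in> c'.L i"
    then have "(Q ** X ** P) *v (Q *v x) \<in> c.L (i + n)"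
      using Q c.latD[OF that] by blast
    then have "Q *v (X *v x) \<in> c.L (i + n)"
      by (simp add: matrix_vector_mul_assoc matrix_mul_assoc[symmetric] PQ)
    then show "X *v x \<in> c'.L (i + n)" by (simp add: Q)
  qed
  have shift: "Q ** (y - mat e) ** P = Q ** y ** P - mat e" for e
  proof -
    have "Q ** mat e ** P = mat e ** (Q ** P)" by (simp add: mat_commute[symmetric] matrix_mul_assoc)
    then show ?thesis by (simp add: matrix_diff_ldistrib matrix_diff_rdistrib QP)
  qed
  have Qshift: "Q *v ((y - mat e) *v x) = (Q ** y ** P - mat e) *v (Q *v x)" for e x
  proof -
    have "(Q ** (y - mat e) ** P) *v (Q *v x) = (Q ** (y - mat e) ** (P ** Q)) *v x"
      by (simp only: matrix_vector_mul_assoc matrix_mul_assoc)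
    then show ?thesis by (simp add: shift PQ matrix_vector_mul_assoc)
  qed
  have eig: "w \<in> c'.eigen y e j \<longleftrightarrow> Q *v w \<in> c.eigen (Q ** y ** P) e j" for w e j
    by (simp add: c.eigen_def c'.eigen_def Q Qshift)
  have "Q ** ((y - mat a) ** (y - mat b)) ** P = (Q ** y ** P - mat a) ** (Q ** y ** P - mat b)"
    unfolding shift[symmetric] by (simp add: matrix_mul_assoc) (simp add: matrix_mul_assoc[symmetric] PQ)
  then have prod: "(y - mat a) ** (y - mat b) \<in> c'.lat 1"
    using sp by (intro pull_back) (simp add: c.splits_def)
  have one_dim: "\<exists>c\<in>val_ring v. u - c *s w \<in> c'.L (j + 1)"
    if e: "e \<in> {a, b}" and w: "w \<in> c'.eigen y e j" "w \<notin> c'.L (j + 1)" and u: "u \<in> c'.eigen y e j" for e j w u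
  proof -
    have "Q *v w \<in> c.eigen (Q ** y ** P) e j - c.L (j + 1)" "Q *v u \<in> c.eigen (Q ** y ** P) e j"
      using w u by (auto simp: eig Q)
    then obtain c where c: "c \<in> val_ring v" "Q *v u - c *s (Q *v w) \<in> c.L (j + 1)"
      using sp e unfolding c.splits_def by blast
    have "Q *v (u - c *s w) = Q *v u - c *s (Q *v w)"
      by (simp add: matrix_vector_mult_diff_distrib vector_scalar_commute)
    then show ?thesis using c Q[of "u - c *s w" "j + 1"] by auto
  qed
  have "y \<in> c'.lat 0" using sp by (intro pull_back) (simp add: c.splits_def)
  then show ?thesis using sp prod one_dim unfolding c'.splits_def c.splits_def by blast
qed

text \<open>A monomial matrix carries the second lattice sequence to the first.\<close>

lemma splits_wt2:
  assumes p: "p \<noteq> 0" "v p = 1" and n: "n = 2 * m + 1"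
    and \<beta>: "\<beta> \<in> lat_filtration (Lam v wt2) (- int n)"
    and a: "a \<in> val_ring v" and b: "b \<in> val_ring v" and ab: "red a \<noteq> red b"
    and phi: "map_poly red (charpoly (mat (p ^ n) ** (\<beta> ** \<beta>))) = [:- red a, 1:] ^ 2 * [:- red b, 1:] ^ 2"
  shows "lattice_chain.splits v wt2 (mat (p ^ n) ** (\<beta> ** \<beta>)) a b"
proof -
  interpret c: lattice_chain v red wt1 by unfold_locales
  interpret c': lattice_chain v red wt2 by unfold_locales
  define Q :: "'a^4^4" where "Q = (\<chi> k l. if k = 1 \<and> l = 1 \<or> k = 3 \<and> l = 3 \<or> k = 4 \<and> l = 2 then 1
      else if k = 2 \<and> l = 4 then inverse p else 0)"
  define P :: "'a^4^4" where "P = (\<chi> k l. if k = 1 \<and> l = 1 \<or> k = 3 \<and> l = 3 \<or> k = 2 \<and> l = 4 then 1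
      else if k = 4 \<and> l = 2 then p else 0)"
  have PQ: "P ** Q = mat 1"
    using p by (simp add: vec_eq_iff forall_4 matrix_matrix_mult_def sum_4 P_def Q_def mat_def)
  have Q: "x \<in> c'.L i \<longleftrightarrow> Q *v x \<in> c.L i" for i x
  proof -
    have "(i + 2) div 2 = i div 2 + 1" by simp
    moreover have "inverse p * z \<in> frac_ideal v k \<longleftrightarrow> z \<in> frac_ideal v (k + 1)" for z k
      using p by (simp add: ideal_scale val_inverse)
    ultimately show ?thesis
      by (auto simp: Lam_def forall_4 matrix_vector_mult_def sum_4 Q_def)
  qed
  have \<beta>': "Q ** \<beta> ** P \<in> c.lat (- int n)"
  proof (rule c.latI)
    fix i x assume "x \<in> c.L i"
    moreover have "Q ** P = mat 1" using PQ by (simp add: matrix_left_right_inverse)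
    then have "Q *v (P *v x) = x" by (simp add: matrix_vector_mul_assoc)
    ultimately have "P *v x \<in> c'.L i" by (simp add: Q)
    then have "\<beta> *v (P *v x) \<in> c'.L (i + - int n)" using \<beta> by (auto intro: c'.latD)
    then show "Q ** \<beta> ** P *v x \<in> c.L (i + - int n)" by (simp add: Q matrix_vector_mul_assoc matrix_mul_assoc)
  qed
  have y: "Q ** (mat (p ^ n) ** (\<beta> ** \<beta>)) ** P = mat (p ^ n) ** ((Q ** \<beta> ** P) ** (Q ** \<beta> ** P))"
  proof -
    have "(Q ** \<beta> ** P) ** (Q ** \<beta> ** P) = Q ** \<beta> ** (P ** Q) ** \<beta> ** P"
      by (simp only: matrix_mul_assoc)
    then have "mat (p ^ n) ** ((Q ** \<beta> ** P) ** (Q ** \<beta> ** P)) = (mat (p ^ n) ** Q) ** \<beta> ** \<beta> ** P"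
      by (simp add: PQ matrix_mul_assoc)
    then show ?thesis by (simp add: mat_commute[of _ Q] matrix_mul_assoc)
  qed
  have "c.splits (mat (p ^ n) ** ((Q ** \<beta> ** P) ** (Q ** \<beta> ** P))) a b"
  proof (rule splits_wt1[OF p n \<beta>' a b ab])
    show "map_poly red (charpoly (mat (p ^ n) ** ((Q ** \<beta> ** P) ** (Q ** \<beta> ** P)))) =
        [:- red a, 1:] ^ 2 * [:- red b, 1:] ^ 2"
      unfolding y[symmetric] charpoly_conj[OF PQ] by (rule phi)
  qed
  then show ?thesis by (intro splits_transport[OF PQ Q]) (simp only: y)
qed

end

context lattice_chain
begin

lemma scale_L:
  assumes "p \<noteq> 0" "v p = 1"
  shows "(*s) (p powi i) ` L j = L (j + 2 * i)"
proof safe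
  have p: "p powi i \<noteq> 0" "v (p powi i) = i" using assms by (auto simp: val_powi)
  show "p powi i *s x \<in> L (j + 2 * i)" if "x \<in> L j" for x
    using that p by (simp add: L_scale_iff)
  show "x \<in> (*s) (p powi i) ` L j" if "x \<in> L (j + 2 * i)" for x
  proof (rule image_eqI)
    show "x = p powi i *s (inverse (p powi i) *s x)" using p by (simp add: vector_smult_assoc)
    show "inverse (p powi i) *s x \<in> L j" using that p by (simp add: L_scale_iff val_inverse)
  qed
qed

lemma L_strict:
  assumes k: "odd (i + d k)" shows "L i \<noteq> L (i + 1)"
proof
  assume eq: "L i = L (i + 1)"
  obtain p where p: "p \<noteq> 0" "v p = 1" using val_normalized by blast
  define q where "q = p powi ((i + d k) div 2)"
  have q: "q \<noteq> 0" "v q = (i + d k) div 2" using p by (auto simp: q_def val_powi)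
  have "q *s axis k 1 \<in> L i" by (rule L_axis) (use q in \<open>simp add: frac_ideal_def\<close>)
  then have "q *s axis k 1 \<in> L (i + 1)" using eq by simp
  then have "(q *s axis k 1) $ k \<in> frac_ideal v ((i + 1 + d k) div 2)" unfolding Lam_def by blast
  moreover have "(i + 1 + d k) div 2 = (i + d k) div 2 + 1" using k by presburger
  ultimately show False using q by (simp add: frac_ideal_def axis_def)
qed

lemma period_L:
  assumes p: "p \<noteq> 0" "v p = 1" and d: "even (d k)" "odd (d l)"
  shows "period p L = 2"
proof -
  have strict: "L i \<noteq> L (i + 1)" for i
    using L_strict[of i k] L_strict[of i l] d by (cases "even i") auto
  have less: "L i \<noteq> L j" if "i < j" for i j
  proof
    assume eq: "L i = L j"
    have "L (i + 1) \<subseteq> L i" "L j \<subseteq> L (i + 1)" using that by (auto intro: L_mono)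
    then show False using strict[of i] eq by blast
  qed
  have inj: "i = j" if "L i = L j" for i j
    using less[of i j] less[of j i] that by (cases i j rule: linorder_cases) auto
  have scale: "(*s) p ` L i = L (i + 2)" for i using scale_L[OF p, of 1 i] by simp
  show ?thesis
    unfolding period_def
  proof (rule the_equality)
    fix e assume "e > 0 \<and> (\<forall>i. (*s) p ` L i = L (i + int e))"
    then have "L (0 + 2) = L (0 + int e)" using scale by metis
    from inj[OF this] show "e = 2" by simp
  qed (simp add: scale)
qed

text \<open>For period two and odd \<open>n\<close> the greatest common divisor in the definition of \<open>y\<close> is one.\<close>

lemma y_elt_L:
  assumes p: "p \<noteq> 0" "v p = 1" and d: "even (d k)" "odd (d l)" and n: "odd n"
  shows "y_elt p L n \<beta> = mat (p ^ n) ** (\<beta> ** \<beta>)"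
proof -
  have "gcd 2 n = 1" using n by (simp add: coprime_iff_gcd_eq_1[symmetric])
  moreover have "matrix_power \<beta> 2 = \<beta> ** \<beta>" by (simp add: matrix_power_def numeral_2_eq_2)
  ultimately show ?thesis by (simp add: y_elt_def period_L[OF p d])
qed

end

context unramified_quadratic_ext
begin

lemma seq1_eq_Lam:
  assumes p: "p \<noteq> 0" "v p = 1" and "is_seq1 v p \<Lambda>" shows "\<Lambda> = Lam v wt1"
proof
  interpret c: lattice_chain v red wt1 by unfold_locales
  fix i
  have N: "N0 v = c.L 0" "N2 v = c.L 1" by (auto simp: N0_def N2_def Lam_def forall_4)
  have seq: "\<Lambda> (2 * j) = (*s) (p powi j) ` N0 v" "\<Lambda> (2 * j + 1) = (*s) (p powi j) ` N2 v" for j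
    using assms(3) unfolding is_seq1_def by auto
  show "\<Lambda> i = Lam v wt1 i"
  proof (cases "even i")
    case True
    then obtain j where "i = 2 * j" by blast
    then show ?thesis by (simp add: seq N c.scale_L[OF p])
  next
    case False
    then obtain j where "i = 2 * j + 1" by (elim oddE)
    then show ?thesis by (simp only: seq(2) N c.scale_L[OF p]) (simp add: add.commute)
  qed
qed

lemma u22_chain_wt1: "u22_chain v0 red0 v red \<iota> \<epsilon> s cj wt1 1"
proof unfold_locales
  have "wt1 0 = wt1 4" "wt1 (- 1) = wt1 3" "wt1 (- 2) = wt1 2" "wt1 (- 3) = wt1 1"
    by (rule arg_cong[of _ _ wt1], simp)+
  then show "wt1 k + wt1 (1 - k) = 1" for k
    using exhaust_4[of k] by (elim disjE) simp_all
qed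

lemma u22_chain_wt2: "u22_chain v0 red0 v red \<iota> \<epsilon> s cj wt2 2"
proof unfold_locales
  have "wt2 0 = wt2 4" "wt2 (- 1) = wt2 3" "wt2 (- 2) = wt2 2" "wt2 (- 3) = wt2 1"
    by (rule arg_cong[of _ _ wt2], simp)+
  then show "wt2 k + wt2 (1 - k) = 2" for k
    using exhaust_4[of k] by (elim disjE) simp_all
qed

lemma seq2_eq_Lam:
  assumes p: "p \<noteq> 0" "v p = 1" and "is_seq2 v cj p \<Lambda>" shows "\<Lambda> = Lam v wt2"
proof
  interpret c: u22_chain v0 red0 v red \<iota> \<epsilon> s cj wt2 2 by (rule u22_chain_wt2)
  fix i
  have N: "N1 v = c.L 0" by (auto simp: N1_def Lam_def forall_4)
  have N': "dual_lattice v cj (N1 v) = c.L (- 1)" unfolding N c.dual_L by simp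
  have seq: "\<Lambda> (2 * j) = (*s) (p powi j) ` N1 v"
    "\<Lambda> (2 * j + 1) = (*s) (p powi (j + 1)) ` dual_lattice v cj (N1 v)" for j
    using assms(3) unfolding is_seq2_def by auto
  show "\<Lambda> i = Lam v wt2 i"
  proof (cases "even i")
    case True
    then obtain j where "i = 2 * j" by blast
    then show ?thesis by (simp add: seq N c.chain.scale_L[OF p])
  next
    case False
    then obtain j where "i = 2 * j + 1" by (elim oddE)
    then show ?thesis by (simp only: seq(2) N' c.chain.scale_L[OF p]) (simp add: algebra_simps)
  qed
qed

end

section \<open>From agreement of characters to conjugate matrices\<close>

context lattice_chain
begin

lemma lat_entries_bounded: "\<exists>B. \<forall>X\<in>lat n. \<forall>k l. X $ k $ l \<in> frac_ideal v B"
proof -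
  define B where "B = Min (range (\<lambda>(k, l). (n + d k - d l + 1) div 2))"
  have "B \<le> (n + d k - d l + 1) div 2" for k l
    unfolding B_def by (rule Min_le) (auto simp: image_iff)
  then have "X $ k $ l \<in> frac_ideal v B" if "X \<in> lat n" for X k l
    using that unfolding lat_iff by (meson ideal_mono)
  then show ?thesis by blast
qed

end

context u22_chain
begin

lemma P_iff: "k > 0 \<Longrightarrow> p \<in> P_filtration cj L k \<longleftrightarrow> p \<in> G \<and> p - mat 1 \<in> lat (int k)"
  unfolding P_filtration_def by (auto intro!: exI[of _ "p - mat 1"])

lemma skew_iff: "X \<in> u22_Lie cj \<longleftrightarrow> \<sigma> X = - X"
  unfolding u22_Lie_def by (auto simp: eq_neg_iff_add_eq_0 add.commute)

definition one_half :: 'f where "one_half = inverse 2"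

lemma one_half_double: "one_half + one_half = 1"
  using two_nonzero by (simp add: one_half_def field_simps flip: mult_2)

lemma cj_one_half: "cj one_half = one_half"
  unfolding one_half_def cj_inverse using cj_emb[of 2] by (simp only: emb_2)

lemma one_half_integral: "one_half \<in> val_ring v"
  unfolding one_half_def frac_ideal_def using ext.val_inverse[of 2] by (simp only: mem_Collect_eq) simp

definition half :: "'f^4^4 \<Rightarrow> 'f^4^4" where "half X = mat one_half ** X"

lemma half_double: "half X + half X = X"
proof -
  have "half X + half X = mat (one_half + one_half) ** X"
    by (simp add: half_def vec_eq_iff mat_mult_nth distrib_right)
  then show ?thesis by (simp add: one_half_double)
qed

lemma half_add: "half (X + Y) = half X + half Y"
  by (simp only: half_def matrix_add_ldistrib)

lemma half_lat: "X \<in> lat k \<Longrightarrow> half X \<in> lat k"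
  unfolding half_def by (rule chain.lat_scale[OF one_half_integral]) auto

lemma adj_half: "\<sigma> (half X) = half (\<sigma> X)"
  by (simp add: half_def vec_eq_iff adj_inv_nth mat_mult_nth cj_mult cj_one_half)

lemma half_minus: "half (- X) = - half X"
  by (simp add: half_def matrix_minus_right)

lemma mat_conj: "A ** (mat c ** X) ** B = mat c ** (A ** X ** B)" for A X B :: "'f^4^4"
proof -
  have "A ** (mat c ** X) ** B = (A ** mat c) ** X ** B" by (simp only: matrix_mul_assoc)
  also have "\<dots> = mat c ** (A ** X ** B)" by (simp only: mat_commute[of c A, symmetric] matrix_mul_assoc)
  finally show ?thesis .
qed

lemma half_conj: "half (A ** X ** B) = A ** half X ** B"
  by (simp only: half_def mat_conj)

text \<open>The Cayley transform \<open>(1 + X/2) (1 - X/2)\<^sup>-\<^sup>1\<close> serves as a substitute for the exponential, whose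
  convergence would depend on the residue characteristic; the two agree up to second order.\<close>

lemma cayley_unitary:
  assumes X: "\<sigma> X = - X"
    and W: "(mat 1 - half X) ** W = mat 1" "W ** (mat 1 - half X) = mat 1"
  shows "(mat 1 + half X) ** W \<in> G"
proof (rule G_I)
  let ?Z = "half X"
  have \<sigma>Z: "\<sigma> ?Z = - ?Z" by (simp add: adj_half X half_minus)
  have 1: "\<sigma> W ** (mat 1 + ?Z) = mat 1"
    using arg_cong[OF W(1), of \<sigma>] by (simp add: adj_mult adj_diff \<sigma>Z)
  then have 2: "(mat 1 + ?Z) ** \<sigma> W = mat 1" by (simp add: matrix_left_right_inverse)
  have comm: "(mat 1 + ?Z) ** (mat 1 - ?Z) = (mat 1 - ?Z) ** (mat 1 + ?Z)"
    by (simp add: matrix_diff_ldistrib matrix_diff_rdistrib matrix_add_ldistrib matrix_add_rdistrib')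
  have "W ** (mat 1 + ?Z) = W ** (mat 1 + ?Z) ** ((mat 1 - ?Z) ** W)" using W(1) by simp
  also have "\<dots> = W ** ((mat 1 + ?Z) ** (mat 1 - ?Z)) ** W" by (simp only: matrix_mul_assoc)
  also have "\<dots> = (W ** (mat 1 - ?Z)) ** (mat 1 + ?Z) ** W" by (simp only: comm matrix_mul_assoc)
  also have "\<dots> = (mat 1 + ?Z) ** W" using W(2) by simp
  finally have comm': "(mat 1 + ?Z) ** W = W ** (mat 1 + ?Z)" by simp
  have "(mat 1 + ?Z) ** W ** \<sigma> ((mat 1 + ?Z) ** W) = W ** ((mat 1 + ?Z) ** \<sigma> W) ** (mat 1 - ?Z)"
    unfolding comm' by (simp add: adj_mult adj_add \<sigma>Z comm' matrix_mul_assoc flip: comm')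
  also have "\<dots> = mat 1" using 2 W(2) by simp
  finally show "(mat 1 + ?Z) ** W ** \<sigma> ((mat 1 + ?Z) ** W) = mat 1" .
qed

lemma cayley_approx:
  assumes X: "X \<in> lat k" "k \<ge> 1"
    and W: "(mat 1 - half X) ** W = mat 1"
  shows "(mat 1 + half X) ** W - mat 1 \<in> lat k" "(mat 1 + half X) ** W - mat 1 - X \<in> lat (2 * k)"
proof -
  let ?Z = "half X"
  have Z: "?Z \<in> lat k" using X(1) by (rule half_lat)
  obtain W' where W': "W' \<in> lat 0" "W' ** (mat 1 - ?Z) = mat 1"
    using chain.one_minus_inverse[OF chain.lat_mono[OF Z X(2)]] by blast
  have "W' ** ((mat 1 - ?Z) ** W) = W" using W'(2) by (simp add: matrix_mul_assoc)
  then have W0: "W \<in> lat 0" using W W' by simp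
  have W_diff: "W - ?Z ** W = mat 1" using W by (simp add: matrix_diff_rdistrib)
  then have W_eq: "W = mat 1 + ?Z ** W" by (simp add: algebra_simps)
  have "(mat 1 + ?Z) ** W - mat 1 = W + ?Z ** W - mat 1" by (simp add: matrix_add_rdistrib')
  also have "\<dots> = ?Z ** W + ?Z ** W" by (subst W_diff[symmetric]) simp
  also have "\<dots> = X ** W" by (simp only: half_double flip: matrix_add_rdistrib')
  finally have 1: "(mat 1 + ?Z) ** W - mat 1 = X ** W" .
  show "(mat 1 + ?Z) ** W - mat 1 \<in> lat k" unfolding 1 using X(1) W0 by (rule chain.lat_mult) simp
  have "X ** W = X ** (mat 1 + ?Z ** W)" by (rule arg_cong[OF W_eq])
  then have "(mat 1 + ?Z) ** W - mat 1 - X = X ** (?Z ** W)"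
    unfolding 1 by (simp add: matrix_add_ldistrib)
  also have "\<dots> \<in> lat (2 * k)"
    by (rule chain.lat_mult[OF X(1) chain.lat_mult[OF Z W0 order_refl]]) simp
  finally show "(mat 1 + ?Z) ** W - mat 1 - X \<in> lat (2 * k)" .
qed

text \<open>Elements of \<open>\<aa>\<^sub>n\<^sub>+\<^sub>1\<close> are invisible to \<open>\<psi>\<^sub>\<beta>\<close>, because their product with \<open>\<beta>\<close> has its trace in the
  maximal ideal.\<close>

lemma psi_approx:
  assumes \<Omega>: "additive_character_conductor_p v0 \<Omega>"
    and \<beta>: "\<beta> \<in> lat (- n)" and p: "p - mat 1 - X \<in> lat (n + 1)"
  shows "psi \<iota> cj \<Omega> \<beta> p = \<Omega> (Tr (trace (\<beta> ** X)))"
proof -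
  have "\<beta> ** (p - mat 1) = \<beta> ** X + \<beta> ** (p - mat 1 - X)"
    by (simp flip: matrix_add_ldistrib)
  then have "Tr (trace (\<beta> ** (p - mat 1))) = Tr (trace (\<beta> ** X)) + Tr (trace (\<beta> ** (p - mat 1 - X)))"
    by (simp add: trace_add Tr_add)
  moreover have "\<beta> ** (p - mat 1 - X) \<in> lat 1" by (rule chain.lat_mult[OF \<beta> p]) simp
  then have "\<Omega> (Tr (trace (\<beta> ** (p - mat 1 - X)))) = 1"
    using \<Omega> Tr_ideal chain.trace_ideal unfolding additive_character_conductor_p_def by blast
  ultimately show ?thesis using \<Omega> by (simp add: psi_def additive_character_conductor_p_def)
qed

lemma character_eq_iff:
  assumes \<Omega>: "additive_character_conductor_p v0 \<Omega>"
  shows "\<Omega> x = \<Omega> y \<longleftrightarrow> \<Omega> (x - y) = 1"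
proof -
  have "\<Omega> ((x - y) + y) = \<Omega> (x - y) * \<Omega> y" "norm (\<Omega> y) = 1"
    using \<Omega> unfolding additive_character_conductor_p_def by blast+
  then show ?thesis by auto
qed

text \<open>Otherwise \<open>\<delta>\<close> could be separated from the lattice \<open>\<aa>\<^sub>m + g \<aa>\<^sub>m g\<^sup>-\<^sup>1\<close> by a functional
  \<open>X \<mapsto> trace (T ** X)\<close>. By duality for each of the two summands, \<open>T\<close> lies in \<open>\<aa>\<^sub>1\<^sub>-\<^sub>m\<close> and in
  \<open>g \<aa>\<^sub>1\<^sub>-\<^sub>m g\<^sup>-\<^sup>1\<close>, and it contradicts the hypothesis on \<open>\<delta>\<close>.\<close>

lemma annihilator_of_intersection:
  assumes g: "g \<in> G"
    and ann: "\<And>X. X \<in> lat (1 - m) \<Longrightarrow> \<sigma> g ** X ** g \<in> lat (1 - m) \<Longrightarrow> trace (\<delta> ** X) \<in> max_ideal v"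
  shows "\<exists>Z1\<in>lat m. \<exists>Z2\<in>lat m. \<delta> = Z1 + g ** Z2 ** \<sigma> g"
proof (rule ccontr)
  assume no: "\<not> ?thesis"
  define S where "S = {Z1 + g ** Z2 ** \<sigma> g | Z1 Z2. Z1 \<in> lat m \<and> Z2 \<in> lat m}"
  define vec where "vec X = (\<lambda>(i, j). X $ i $ j)" for X :: "'f^4^4"
  have vec_inj: "vec X = vec Y \<longleftrightarrow> X = Y" for X Y
    by (auto simp: vec_def fun_eq_iff vec_eq_iff)
  have S_add: "X + Y \<in> S" if XY: "X \<in> S" "Y \<in> S" for X Y
  proof -
    obtain Z1 Z2 where "X = Z1 + g ** Z2 ** \<sigma> g" "Z1 \<in> lat m" "Z2 \<in> lat m"
      using XY(1) unfolding S_def by blast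
    moreover obtain Z1' Z2' where "Y = Z1' + g ** Z2' ** \<sigma> g" "Z1' \<in> lat m" "Z2' \<in> lat m"
      using XY(2) unfolding S_def by blast
    ultimately show ?thesis unfolding S_def
      by (intro CollectI exI[of _ "Z1 + Z1'"] exI[of _ "Z2 + Z2'"])
         (simp add: chain.lat_add matrix_add_ldistrib matrix_add_rdistrib' add_ac)
  qed
  have S_scale: "mat c ** X \<in> S" if c: "c \<in> val_ring v" and X: "X \<in> S" for c X
  proof -
    obtain Z1 Z2 where Z: "X = Z1 + g ** Z2 ** \<sigma> g" "Z1 \<in> lat m" "Z2 \<in> lat m"
      using X unfolding S_def by blast
    have "mat c ** (g ** Z2 ** \<sigma> g) = g ** (mat c ** Z2) ** \<sigma> g" by (simp only: mat_conj)
    moreover have "mat c ** Z1 \<in> lat m" "mat c ** Z2 \<in> lat m"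
      using Z c by (auto intro: chain.lat_scale)
    ultimately show ?thesis unfolding S_def Z(1) by (auto simp: matrix_add_ldistrib)
  qed
  obtain C1 C2 where C: "g \<in> lat (- int C1)" "\<sigma> g \<in> lat (- int C2)"
    using chain.lat_bounded by meson
  have S_lat: "X \<in> lat (m - int C1 - int C2)" if X: "X \<in> S" for X
  proof -
    obtain Z1 Z2 where Z: "X = Z1 + g ** Z2 ** \<sigma> g" "Z1 \<in> lat m" "Z2 \<in> lat m"
      using X unfolding S_def by blast
    have "g ** Z2 \<in> lat (m - int C1)" by (rule chain.lat_mult[OF C(1) Z(3)]) simp
    then have "g ** Z2 ** \<sigma> g \<in> lat (m - int C1 - int C2)" by (rule chain.lat_mult[OF _ C(2)]) simp
    moreover have "Z1 \<in> lat (m - int C1 - int C2)" using Z(2) by (rule chain.lat_mono) simp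
    ultimately show ?thesis unfolding Z(1) by (intro chain.lat_add)
  qed
  obtain B where B: "\<And>X k l. X \<in> lat (m - int C1 - int C2) \<Longrightarrow> X $ k $ l \<in> frac_ideal v B"
    using chain.lat_entries_bounded by blast
  have S_D: "Z1 \<in> S" "g ** Z1 ** \<sigma> g \<in> S" if "Z1 \<in> lat m" for Z1
  proof -
    have "Z1 = Z1 + g ** 0 ** \<sigma> g" "g ** Z1 ** \<sigma> g = 0 + g ** Z1 ** \<sigma> g" by simp_all
    then show "Z1 \<in> S" "g ** Z1 ** \<sigma> g \<in> S" unfolding S_def using that chain.lat_0 by blast+
  qed
  have "\<exists>t. (\<forall>x\<in>vec ` S. (\<Sum>i\<in>UNIV. t i * x i) \<in> max_ideal v) \<and>
      (\<Sum>i\<in>UNIV. t i * vec \<delta> i) \<notin> max_ideal v"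
  proof (rule ext.lattice_separation[where B = B])
    show "(\<lambda>i. x i + y i) \<in> vec ` S" if xy: "x \<in> vec ` S" "y \<in> vec ` S" for x y
    proof -
      obtain X Y where XY: "x = vec X" "y = vec Y" "X \<in> S" "Y \<in> S" using xy by blast
      have "(\<lambda>i. x i + y i) = vec (X + Y)" by (auto simp: XY vec_def)
      then show ?thesis using S_add XY by blast
    qed
    show "(\<lambda>i. c * x i) \<in> vec ` S" if c: "c \<in> val_ring v" and x: "x \<in> vec ` S" for c x
    proof -
      obtain X where X: "x = vec X" "X \<in> S" using x by blast
      have "(\<lambda>i. c * x i) = vec (mat c ** X)" by (auto simp: X vec_def mat_mult_nth)
      then show ?thesis using S_scale c X by blast
    qed
    show "x i \<in> frac_ideal v B" if "x \<in> vec ` S" for x i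
      using that S_lat B by (auto simp: vec_def split: prod.split)
    have "vec 0 \<in> vec ` S" using S_D(1)[OF chain.lat_0] by blast
    then show "(\<lambda>_. 0) \<in> vec ` S" by (simp add: vec_def case_prod_unfold)
    show "vec \<delta> \<notin> vec ` S" using no by (auto simp: vec_inj S_def)
  qed auto
  then obtain t where t: "\<And>X. X \<in> S \<Longrightarrow> (\<Sum>i\<in>UNIV. t i * vec X i) \<in> max_ideal v"
      "(\<Sum>i\<in>UNIV. t i * vec \<delta> i) \<notin> max_ideal v"
    by blast
  define T where "T = (\<chi> i j. t (j, i))"
  have tr: "(\<Sum>i\<in>UNIV. t i * vec X i) = trace (T ** X)" for X
  proof -
    have "(\<Sum>i\<in>UNIV. t i * vec X i) = (\<Sum>(i, j)\<in>UNIV \<times> UNIV. t (i, j) * X $ i $ j)"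
      by (rule sum.cong) (auto simp: vec_def)
    also have "\<dots> = (\<Sum>i\<in>UNIV. \<Sum>j\<in>UNIV. t (i, j) * X $ i $ j)"
      by (rule sum.cartesian_product[symmetric])
    also have "\<dots> = (\<Sum>j\<in>UNIV. \<Sum>i\<in>UNIV. t (i, j) * X $ i $ j)" by (rule sum.swap)
    finally show ?thesis by (simp add: trace_def matrix_matrix_mult_def T_def)
  qed
  have "T \<in> lat (1 - m)"
    by (rule chain.lat_dual) (use t(1) S_D in \<open>simp add: tr\<close>)
  moreover have "\<sigma> g ** T ** g \<in> lat (1 - m)"
  proof (rule chain.lat_dual)
    fix X assume "X \<in> lat m"
    then have "trace (T ** (g ** X ** \<sigma> g)) \<in> max_ideal v" using t(1) S_D by (simp add: tr)
    moreover have "trace (T ** (g ** X ** \<sigma> g)) = trace (\<sigma> g ** T ** g ** X)"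
      using trace_mul_sym[of "T ** g ** X" "\<sigma> g"] by (simp add: matrix_mul_assoc)
    ultimately show "trace (\<sigma> g ** T ** g ** X) \<in> max_ideal v" by simp
  qed
  ultimately have "trace (\<delta> ** T) \<in> max_ideal v" by (rule ann)
  then show False using t(2) trace_mul_sym[of T \<delta>] by (simp add: tr)
qed

text \<open>Cayley transforms of skew \<open>X\<close> in \<open>\<aa>\<^sub>m\<^sub>+\<^sub>1 \<inter> g \<aa>\<^sub>m\<^sub>+\<^sub>1 g\<^sup>-\<^sup>1\<close> provide elements of both groups, and the agreement
  of the characters there says that \<open>\<delta> = \<beta> - g \<gamma> g\<^sup>-\<^sup>1\<close> annihilates these \<open>X\<close> up to \<open>\<Omega>\<close>. Applied to
  \<open>Y - \<sigma> Y\<close>, and to all integral multiples of \<open>Y\<close>, this gives the annihilation of the whole intersection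
  under the trace form. The resulting decomposition of \<open>\<delta>\<close> is made skew by averaging with \<open>\<sigma>\<close>.\<close>

lemma conjugate_representatives:
  assumes \<Omega>: "additive_character_conductor_p v0 \<Omega>" and g: "g \<in> G"
    and \<beta>: "\<beta> \<in> lat (- int n)" "\<sigma> \<beta> = - \<beta>" and \<gamma>: "\<gamma> \<in> lat (- int n)" "\<sigma> \<gamma> = - \<gamma>"
    and n: "n = 2 * m + 1"
    and agree: "\<And>p. p \<in> P_filtration cj L (m + 1) \<Longrightarrow> \<sigma> g ** p ** g \<in> P_filtration cj L (m + 1) \<Longrightarrow>
        psi \<iota> cj \<Omega> \<beta> p = psi \<iota> cj \<Omega> \<gamma> (\<sigma> g ** p ** g)"
  shows "\<exists>Y1\<in>lat (- int m). \<exists>Y2\<in>lat (- int m). \<sigma> Y1 = - Y1 \<and> \<sigma> Y2 = - Y2 \<and>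
    \<beta> - Y1 = g ** (\<gamma> + Y2) ** \<sigma> g"
proof -
  define \<delta> where "\<delta> = \<beta> - g ** \<gamma> ** \<sigma> g"
  have \<sigma>\<delta>: "\<sigma> \<delta> = - \<delta>"
    by (simp add: \<delta>_def adj_diff adj_mult \<beta> \<gamma> matrix_minus_left matrix_minus_right matrix_mul_assoc)
  have skew: "\<Omega> (Tr (trace (\<delta> ** X))) = 1"
    if X: "X \<in> lat (int m + 1)" "\<sigma> g ** X ** g \<in> lat (int m + 1)" "\<sigma> X = - X" for X
  proof -
    let ?X' = "\<sigma> g ** X ** g"
    have "half X \<in> lat 1" using half_lat[OF X(1)] by (rule chain.lat_mono) simp
    then obtain W where W: "(mat 1 - half X) ** W = mat 1" "W ** (mat 1 - half X) = mat 1"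
      using chain.one_minus_inverse by blast
    define p where "p = (mat 1 + half X) ** W"
    have pG: "p \<in> G" unfolding p_def using X(3) W by (rule cayley_unitary)
    have p: "p - mat 1 \<in> lat (int m + 1)" "p - mat 1 - X \<in> lat (int n + 1)"
      using cayley_approx[OF X(1) _ W(1)] n by (simp_all add: p_def algebra_simps)
    have conj: "\<sigma> g ** A ** B ** g = (\<sigma> g ** A ** g) ** (\<sigma> g ** B ** g)" for A B
    proof -
      have "(\<sigma> g ** A ** g) ** (\<sigma> g ** B ** g) = \<sigma> g ** A ** (g ** \<sigma> g) ** B ** g"
        by (simp only: matrix_mul_assoc)
      then show ?thesis using G_adj[OF g] by simp
    qed
    have W': "(mat 1 - half ?X') ** (\<sigma> g ** W ** g) = mat 1"
    proof -
      have "mat 1 - half ?X' = \<sigma> g ** (mat 1 - half X) ** g"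
        by (simp add: half_conj matrix_diff_ldistrib matrix_diff_rdistrib G_adj[OF g])
      then show ?thesis using conj[of "mat 1 - half X" W] W(1) G_adj[OF g]
        by (simp add: matrix_mul_assoc[symmetric])
    qed
    have p'_eq: "\<sigma> g ** p ** g = (mat 1 + half ?X') ** (\<sigma> g ** W ** g)"
    proof -
      have "mat 1 + half ?X' = \<sigma> g ** (mat 1 + half X) ** g"
        by (simp add: half_conj matrix_add_ldistrib matrix_add_rdistrib' G_adj[OF g])
      then show ?thesis using conj[of "mat 1 + half X" W] by (simp add: p_def matrix_mul_assoc)
    qed
    have p': "\<sigma> g ** p ** g - mat 1 \<in> lat (int m + 1)" "\<sigma> g ** p ** g - mat 1 - ?X' \<in> lat (int n + 1)"
      using cayley_approx[OF X(2) _ W'] n by (simp_all add: p'_eq algebra_simps)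
    have "p \<in> P_filtration cj L (m + 1)" "\<sigma> g ** p ** g \<in> P_filtration cj L (m + 1)"
      using p p' pG g G_adj(4) by (auto simp: P_iff add.commute intro!: G_mult)
    from agree[OF this] have "\<Omega> (Tr (trace (\<beta> ** X))) = \<Omega> (Tr (trace (\<gamma> ** ?X')))"
      by (simp only: psi_approx[OF \<Omega> \<beta>(1) p(2)] psi_approx[OF \<Omega> \<gamma>(1) p'(2)])
    moreover have "trace (\<gamma> ** ?X') = trace (g ** \<gamma> ** \<sigma> g ** X)"
      using trace_mul_sym[of "\<gamma> ** \<sigma> g ** X" g] by (simp add: matrix_mul_assoc)
    moreover have "Tr (trace (\<beta> ** X)) = Tr (trace (\<delta> ** X)) + Tr (trace (g ** \<gamma> ** \<sigma> g ** X))"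
      by (simp add: \<delta>_def matrix_diff_rdistrib trace_sub flip: Tr_add)
    ultimately show ?thesis using character_eq_iff[OF \<Omega>] by (metis add_diff_cancel_right')
  qed
  have ann: "trace (\<delta> ** X) \<in> max_ideal v"
    if X: "X \<in> lat (int m + 1)" "\<sigma> g ** X ** g \<in> lat (int m + 1)" for X
  proof (rule character_Tr_detects[OF \<Omega>])
    fix c assume c: "c \<in> val_ring v"
    define Y where "Y = half (mat c ** X)"
    have Y: "Y \<in> lat (int m + 1)" unfolding Y_def
      by (intro half_lat) (rule chain.lat_scale[OF c X(1)], simp)
    have "\<sigma> g ** Y ** g = half (mat c ** (\<sigma> g ** X ** g))"
      unfolding Y_def half_conj[symmetric] mat_conj ..
    moreover have "half (mat c ** (\<sigma> g ** X ** g)) \<in> lat (int m + 1)"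
      by (intro half_lat) (rule chain.lat_scale[OF c X(2)], simp)
    ultimately have Y': "\<sigma> g ** Y ** g \<in> lat (int m + 1)" by simp
    have "\<sigma> g ** (Y - \<sigma> Y) ** g = \<sigma> g ** Y ** g - \<sigma> (\<sigma> g ** Y ** g)"
      by (simp add: adj_mult matrix_diff_ldistrib matrix_diff_rdistrib matrix_mul_assoc)
    then have "\<Omega> (Tr (trace (\<delta> ** (Y - \<sigma> Y)))) = 1"
      using Y Y' by (intro skew) (auto simp: adj_diff intro!: chain.lat_diff adj_lat)
    moreover have "trace (\<delta> ** \<sigma> Y) = - cj (trace (\<delta> ** Y))"
    proof -
      have "trace (\<delta> ** \<sigma> Y) = trace (\<sigma> (Y ** \<sigma> \<delta>))" by (simp add: adj_mult)
      also have "\<dots> = cj (trace (- (Y ** \<delta>)))" by (simp only: trace_adj \<sigma>\<delta> matrix_minus_right)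
      also have "\<dots> = - cj (trace (Y ** \<delta>))" by (simp add: trace_def sum_negf cj_minus)
      finally show ?thesis by (simp only: trace_mul_sym[of Y \<delta>])
    qed
    then have "Tr (trace (\<delta> ** (Y - \<sigma> Y))) = Tr (trace (\<delta> ** Y)) + Tr (cj (trace (\<delta> ** Y)))"
      by (simp only: matrix_diff_ldistrib trace_sub diff_minus_eq_add Tr_add)
    moreover have "\<dots> = Tr (trace (\<delta> ** Y) + trace (\<delta> ** Y))" by (simp only: Tr_add Tr_cj)
    moreover have "trace (\<delta> ** Y) + trace (\<delta> ** Y) = c * trace (\<delta> ** X)"
    proof -
      have "trace (\<delta> ** Y) + trace (\<delta> ** Y) = trace (\<delta> ** (Y + Y))"
        by (simp only: matrix_add_ldistrib trace_add)
      also have "\<delta> ** (Y + Y) = mat c ** (\<delta> ** X)"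
        unfolding Y_def half_double using mat_conj[of \<delta> c X "mat 1"] by simp
      also have "trace \<dots> = c * trace (\<delta> ** X)" by (simp add: trace_def mat_mult_nth sum_distrib_left)
      finally show ?thesis .
    qed
    ultimately show "\<Omega> (Tr (c * trace (\<delta> ** X))) = 1" by simp
  qed
  have "\<exists>Z1\<in>lat (- int m). \<exists>Z2\<in>lat (- int m). \<delta> = Z1 + g ** Z2 ** \<sigma> g"
    using ann by (intro annihilator_of_intersection[OF g]) (simp add: add.commute)
  then obtain Z1 Z2 where Z: "Z1 \<in> lat (- int m)" "Z2 \<in> lat (- int m)" "\<delta> = Z1 + g ** Z2 ** \<sigma> g"
    by blast
  define Y where "Y Z = half (Z - \<sigma> Z)" for Z
  have Y_lat: "Y Z \<in> lat (- int m)" if "Z \<in> lat (- int m)" for Z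
    unfolding Y_def by (intro half_lat chain.lat_diff adj_lat that)
  have Y_skew: "\<sigma> (Y Z) = - Y Z" for Z
    unfolding Y_def adj_half adj_diff by (simp flip: half_minus)
  have "\<delta> + \<delta> = \<delta> - \<sigma> \<delta>" using \<sigma>\<delta> by simp
  also have "\<dots> = (Z1 - \<sigma> Z1) + g ** (Z2 - \<sigma> Z2) ** \<sigma> g"
    unfolding Z(3) by (simp add: adj_add adj_mult matrix_diff_ldistrib matrix_diff_rdistrib matrix_mul_assoc)
  finally have "half (\<delta> + \<delta>) = Y Z1 + g ** Y Z2 ** \<sigma> g" by (simp only: Y_def half_add half_conj)
  then have "\<delta> = Y Z1 + g ** Y Z2 ** \<sigma> g" by (simp only: half_add half_double)
  then have "\<beta> - Y Z1 = g ** (\<gamma> + Y Z2) ** \<sigma> g"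
    by (simp add: \<delta>_def matrix_add_ldistrib matrix_add_rdistrib' algebra_simps)
  then show ?thesis using Y_lat Z Y_skew by blast
qed

end

section \<open>Intertwining in an irreducible representation\<close>

lemma (in lattice_chain) ideal_entries_lat: "\<exists>B. \<forall>X. (\<forall>k l. X $ k $ l \<in> frac_ideal v B) \<longrightarrow> X \<in> lat n"
proof -
  define B where "B = Max (range (\<lambda>(k, l). (n + d k - d l + 1) div 2))"
  have "(n + d k - d l + 1) div 2 \<le> B" for k l
    unfolding B_def by (rule Max_ge) (auto simp: image_iff)
  then have "X \<in> lat n" if "\<forall>k l. X $ k $ l \<in> frac_ideal v B" for X
    using that unfolding lat_iff by (meson ideal_mono)
  then show ?thesis by blast
qed

text \<open>The function \<open>code\<close> replaces each entry by a representative modulo a high power of the maximal ideal.\<close>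

lemma (in lattice_chain) finite_lat_quotient:
  "\<exists>code :: 'a^4^4 \<Rightarrow> 'a^4^4. finite (code ` lat 0) \<and> (\<forall>X\<in>lat 0. \<forall>Y\<in>lat 0. code X = code Y \<longrightarrow> X - Y \<in> lat n)"
proof -
  obtain A where A: "\<And>X k l. X \<in> lat 0 \<Longrightarrow> X $ k $ l \<in> frac_ideal v A"
    using lat_entries_bounded by blast
  obtain B where B: "\<And>X. (\<And>k l. X $ k $ l \<in> frac_ideal v B) \<Longrightarrow> X \<in> lat n"
    using ideal_entries_lat by blast
  obtain S where S: "finite S" "\<forall>x\<in>frac_ideal v A. \<exists>y\<in>S. x - y \<in> frac_ideal v (A + int (nat (B - A)))"
    using finite_ideal_quotient by blast
  define pick where "pick x = (SOME y. y \<in> S \<and> x - y \<in> frac_ideal v (A + int (nat (B - A))))" for x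
  have pick: "pick x \<in> S \<and> x - pick x \<in> frac_ideal v B" if "x \<in> frac_ideal v A" for x
  proof -
    have "pick x \<in> S \<and> x - pick x \<in> frac_ideal v (A + int (nat (B - A)))"
      unfolding pick_def by (rule someI_ex) (use S(2) that in blast)
    moreover have "B \<le> A + int (nat (B - A))" by simp
    ultimately show ?thesis using ideal_mono by blast
  qed
  define code :: "'a^4^4 \<Rightarrow> 'a^4^4" where "code X = (\<chi> i j. pick (X $ i $ j))" for X
  have "code ` lat 0 \<subseteq> (\<lambda>h. \<chi> i j. h (i, j)) ` (PiE UNIV (\<lambda>_. S))"
  proof
    fix Y assume "Y \<in> code ` lat 0"
    then obtain X where X: "X \<in> lat 0" "Y = code X" by blast
    then have "Y = (\<chi> i j. (\<lambda>(i, j). pick (X $ i $ j)) (i, j))" by (simp add: code_def)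
    moreover have "(\<lambda>(i, j). pick (X $ i $ j)) \<in> PiE UNIV (\<lambda>_. S)" using pick A[OF X(1)] by auto
    ultimately show "Y \<in> (\<lambda>h. \<chi> i j. h (i, j)) ` (PiE UNIV (\<lambda>_. S))" by blast
  qed
  then have "finite (code ` lat 0)"
    by (rule finite_subset) (intro finite_imageI finite_PiE, auto simp: S)
  moreover have "X - Y \<in> lat n" if XY: "X \<in> lat 0" "Y \<in> lat 0" "code X = code Y" for X Y
  proof (rule B)
    fix k l
    have "pick (X $ k $ l) = pick (Y $ k $ l)" using XY(3) by (simp add: code_def vec_eq_iff)
    moreover have "(X $ k $ l - pick (X $ k $ l)) - (Y $ k $ l - pick (Y $ k $ l)) \<in> frac_ideal v B"
      by (rule ideal_diff) (use pick[OF A[OF XY(1)]] pick[OF A[OF XY(2)]] in blast)+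
    ultimately show "(X - Y) $ k $ l \<in> frac_ideal v B" by simp
  qed
  ultimately show ?thesis by blast
qed

context u22_chain
begin

lemma P_1: "k > 0 \<Longrightarrow> mat 1 \<in> P_filtration cj L k"
  by (simp add: P_iff)

lemma P_mono: "0 < k \<Longrightarrow> k \<le> k' \<Longrightarrow> p \<in> P_filtration cj L k' \<Longrightarrow> p \<in> P_filtration cj L k"
  by (auto simp: P_iff intro: chain.lat_mono)

lemma P_lat0: "k > 0 \<Longrightarrow> p \<in> P_filtration cj L k \<Longrightarrow> p \<in> lat 0"
  using chain.lat_add[of "p - mat 1" 0 "mat 1"] chain.lat_mono[of "p - mat 1" "int k" 0] by (simp add: P_iff)

lemma P_mult:
  assumes "k > 0" "p \<in> P_filtration cj L k" "q \<in> P_filtration cj L k"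
  shows "p ** q \<in> P_filtration cj L k"
proof -
  have "p ** (q - mat 1) \<in> lat (int k)"
    by (rule chain.lat_mult[OF P_lat0[OF assms(1,2)]]) (use assms in \<open>auto simp: P_iff\<close>)
  then have "p ** (q - mat 1) + (p - mat 1) \<in> lat (int k)"
    using assms by (intro chain.lat_add) (auto simp: P_iff)
  then show ?thesis using assms by (auto simp: P_iff G_mult matrix_diff_ldistrib)
qed

lemma P_adj: "k > 0 \<Longrightarrow> p \<in> P_filtration cj L k \<Longrightarrow> \<sigma> p \<in> P_filtration cj L k"
  using adj_lat[of "p - mat 1" "int k"] by (auto simp: P_iff adj_diff G_adj)

lemma P_conj:
  assumes "k > 0" "k' > 0" "p \<in> P_filtration cj L k" "q \<in> P_filtration cj L k'"
  shows "\<sigma> p ** q ** p \<in> P_filtration cj L k'"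
proof -
  have p: "p \<in> G" using assms by (simp add: P_iff)
  have "\<sigma> p ** (q - mat 1) \<in> lat (int k')"
    by (rule chain.lat_mult[OF P_lat0[OF assms(1) P_adj[OF assms(1,3)]]]) (use assms in \<open>auto simp: P_iff\<close>)
  then have "\<sigma> p ** (q - mat 1) ** p \<in> lat (int k')"
    by (rule chain.lat_mult[OF _ P_lat0[OF assms(1,3)]]) simp
  moreover have "\<sigma> p ** (q - mat 1) ** p = \<sigma> p ** q ** p - mat 1"
    by (simp add: matrix_diff_ldistrib matrix_diff_rdistrib G_adj[OF p])
  ultimately show ?thesis using assms G_adj[OF p] by (auto simp: P_iff G_mult)
qed

lemma psi_mult:
  assumes \<Omega>: "additive_character_conductor_p v0 \<Omega>" and \<beta>: "\<beta> \<in> lat (- int n)" and n: "n = 2 * m + 1"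
    and pq: "p \<in> P_filtration cj L (m + 1)" "q \<in> P_filtration cj L (m + 1)"
  shows "psi \<iota> cj \<Omega> \<beta> (p ** q) = psi \<iota> cj \<Omega> \<beta> p * psi \<iota> cj \<Omega> \<beta> q"
proof -
  have "(p - mat 1) ** (q - mat 1) \<in> lat (int n + 1)"
    by (rule chain.lat_mult[of _ "int (m + 1)" _ "int (m + 1)"]) (use pq n in \<open>auto simp: P_iff\<close>)
  moreover have "(p - mat 1) ** (q - mat 1) = p ** q - mat 1 - ((p - mat 1) + (q - mat 1))"
    by (simp add: matrix_diff_ldistrib matrix_diff_rdistrib)
  ultimately have "psi \<iota> cj \<Omega> \<beta> (p ** q) = \<Omega> (Tr (trace (\<beta> ** ((p - mat 1) + (q - mat 1)))))"
    by (intro psi_approx[OF \<Omega> \<beta>]) simp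
  also have "\<dots> = \<Omega> (Tr (trace (\<beta> ** (p - mat 1))) + Tr (trace (\<beta> ** (q - mat 1))))"
    by (simp only: matrix_add_ldistrib trace_add Tr_add)
  finally show ?thesis using \<Omega> by (simp add: psi_def additive_character_conductor_p_def)
qed

lemma psi_trivial:
  assumes \<Omega>: "additive_character_conductor_p v0 \<Omega>" and \<beta>: "\<beta> \<in> lat (- int n)"
    and p: "p \<in> P_filtration cj L M" and M: "M > n"
  shows "psi \<iota> cj \<Omega> \<beta> p = 1"
proof -
  have "p - mat 1 \<in> lat (int n + 1)" using p M by (auto simp: P_iff intro: chain.lat_mono)
  then have "psi \<iota> cj \<Omega> \<beta> p = \<Omega> (Tr (trace (\<beta> ** 0)))" by (intro psi_approx[OF \<Omega> \<beta>]) simp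
  also have "Tr (trace (\<beta> ** 0)) = 0" using Tr_ideal[of 0] emb_Tr[of 0] by (simp add: trace_def)
  also have "\<Omega> 0 = 1" using \<Omega> by (auto simp: additive_character_conductor_p_def)
  finally show ?thesis .
qed

text \<open>The groups \<open>P\<^sub>M\<close> are arbitrarily small: multiplying by \<open>p\<^sup>-\<^sup>N\<close> lowers the degree of a matrix by \<open>2 N\<close> only.\<close>

lemma smooth_fixed:
  assumes "smooth_rep v cj scl \<rho>"
  shows "\<exists>M. \<forall>M'\<ge>M. \<forall>h\<in>P_filtration cj L M'. \<rho> h x = x"
proof -
  have "open_in_U22 v cj {g \<in> G. \<rho> g x = x}" and "\<rho> (mat 1) x = x"
    using assms by (auto simp: smooth_rep_def U22_rep_def)
  then have "\<exists>B. \<forall>h\<in>G. (\<forall>i j. h $ i $ j - mat 1 $ i $ j \<in> frac_ideal v B) \<longrightarrow> h \<in> {g \<in> G. \<rho> g x = x}"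
    unfolding open_in_U22_def using G_1 by blast
  then obtain B where B: "\<And>h. h \<in> G \<Longrightarrow> (\<And>i j. h $ i $ j - mat 1 $ i $ j \<in> frac_ideal v B) \<Longrightarrow> \<rho> h x = x"
    by blast
  obtain A where A: "\<And>X k l. X \<in> lat 0 \<Longrightarrow> X $ k $ l \<in> frac_ideal v A"
    using chain.lat_entries_bounded by blast
  obtain p where p: "p \<noteq> 0" "v p = 1" using ext.val_normalized by blast
  define N where "N = nat (B - A)"
  have "\<rho> h x = x" if M: "M \<ge> 2 * N + 1" and h: "h \<in> P_filtration cj L M" for M h
  proof (rule B)
    show "h \<in> G" using M h by (simp add: P_iff)
    fix i j
    define c where "c = inverse (p ^ N)"
    have c: "c \<noteq> 0" "v c = - int N" using p by (auto simp: c_def ext.val_inverse ext.val_power)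
    have "h - mat 1 \<in> lat (int M)" using h M by (simp add: P_iff)
    then have "mat c ** (h - mat 1) \<in> lat 0"
      by (rule chain.lat_scale[of c "- int N", rotated]) (use c M in \<open>auto simp: frac_ideal_def\<close>)
    from A[OF this, of i j] have "c * (h - mat 1) $ i $ j \<in> frac_ideal v A" by (simp only: mat_mult_nth)
    then have "(h - mat 1) $ i $ j \<in> frac_ideal v (A + int N)" using c by (simp add: ext.ideal_scale)
    then show "h $ i $ j - mat 1 $ i $ j \<in> frac_ideal v B"
      using ext.ideal_mono[of _ "A + int N" B] by (simp add: N_def)
  qed
  then show ?thesis by blast
qed

text \<open>Averaging against \<open>\<psi>\<^sub>\<beta>\<close> over the finite quotient of \<open>P\<^sub>m\<^sub>+\<^sub>1\<close> through which everything factors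
  projects onto the \<open>\<psi>\<^sub>\<beta>\<close>-isotypic part. By irreducibility some translate \<open>\<rho> g x\<^sub>\<gamma>\<close> of the
  \<open>\<psi>\<^sub>\<gamma>\<close>-vector has nonzero projection, and then the characters must agree on the intersection of
  the two groups.\<close>

lemma intertwining_exists:
  assumes \<Omega>: "additive_character_conductor_p v0 \<Omega>"
    and \<beta>: "\<beta> \<in> lat (- int n)" and \<gamma>: "\<gamma> \<in> lat (- int n)" and n: "n = 2 * m + 1"
    and smooth: "smooth_rep v cj scl \<rho>" and irred: "irreducible_rep cj scl \<rho>"
    and con_\<beta>: "contains_stratum \<iota> cj \<Omega> scl \<rho> L m \<beta>"
    and con_\<gamma>: "contains_stratum \<iota> cj \<Omega> scl \<rho> L m \<gamma>"
  shows "\<exists>g\<in>G. \<forall>p\<in>P_filtration cj L (m + 1). \<sigma> g ** p ** g \<in> P_filtration cj L (m + 1) \<longrightarrow>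
    psi \<iota> cj \<Omega> \<beta> p = psi \<iota> cj \<Omega> \<gamma> (\<sigma> g ** p ** g)"
proof -
  have rep: "U22_rep cj scl \<rho>" using smooth by (simp add: smooth_rep_def)
  interpret V: vector_space scl using rep by (simp add: U22_rep_def)
  have \<rho>_add: "\<rho> g (x + y) = \<rho> g x + \<rho> g y" and \<rho>_scale: "\<rho> g (scl c x) = scl c (\<rho> g x)"
    if "g \<in> G" for g x y c
    using rep that by (auto simp: U22_rep_def Vector_Spaces.linear_def module_hom.add module_hom.scale)
  have \<rho>_mult: "\<rho> (g ** h) x = \<rho> g (\<rho> h x)" if "g \<in> G" "h \<in> G" for g h x
    using rep that by (simp add: U22_rep_def)
  have \<rho>_1: "\<rho> (mat 1) x = x" for x using rep by (simp add: U22_rep_def)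
  let ?P = "P_filtration cj L (m + 1)"
  define \<psi> where "\<psi> = psi \<iota> cj \<Omega> \<beta>"
  have \<psi>_ne: "\<psi> p \<noteq> 0" for p
  proof -
    have "norm (\<psi> p) = 1" using \<Omega> by (simp add: \<psi>_def psi_def additive_character_conductor_p_def)
    then show ?thesis by auto
  qed
  have \<psi>_mult: "\<psi> (p ** q) = \<psi> p * \<psi> q" if "p \<in> ?P" "q \<in> ?P" for p q
    unfolding \<psi>_def by (rule psi_mult[OF \<Omega> \<beta> n that])
  have PG: "p \<in> G" if "p \<in> ?P" for p using that by (simp add: P_iff)
  obtain x\<^sub>\<beta> where x\<beta>: "x\<^sub>\<beta> \<noteq> 0" "\<And>p. p \<in> ?P \<Longrightarrow> \<rho> p x\<^sub>\<beta> = scl (\<psi> p) x\<^sub>\<beta>"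
    using con_\<beta> by (auto simp: contains_stratum_def \<psi>_def)
  obtain x\<^sub>\<gamma> where x\<gamma>: "x\<^sub>\<gamma> \<noteq> 0" "\<And>p. p \<in> ?P \<Longrightarrow> \<rho> p x\<^sub>\<gamma> = scl (psi \<iota> cj \<Omega> \<gamma> p) x\<^sub>\<gamma>"
    using con_\<gamma> by (auto simp: contains_stratum_def)
  define Orb where "Orb = (\<lambda>g. \<rho> g x\<^sub>\<gamma>) ` G"
  have "V.span Orb = UNIV"
  proof -
    have "\<rho> g ` V.span Orb \<subseteq> V.span Orb" if g: "g \<in> G" for g
    proof safe
      fix x assume "x \<in> V.span Orb"
      then show "\<rho> g x \<in> V.span Orb"
      proof (induction rule: V.span_induct_alt)
        case base
        have "\<rho> g 0 = 0" using \<rho>_scale[OF g, of 0 0] by simp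
        then show ?case by (simp add: V.span_zero)
      next
        case (step c x y)
        then have "\<rho> g x \<in> Orb" using g by (auto simp: Orb_def \<rho>_mult[symmetric] G_mult)
        then show ?case using step g
          by (simp add: \<rho>_add \<rho>_scale V.span_add V.span_scale V.span_base)
      qed
    qed
    moreover have "x\<^sub>\<gamma> \<in> V.span Orb"
      by (rule V.span_base) (unfold Orb_def, rule image_eqI[of _ _ "mat 1"], simp_all add: \<rho>_1)
    moreover have irr: "V.subspace W \<and> (\<forall>g\<in>G. \<rho> g ` W \<subseteq> W) \<longrightarrow> W = {0} \<or> W = UNIV" for W
      using irred by (simp add: irreducible_rep_def)
    ultimately have "V.span Orb = {0} \<or> V.span Orb = UNIV" "x\<^sub>\<gamma> \<in> V.span Orb"
      using irr[of "V.span Orb"] V.subspace_span[of Orb] by simp_all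
    then show ?thesis using x\<gamma>(1) by auto
  qed
  then have "x\<^sub>\<beta> \<in> V.span Orb" by simp
  then obtain t r where t: "finite t" "t \<subseteq> Orb" "x\<^sub>\<beta> = (\<Sum>a\<in>t. scl (r a) a)"
    unfolding V.span_explicit by (elim CollectE exE conjE)
  \<comment> \<open>From level \<open>M\<close> on all vectors in sight are fixed and \<open>\<psi>\<close> is trivial.\<close>
  obtain F where F: "\<And>x M' h. M' \<ge> F x \<Longrightarrow> h \<in> P_filtration cj L M' \<Longrightarrow> \<rho> h x = x"
    using smooth_fixed[OF smooth] by metis
  define M where "M = Max (insert (n + 1) (F ` t))"
  have M: "n + 1 \<le> M" "\<And>a. a \<in> t \<Longrightarrow> F a \<le> M" using t(1) by (auto simp: M_def)
  let ?K = "P_filtration cj L M"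
  have K_P: "k \<in> ?P" if "k \<in> ?K" for k using that M(1) n by (intro P_mono[of "m + 1" M]) auto
  have K_\<psi>: "\<psi> k = 1" if "k \<in> ?K" for k
    unfolding \<psi>_def using that M(1) by (intro psi_trivial[OF \<Omega> \<beta>]) auto
  \<comment> \<open>The vectors on which \<open>?P\<close> acts through its finite quotient by \<open>?K\<close>; restricting the operators to them
    makes \<open>TT\<close> a finite group under composition.\<close>
  define W where "W = {u. \<forall>k\<in>?K. \<rho> k u = u}"
  have W_add: "u + w \<in> W" if "u \<in> W" "w \<in> W" for u w
    using that K_P PG by (auto simp: W_def \<rho>_add)
  have W_scale: "scl c u \<in> W" if "u \<in> W" for c u
    using that K_P PG by (auto simp: W_def \<rho>_scale)
  have W_0: "0 \<in> W"
  proof -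
    have "\<rho> g 0 = 0" if "g \<in> G" for g using \<rho>_scale[OF that, of 0 0] by simp
    then show ?thesis using K_P PG by (auto simp: W_def)
  qed
  have W_P: "\<rho> p u \<in> W" if p: "p \<in> ?P" and u: "u \<in> W" for p u
    unfolding W_def
  proof safe
    fix k assume k: "k \<in> ?K"
    have "\<sigma> p ** k ** p \<in> ?K" by (rule P_conj[OF _ _ p k]) (use M in auto)
    then have "\<rho> p (\<rho> (\<sigma> p ** k ** p) u) = \<rho> p u" using u by (simp add: W_def)
    moreover have "\<sigma> p ** k ** p \<in> G" "k \<in> G" "p \<in> G" using \<open>\<sigma> p ** k ** p \<in> ?K\<close> k p K_P PG by auto
    moreover have "p ** (\<sigma> p ** k ** p) = k ** p"
      using G_cancel[OF \<open>p \<in> G\<close>] by (simp add: matrix_mul_assoc)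
    ultimately show "\<rho> k (\<rho> p u) = \<rho> p u" by (metis \<rho>_mult)
  qed
  have x\<beta>_W: "x\<^sub>\<beta> \<in> W" using x\<beta>(2) K_P K_\<psi> by (simp add: W_def)
  have t_W: "t \<subseteq> W" using M(2) F by (auto simp: W_def)
  define T where "T p = (\<lambda>u. if u \<in> W then scl (inverse (\<psi> p)) (\<rho> p u) else 0)" for p
  have T_W: "T p u \<in> W" if "p \<in> ?P" for p u
    using that W_0 W_scale W_P by (simp add: T_def)
  have T_mult: "T p \<circ> T q = T (p ** q)" if pq: "p \<in> ?P" "q \<in> ?P" for p q
  proof
    fix u
    have "\<rho> p 0 = 0" using \<rho>_scale[OF PG[OF pq(1)], of 0 0] by simp
    then show "(T p \<circ> T q) u = T (p ** q) u"
      using pq W_0 W_scale W_P PG by (auto simp: T_def \<rho>_scale \<rho>_mult \<psi>_mult mult.commute)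
  qed
  define TT where "TT = T ` ?P"
  have fin: "finite TT"
  proof -
    obtain code :: "'f^4^4 \<Rightarrow> 'f^4^4" where code: "finite (code ` lat 0)"
      "\<And>X Y. X \<in> lat 0 \<Longrightarrow> Y \<in> lat 0 \<Longrightarrow> code X = code Y \<Longrightarrow> X - Y \<in> lat (int M)"
      using chain.finite_lat_quotient by blast
    have P0: "p \<in> lat 0" if "p \<in> ?P" for p by (rule P_lat0[OF _ that]) simp
    have same: "T p = T q" if pq: "p \<in> ?P" "q \<in> ?P" and eq: "code p = code q" for p q
    proof -
      have q': "\<sigma> q \<in> ?P" using pq by (intro P_adj) auto
      have "\<sigma> q ** (p - q) \<in> lat (int M)"
        by (rule chain.lat_mult[OF P0[OF q'] code(2)[OF P0[OF pq(1)] P0[OF pq(2)] eq]]) simp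
      then have k: "\<sigma> q ** p \<in> ?K"
        using M(1) pq PG q' by (auto simp: P_iff matrix_diff_ldistrib G_adj G_mult)
      have "p = q ** (\<sigma> q ** p)" using G_cancel[OF PG[OF pq(2)]] by simp
      then have "T p = T q \<circ> T (\<sigma> q ** p)" using T_mult[OF pq(2) K_P[OF k]] by simp
      then have comp: "T p u = T q (T (\<sigma> q ** p) u)" for u by (simp only: comp_apply)
      have T_k: "T (\<sigma> q ** p) u = (if u \<in> W then u else 0)" for u
        using k K_\<psi> by (simp add: T_def W_def)
      have T_0: "T q 0 = 0" using \<rho>_scale[OF PG[OF pq(2)], of 0 0] by (simp add: T_def)
      show ?thesis
      proof
        fix u
        show "T p u = T q u"
          unfolding comp[of u] T_k by (cases "u \<in> W") (simp_all add: T_0, simp add: T_def)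
      qed
    qed
    have "TT \<subseteq> (\<lambda>c. T (SOME p. p \<in> ?P \<and> code p = c)) ` (code ` lat 0)"
    proof
      fix y assume "y \<in> TT"
      then obtain p where p: "p \<in> ?P" "y = T p" by (auto simp: TT_def)
      define q where "q = (SOME q. q \<in> ?P \<and> code q = code p)"
      have q: "q \<in> ?P \<and> code q = code p" unfolding q_def by (rule someI[of _ p]) (use p in simp)
      have "y = T q" unfolding p(2) by (rule same) (use p q in auto)
      then show "y \<in> (\<lambda>c. T (SOME p. p \<in> ?P \<and> code p = c)) ` (code ` lat 0)"
        unfolding q_def using P0[OF p(1)] by blast
    qed
    then show ?thesis using code(1) finite_subset by blast
  qed
  define e where "e u = (\<Sum>S\<in>TT. S u)" for u
  have e_T: "e (T q u) = e u" if q: "q \<in> ?P" for q u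
  proof -
    have q': "\<sigma> q \<in> ?P" using q by (intro P_adj) auto
    have "(\<Sum>S\<in>TT. S (T q u)) = (\<Sum>S\<in>TT. S u)"
    proof (rule sum.reindex_bij_witness[of _ "\<lambda>S. S \<circ> T (\<sigma> q)" "\<lambda>S. S \<circ> T q"])
      show "(S \<circ> T q) \<circ> T (\<sigma> q) = S" "(S \<circ> T (\<sigma> q)) \<circ> T q = S" "S \<circ> T q \<in> TT" "S \<circ> T (\<sigma> q) \<in> TT"
        if S: "S \<in> TT" for S
      proof -
        obtain p where p: "p \<in> ?P" "S = T p" using S by (auto simp: TT_def)
        have pq: "p ** q \<in> ?P" "p ** \<sigma> q \<in> ?P" using p q q' by (auto intro!: P_mult)
        show "(S \<circ> T q) \<circ> T (\<sigma> q) = S" "(S \<circ> T (\<sigma> q)) \<circ> T q = S" "S \<circ> T q \<in> TT" "S \<circ> T (\<sigma> q) \<in> TT"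
          using p q q' pq G_cancel[OF PG[OF q]] by (auto simp: T_mult TT_def)
      qed
    qed simp_all
    then show ?thesis by (simp add: e_def)
  qed
  have S_lin: "S (scl c u) = scl c (S u) \<and> S (u + w) = S u + S w"
    if "S \<in> TT" "u \<in> W" "w \<in> W" for S c u w
    using that W_add W_scale PG by (auto simp: TT_def T_def \<rho>_add \<rho>_scale V.scale_right_distrib mult.commute)
  have S_0: "S 0 = 0" if "S \<in> TT" for S
    using S_lin[OF that W_0 W_0, of 0] by simp
  have S_sum: "(\<Sum>a\<in>A. scl (r a) a) \<in> W \<and> S (\<Sum>a\<in>A. scl (r a) a) = (\<Sum>a\<in>A. scl (r a) (S a))"
    if "S \<in> TT" "finite A" "A \<subseteq> W" for S A
    using that(2,3)
  proof (induction A rule: finite_induct)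
    case (insert a A)
    then show ?case using S_lin[OF that(1), of a] S_lin[OF that(1), of "scl (r a) a"] W_add W_scale by auto
  qed (use W_0 S_0 that(1) in auto)
  have e_x\<beta>: "e x\<^sub>\<beta> \<noteq> 0"
  proof -
    have "S x\<^sub>\<beta> = x\<^sub>\<beta>" if "S \<in> TT" for S
      using that x\<beta>_W x\<beta>(2) \<psi>_ne by (auto simp: TT_def T_def)
    then have "e x\<^sub>\<beta> = (\<Sum>S\<in>TT. x\<^sub>\<beta>)" unfolding e_def by (rule sum.cong[OF refl])
    also have "\<dots> = scl (of_nat (card TT)) x\<^sub>\<beta>" by (rule V.sum_constant_scale)
    finally have "e x\<^sub>\<beta> = scl (of_nat (card TT)) x\<^sub>\<beta>" .
    moreover have "TT \<noteq> {}" using P_1[of "m + 1"] by (auto simp: TT_def)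
    ultimately show ?thesis using x\<beta>(1) fin by simp
  qed
  have e_sum: "e x\<^sub>\<beta> = (\<Sum>a\<in>t. scl (r a) (e a))"
  proof -
    have "e x\<^sub>\<beta> = (\<Sum>S\<in>TT. \<Sum>a\<in>t. scl (r a) (S a))"
      unfolding e_def using S_sum[OF _ t(1) t_W] t(3) by (intro sum.cong) auto
    also have "\<dots> = (\<Sum>a\<in>t. scl (r a) (e a))"
      unfolding e_def V.scale_sum_right by (rule sum.swap)
    finally show ?thesis .
  qed
  have "\<exists>u\<in>t. e u \<noteq> 0"
  proof (rule ccontr)
    assume "\<not> ?thesis"
    then have "(\<Sum>a\<in>t. scl (r a) (e a)) = 0" by (intro sum.neutral) simp
    then show False using e_x\<beta> e_sum by simp
  qed
  then obtain u where u: "u \<in> t" "e u \<noteq> 0" by blast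
  then obtain g where g: "g \<in> G" "u = \<rho> g x\<^sub>\<gamma>" using t(2) by (auto simp: Orb_def)
  have uW: "u \<in> W" using u t_W by blast
  have "\<psi> p = psi \<iota> cj \<Omega> \<gamma> (\<sigma> g ** p ** g)" if p: "p \<in> ?P" "\<sigma> g ** p ** g \<in> ?P" for p
  proof -
    let ?c = "psi \<iota> cj \<Omega> \<gamma> (\<sigma> g ** p ** g)"
    have "p ** g = g ** (\<sigma> g ** p ** g)" using G_cancel[OF g(1)] by (simp add: matrix_mul_assoc)
    then have "\<rho> p u = scl ?c u"
      using g p PG x\<gamma>(2)[OF p(2)] by (metis \<rho>_mult \<rho>_scale)
    then have "T p u = scl (inverse (\<psi> p) * ?c) u" using uW by (simp add: T_def)
    then have "e u = e (scl (inverse (\<psi> p) * ?c) u)" using e_T[OF p(1), of u] by simp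
    also have "\<dots> = scl (inverse (\<psi> p) * ?c) (e u)"
      unfolding e_def V.scale_sum_right using S_lin[OF _ uW uW] by (intro sum.cong) auto
    finally have "scl (inverse (\<psi> p) * ?c) (e u) = scl 1 (e u)" by simp
    then have "inverse (\<psi> p) * ?c = 1" using u(2) by (simp only: V.scale_cancel_right) simp
    then show ?thesis using \<psi>_ne[of p] by (simp add: field_simps)
  qed
  then show ?thesis using g(1) unfolding \<psi>_def by blast
qed

end

section \<open>Conjugacy of the characters\<close>

context u22_chain
begin

text \<open>The element \<open>y\<^sub>\<beta>\<close> of a stratum with \<open>n\<close> odd.\<close>

definition y_of :: "'f \<Rightarrow> nat \<Rightarrow> 'f^4^4 \<Rightarrow> 'f^4^4" where
  "y_of p n \<beta> = mat (p ^ n) ** (\<beta> ** \<beta>)"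

text \<open>Changing \<open>\<beta>\<close> by an element of \<open>\<aa>\<^sub>-\<^sub>m\<close> changes \<open>p\<^sup>n \<beta>\<^sup>2\<close> by an element of \<open>\<aa>\<^sub>m\<^sub>+\<^sub>1\<close>.\<close>

lemma splits_perturb:
  assumes p: "p \<noteq> 0" "v p = 1" and n: "n = 2 * m + 1" and \<beta>: "\<beta> \<in> lat (- int n)"
    and Y: "Y \<in> lat (- int m)" and sp: "chain.splits (y_of p n \<beta>) a b"
  shows "chain.splits (y_of p n (\<beta> + Y)) a b"
proof -
  have p_n: "p ^ n \<in> frac_ideal v (int n)" using p by (simp add: frac_ideal_def ext.val_power)
  have "\<beta> ** Y + Y ** \<beta> + Y ** Y \<in> lat (- int n - int m)"
    by (intro chain.lat_add; rule chain.lat_mult[OF \<beta> Y] chain.lat_mult[OF Y \<beta>] chain.lat_mult[OF Y Y]) (use n in simp_all)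
  then have "mat (p ^ n) ** (\<beta> ** Y + Y ** \<beta> + Y ** Y) \<in> lat 1"
    by (rule chain.lat_scale[OF p_n]) (use n in simp)
  then have "chain.splits (y_of p n \<beta> + mat (p ^ n) ** (\<beta> ** Y + Y ** \<beta> + Y ** Y)) a b"
    by (rule chain.splits_cong[OF sp])
  also have "y_of p n \<beta> + mat (p ^ n) ** (\<beta> ** Y + Y ** \<beta> + Y ** Y) = y_of p n (\<beta> + Y)"
    by (simp add: y_of_def matrix_add_ldistrib matrix_add_rdistrib' add_ac)
  finally show ?thesis .
qed

text \<open>The element \<open>\<theta>\<close> must have the right parity: its degree and \<open>D\<close> are congruent modulo two. For even \<open>D\<close>
  the form itself (\<open>\<theta> = 1\<close>) serves. For odd \<open>D\<close> one takes \<open>\<theta> = \<beta>\<close>, of odd degree \<open>- n\<close>; it maps eigenvectors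
  to vectors of the exact expected depth because \<open>p\<^sup>n \<beta>\<^sup>2\<close> acts on them by a unit.\<close>

lemma conjugator_preserves_chain:
  assumes p: "p \<noteq> 0" "v p = 1" "cj p = p" and n: "odd n"
    and \<beta>: "\<beta> \<in> lat (- int n)" "\<sigma> \<beta> = - \<beta>" and \<gamma>: "\<gamma> \<in> lat (- int n)"
    and g: "g \<in> G" "\<beta> ** g = g ** \<gamma>"
    and sp: "chain.splits (y_of p n \<beta>) a b" "chain.splits (y_of p n \<gamma>) a b"
    and cj_ab: "cj a = a" "cj b = b" and ab: "a - b \<noteq> 0" "v (a - b) = 0"
    and cases: "even D \<or> (\<forall>e\<in>{a, b}. e \<noteq> 0 \<and> v e = 0)"
  shows "g \<in> lat 0"
proof -
  let ?y = "y_of p n \<beta>" and ?y' = "y_of p n \<gamma>"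
  have p_n: "p ^ n \<in> frac_ideal v (int n)" using p by (simp add: frac_ideal_def ext.val_power)
  have \<beta>y: "\<beta> ** ?y = ?y ** \<beta>"
  proof -
    have "\<beta> ** mat (p ^ n) ** (\<beta> ** \<beta>) = mat (p ^ n) ** \<beta> ** (\<beta> ** \<beta>)" by (simp only: mat_commute)
    then show ?thesis by (simp add: y_of_def matrix_mul_assoc)
  qed
  have gy: "g ** ?y' = ?y ** g"
  proof -
    have "?y ** g = mat (p ^ n) ** (\<beta> ** (\<beta> ** g))" by (simp add: y_of_def matrix_mul_assoc)
    also have "\<dots> = mat (p ^ n) ** ((\<beta> ** g) ** \<gamma>)" by (simp only: g(2) matrix_mul_assoc)
    also have "\<dots> = (mat (p ^ n) ** g) ** (\<gamma> ** \<gamma>)" by (simp only: g(2) matrix_mul_assoc)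
    also have "\<dots> = g ** ?y'" by (simp only: mat_commute[of "p ^ n" g] y_of_def matrix_mul_assoc)
    finally show ?thesis by simp
  qed
  have \<sigma>y: "\<sigma> ?y = ?y"
    by (simp add: y_of_def adj_mult adj_mat cj_power p(3) \<beta>(2) matrix_minus_left matrix_minus_right mat_commute)
  have y': "?y' \<in> lat 0" "(?y' - mat a) ** (?y' - mat b) \<in> lat 1"
    using sp(2) by (simp_all add: chain.splits_def)
  show ?thesis
  proof (cases "even D")
    case True
    show ?thesis
      by (rule isometry_preserves_chain[of g ?y' ?y "mat 1" "mat 1" a b 0])
         (use g(1) gy sp(1) \<sigma>y y' cj_ab ab True in auto)
  next
    case False
    then have units: "e \<noteq> 0 \<and> v e = 0" if "e \<in> {a, b}" for e using cases that by blast
    have inj: "\<beta> *v w \<notin> L (j - int n + 1)"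
      if e: "e \<in> {a, b}" and w: "w \<in> chain.eigen ?y e j" "w \<notin> L (j + 1)" for e j w
    proof
      assume "\<beta> *v w \<in> L (j - int n + 1)"
      then have "\<beta> *v (\<beta> *v w) \<in> L (j - 2 * int n + 1)" using \<beta>(1) by (auto intro: chain.latD)
      then have "p ^ n *s (\<beta> *v (\<beta> *v w)) \<in> L (j + 1)" by (rule chain.L_scale[OF p_n]) simp
      then have yw: "?y *v w \<in> L (j + 1)"
        by (simp add: y_of_def mat_mult_vec flip: matrix_vector_mul_assoc)
      have "?y *v w - e *s w \<in> L (j + 1)"
        using w(1) by (simp add: chain.eigen_def matrix_vector_mult_diff_rdistrib mat_mult_vec)
      then have "e *s w \<in> L (j + 1)" using chain.L_diff[OF yw] by fastforce
      then show False using w(2) units[OF e] by (simp add: chain.L_scale_iff)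
    qed
    show ?thesis
      by (rule isometry_preserves_chain[of g ?y' ?y \<gamma> \<beta> a b "int n"])
         (use g gy sp(1) \<sigma>y y' cj_ab ab False n \<beta>(1) \<gamma> \<beta>y inj in auto)
  qed
qed

text \<open>Both \<open>g\<close> and its inverse preserve the lattice sequence, so that \<open>g\<close> normalizes \<open>\<aa>\<^sub>-\<^sub>m\<close> and the passage to
  conjugate representatives does not affect the characters.\<close>

lemma conjugate_strata:
  assumes \<Omega>: "additive_character_conductor_p v0 \<Omega>"
    and p: "p \<noteq> 0" "v p = 1" "cj p = p" and n: "n = 2 * m + 1"
    and \<beta>: "\<beta> \<in> lat (- int n)" "\<sigma> \<beta> = - \<beta>" and \<gamma>: "\<gamma> \<in> lat (- int n)" "\<sigma> \<gamma> = - \<gamma>"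
    and sp: "chain.splits (y_of p n \<beta>) a b" "chain.splits (y_of p n \<gamma>) a b"
    and cj_ab: "cj a = a" "cj b = b" and ab: "a - b \<noteq> 0" "v (a - b) = 0"
    and cases: "even D \<or> (\<forall>e\<in>{a, b}. e \<noteq> 0 \<and> v e = 0)"
    and smooth: "smooth_rep v cj scl \<rho>" and irred: "irreducible_rep cj scl \<rho>"
    and con_\<beta>: "contains_stratum \<iota> cj \<Omega> scl \<rho> L m \<beta>"
    and con_\<gamma>: "contains_stratum \<iota> cj \<Omega> scl \<rho> L m \<gamma>"
  shows "\<exists>g\<in>P_filtration cj L 0. \<forall>x\<in>P_filtration cj L (m + 1).
    psi \<iota> cj \<Omega> \<gamma> x = psi \<iota> cj \<Omega> \<beta> (g ** x ** matrix_inv g)"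
proof -
  obtain g where g: "g \<in> G" and agree: "\<And>q. q \<in> P_filtration cj L (m + 1) \<Longrightarrow>
      \<sigma> g ** q ** g \<in> P_filtration cj L (m + 1) \<Longrightarrow> psi \<iota> cj \<Omega> \<beta> q = psi \<iota> cj \<Omega> \<gamma> (\<sigma> g ** q ** g)"
    using intertwining_exists[OF \<Omega> \<beta>(1) \<gamma>(1) n smooth irred con_\<beta> con_\<gamma>] by blast
  obtain Y1 Y2 where Y: "Y1 \<in> lat (- int m)" "Y2 \<in> lat (- int m)" "\<sigma> Y1 = - Y1" "\<sigma> Y2 = - Y2"
      "\<beta> - Y1 = g ** (\<gamma> + Y2) ** \<sigma> g"
    using conjugate_representatives[OF \<Omega> g \<beta> \<gamma> n agree] by blast
  define \<beta>1 where "\<beta>1 = \<beta> + (- Y1)"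
  define \<gamma>1 where "\<gamma>1 = \<gamma> + Y2"
  have conj: "\<beta>1 = g ** \<gamma>1 ** \<sigma> g" using Y(5) by (simp add: \<beta>1_def \<gamma>1_def)
  have Y1': "- Y1 \<in> lat (- int m)" using Y(1) by (rule chain.lat_minus)
  have \<beta>1: "\<beta>1 \<in> lat (- int n)" "\<sigma> \<beta>1 = - \<beta>1" "chain.splits (y_of p n \<beta>1) a b"
  proof -
    show "\<beta>1 \<in> lat (- int n)" unfolding \<beta>1_def
      by (rule chain.lat_add[OF \<beta>(1) chain.lat_mono[OF Y1']]) (use n in simp)
    show "\<sigma> \<beta>1 = - \<beta>1" by (simp only: \<beta>1_def adj_add adj_minus \<beta>(2) Y(3) minus_add_distrib)
    show "chain.splits (y_of p n \<beta>1) a b" unfolding \<beta>1_def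
      by (rule splits_perturb[OF p(1,2) n \<beta>(1) Y1' sp(1)])
  qed
  have \<gamma>1: "\<gamma>1 \<in> lat (- int n)" "\<sigma> \<gamma>1 = - \<gamma>1" "chain.splits (y_of p n \<gamma>1) a b"
  proof -
    show "\<gamma>1 \<in> lat (- int n)" unfolding \<gamma>1_def
      by (rule chain.lat_add[OF \<gamma>(1) chain.lat_mono[OF Y(2)]]) (use n in simp)
    show "\<sigma> \<gamma>1 = - \<gamma>1" by (simp only: \<gamma>1_def adj_add \<gamma>(2) Y(4) minus_add_distrib)
    show "chain.splits (y_of p n \<gamma>1) a b" unfolding \<gamma>1_def
      by (rule splits_perturb[OF p(1,2) n \<gamma>(1) Y(2) sp(2)])
  qed
  have odd: "odd n" using n by simp
  have "\<beta>1 ** g = g ** \<gamma>1" unfolding conj using G_cancel[OF g] by simp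
  then have g0: "g \<in> lat 0"
    by (rule conjugator_preserves_chain[OF p odd \<beta>1(1,2) \<gamma>1(1) g _ \<beta>1(3) \<gamma>1(3) cj_ab ab cases])
  have "\<gamma>1 ** \<sigma> g = \<sigma> g ** \<beta>1" unfolding conj using G_cancel[OF g] by (simp add: matrix_mul_assoc G_adj[OF g])
  then have \<sigma>g0: "\<sigma> g \<in> lat 0"
    by (rule conjugator_preserves_chain[OF p odd \<gamma>1(1,2) \<beta>1(1) G_adj(4)[OF g] _ \<gamma>1(3) \<beta>1(3) cj_ab ab cases])
  have "psi \<iota> cj \<Omega> \<gamma> x = psi \<iota> cj \<Omega> \<beta> (g ** x ** matrix_inv g)"
    if x: "x \<in> P_filtration cj L (m + 1)" for x
  proof -
    define E where "E = Y2 + \<sigma> g ** Y1 ** g"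
    have "\<sigma> g ** Y1 ** g \<in> lat (- int m)"
      by (rule chain.lat_mult[OF chain.lat_mult[OF \<sigma>g0 Y(1) order_refl] g0]) simp
    then have E: "E \<in> lat (- int m)" unfolding E_def using Y(2) by (intro chain.lat_add)
    have x1: "x - mat 1 \<in> lat (int m + 1)" using x by (simp add: P_iff add.commute)
    have "E ** (x - mat 1) \<in> lat 1" by (rule chain.lat_mult[OF E x1]) simp
    then have small: "\<Omega> (Tr (trace (E ** (x - mat 1)))) = 1"
      using \<Omega> Tr_ideal chain.trace_ideal unfolding additive_character_conductor_p_def by blast
    have "\<sigma> g ** \<beta> ** g = \<sigma> g ** (\<beta>1 + Y1) ** g" by (simp add: \<beta>1_def)
    also have "\<dots> = \<gamma> + E"
      unfolding conj E_def \<gamma>1_def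
      by (simp add: matrix_add_ldistrib matrix_add_rdistrib' G_cancel[OF g] add.assoc) 
         (simp add: matrix_mul_assoc G_adj[OF g] G_cancel[OF g])
    finally have conj_\<beta>: "\<sigma> g ** \<beta> ** g = \<gamma> + E" .
    have "g ** x ** \<sigma> g - mat 1 = g ** (x - mat 1) ** \<sigma> g"
      by (simp add: matrix_diff_ldistrib matrix_diff_rdistrib G_adj[OF g])
    then have "trace (\<beta> ** (g ** x ** \<sigma> g - mat 1)) = trace ((\<beta> ** g ** (x - mat 1)) ** \<sigma> g)"
      by (simp only: matrix_mul_assoc)
    also have "\<dots> = trace (\<sigma> g ** (\<beta> ** g ** (x - mat 1)))" by (rule trace_mul_sym)
    also have "\<sigma> g ** (\<beta> ** g ** (x - mat 1)) = (\<gamma> + E) ** (x - mat 1)"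
      by (simp only: conj_\<beta>[symmetric] matrix_mul_assoc)
    also have "trace \<dots> = trace (\<gamma> ** (x - mat 1)) + trace (E ** (x - mat 1))"
      by (simp only: matrix_add_rdistrib' trace_add)
    finally show ?thesis
      using \<Omega> small by (simp add: psi_def G_adj[OF g] Tr_add additive_character_conductor_p_def)
  qed
  moreover have "g \<in> P_filtration cj L 0" using g g0 by (simp add: P_filtration_def)
  ultimately show ?thesis by blast
qed

end

theorem theorem3p9:
  fixes v0 :: "'k::field \<Rightarrow> int" and red0 :: "'k \<Rightarrow> 'r0::field"
    and v :: "'f::field \<Rightarrow> int" and red :: "'f \<Rightarrow> 'r::field"
    and \<iota> :: "'k \<Rightarrow> 'f" and \<epsilon> \<pi>0 :: 'k and s :: 'f and cj :: "'f \<Rightarrow> 'f"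
    and \<Omega> :: "'k \<Rightarrow> complex"
    and \<Lambda> :: "int \<Rightarrow> ('f^4) set" and n :: nat
    and \<beta> \<gamma> :: "'f^4^4" and a b :: 'r
    and scl :: "complex \<Rightarrow> 'v::ab_group_add \<Rightarrow> 'v" and \<rho> :: "'f^4^4 \<Rightarrow> 'v \<Rightarrow> 'v"
  assumes ext: "unramified_quadratic_ext v0 red0 v red \<iota> \<epsilon> s cj"
    and uniformizer: "\<pi>0 \<noteq> 0" "v0 \<pi>0 = 1"
    and character: "additive_character_conductor_p v0 \<Omega>"
    and Lambda: "is_seq1 v (\<iota> \<pi>0) \<Lambda> \<or> is_seq2 v cj (\<iota> \<pi>0) \<Lambda>"
    and n: "n > 0" "odd n"
    and skew_beta: "skew_stratum v cj (\<iota> \<pi>0) \<Lambda> n (n div 2) \<beta>"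
    and skew_gamma: "skew_stratum v cj (\<iota> \<pi>0) \<Lambda> n (n div 2) \<gamma>"
    and ab: "a \<in> red ` \<iota> ` val_ring v0" "b \<in> red ` \<iota> ` val_ring v0" "a \<noteq> b"
    and phi_beta: "phi_poly red (\<iota> \<pi>0) \<Lambda> n \<beta> = [:- a, 1:] ^ 2 * [:- b, 1:] ^ 2"
    and phi_gamma: "phi_poly red (\<iota> \<pi>0) \<Lambda> n \<gamma> = [:- a, 1:] ^ 2 * [:- b, 1:] ^ 2"
    and nondeg: "a * b \<noteq> 0 \<or> is_seq2 v cj (\<iota> \<pi>0) \<Lambda>"
    and smooth: "smooth_rep v cj scl \<rho>"
    and irred: "irreducible_rep cj scl \<rho>"
    and contains_beta: "contains_stratum \<iota> cj \<Omega> scl \<rho> \<Lambda> (n div 2) \<beta>"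
    and contains_gamma: "contains_stratum \<iota> cj \<Omega> scl \<rho> \<Lambda> (n div 2) \<gamma>"
  shows "\<exists>g\<in>P_filtration cj \<Lambda> 0. \<forall>x\<in>P_filtration cj \<Lambda> (n div 2 + 1).
           psi \<iota> cj \<Omega> \<gamma> x = psi \<iota> cj \<Omega> \<beta> (g ** x ** matrix_inv g)"
proof -
  interpret unramified_quadratic_ext v0 red0 v red \<iota> \<epsilon> s cj by (rule ext)
  define p where "p = \<iota> \<pi>0"
  have p: "p \<noteq> 0" "v p = 1" "cj p = p" using uniformizer by (simp_all add: p_def val_emb)
  define m where "m = n div 2"
  have nm: "n = 2 * m + 1" using n(2) by (simp add: m_def)
  obtain a0 b0 where a0: "a0 \<in> val_ring v0" "a = red (\<iota> a0)" and b0: "b0 \<in> val_ring v0" "b = red (\<iota> b0)"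
    using ab by blast
  have ring: "\<iota> a0 \<in> val_ring v" "\<iota> b0 \<in> val_ring v" using a0 b0 by simp_all
  have red_ne: "red (\<iota> a0) \<noteq> red (\<iota> b0)" using ab a0 b0 by simp
  then have "red (\<iota> a0 - \<iota> b0) \<noteq> 0" using ring by (simp add: ext.red_diff)
  then have diff: "\<iota> a0 - \<iota> b0 \<noteq> 0" "v (\<iota> a0 - \<iota> b0) = 0"
    using ext.red_nonzero_unit[OF ext.ideal_diff[OF ring]] by blast+
  note facts = skew_beta skew_gamma phi_beta phi_gamma contains_beta contains_gamma
  show ?thesis
  proof (cases "is_seq2 v cj (\<iota> \<pi>0) \<Lambda>")
    case True
    interpret c: u22_chain v0 red0 v red \<iota> \<epsilon> s cj wt2 2 by (rule u22_chain_wt2)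
    have \<Lambda>: "\<Lambda> = c.L" by (rule seq2_eq_Lam[OF p(1,2)]) (use True in \<open>simp add: p_def\<close>)
    have y: "y_elt p c.L n X = mat (p ^ n) ** (X ** X)" for X
      by (rule c.chain.y_elt_L[OF p(1,2), of 1 3]) (use n in simp_all)
    have X: "X \<in> c.lat (- int n) \<and> \<sigma> X = - X \<and> c.chain.splits (c.y_of p n X) (\<iota> a0) (\<iota> b0)"
      if "skew_stratum v cj p \<Lambda> n m X" "phi_poly red p \<Lambda> n X = [:- a, 1:] ^ 2 * [:- b, 1:] ^ 2" for X
    proof -
      have X: "X \<in> c.lat (- int n)" "\<sigma> X = - X"
        using that(1) by (auto simp: skew_stratum_def Lie_filtration_def c.skew_iff \<Lambda>)
      then show ?thesis
        using ext.splits_wt2[OF p(1,2) nm X(1) ring red_ne] that(2)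
        by (simp add: phi_poly_def \<Lambda> y c.y_of_def a0 b0)
    qed
    show ?thesis
      using c.conjugate_strata[OF character p nm _ _ _ _ _ _ _ _ diff _ smooth irred, of \<beta> \<gamma>]
        X[of \<beta>] X[of \<gamma>] facts by (simp add: p_def m_def \<Lambda>)
  next
    case False
    then have seq1: "is_seq1 v p \<Lambda>" and ab0: "a \<noteq> 0" "b \<noteq> 0" using Lambda nondeg by (auto simp: p_def)
    have units: "\<forall>e\<in>{\<iota> a0, \<iota> b0}. e \<noteq> 0 \<and> v e = 0"
      using ext.red_nonzero_unit[OF ring(1)] ext.red_nonzero_unit[OF ring(2)]
        ab0(1)[unfolded a0(2)] ab0(2)[unfolded b0(2)] by simp
    interpret c: u22_chain v0 red0 v red \<iota> \<epsilon> s cj wt1 1 by (rule u22_chain_wt1)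
    have \<Lambda>: "\<Lambda> = c.L" by (rule seq1_eq_Lam[OF p(1,2) seq1])
    have y: "y_elt p c.L n X = mat (p ^ n) ** (X ** X)" for X
      by (rule c.chain.y_elt_L[OF p(1,2), of 1 3]) (use n in simp_all)
    have X: "X \<in> c.lat (- int n) \<and> \<sigma> X = - X \<and> c.chain.splits (c.y_of p n X) (\<iota> a0) (\<iota> b0)"
      if "skew_stratum v cj p \<Lambda> n m X" "phi_poly red p \<Lambda> n X = [:- a, 1:] ^ 2 * [:- b, 1:] ^ 2" for X
    proof -
      have X: "X \<in> c.lat (- int n)" "\<sigma> X = - X"
        using that(1) by (auto simp: skew_stratum_def Lie_filtration_def c.skew_iff \<Lambda>)
      then show ?thesis
        using ext.splits_wt1[OF p(1,2) nm X(1) ring red_ne] that(2)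
        by (simp add: phi_poly_def \<Lambda> y c.y_of_def a0 b0)
    qed
    show ?thesis
      using c.conjugate_strata[OF character p nm _ _ _ _ _ _ _ _ diff _ smooth irred, of \<beta> \<gamma>]
        X[of \<beta>] X[of \<gamma>] units facts by (simp add: p_def m_def \<Lambda>)
  qed
qed

end
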